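(* Let $f$ satisfy the codifferentiability conditions of order $p\in[1,+\infty]$, and let either $1<p\le+\infty$, or ($p=1$ and) the set $\Omega$ be bounded and have the segment property and the set-valued maps $\underline{d}_{u,\xi}f$ and $\overline{d}_{u,\xi}f$ have the form $$\underline{d}_{u,\xi}f(x,u,\xi)=\operatorname{co}\{(f_i(x,u,\xi),v_{1i},v_{2i})\mid i\in I\},\qquad \overline{d}_{u,\xi}f(x,u,\xi)=\operatorname{co}\{(g_j(x,u,\xi),w_{1j},w_{2j})\mid j\in J\}$$ for some (constant) vectors $v_{1i},w_{1j}\in\mathbb{R}^m$, $v_{2i},w_{2j}\in\mathbb{R}^{m\times d}$ and Carathéodory functions $f_i,g_j:\Omega\times\mathbb{R}^m\times\mathbb{R}^{m\times d}\to\mathbb{R}$, $i\in I=\{1,\dots,\ell\}$, $j\in J=\{1,\dots,r\}$. Then the functional $\mathcal{I}(u)=\int_\Omega f(x,u(x),\nabla u(x))\,dx$ is locally Lipschitz continuous on $W^{1,p}(\Omega;\mathbb{R}^m)$, Hadamard quasidifferentiable at every $u\in W^{1,p}(\Omega;\mathbb{R}^m)$, and the pair $\mathscr{D}\mathcal{I}(u)=[\underline{\partial}\mathcal{I}(u),\overline{\partial}\mathcal{I}(u)]$ with $$\underline{\partial}\mathcal{I}(u)=\{x^*\in(W^{1,p}(\Omega;\mathbb{R}^m))^*\mid(0,x^* )\in\underline{d}\mathcal{I}(u)\},\quad\overline{\partial}\mathcal{I}(u)=\{y^*\in(W^{1,p}(\Omega;\mathbb{R}^m))^*\mid(0,y^*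 )\in\overline{d}\mathcal{I}(u)\}$$ is a quasidifferential of $\mathcal{I}$ at $u$. Here $\underline{d}\mathcal{I}(u)$ (respectively $\overline{d}\mathcal{I}(u)$) is the set of all pairs $(A,x^* )\in\mathbb{R}\times(W^{1,p}(\Omega;\mathbb{R}^m))^*$ of the form $$A=\int_\Omega a(x)\,dx,\qquad\langle x^*,h\rangle=\int_\Omega\big(\langle v_1(x),h(x)\rangle+\langle v_2(x),\nabla h(x)\rangle\big)dx\quad\forall h\in W^{1,p}(\Omega;\mathbb{R}^m),$$ where $(a(\cdot),v_1(\cdot),v_2(\cdot))$ is a measurable selection of $\underline{d}_{u,\xi}f(\cdot,u(\cdot),\nabla u(\cdot))$ (respectively of $\overline{d}_{u,\xi}f(\cdot,u(\cdot),\nabla u(\cdot))$).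
   Context: **Codifferentials and quasidifferentials.** Let $X$ be a real Banach space, $X^*$ its dual, $U\subseteq X$ open. A function $F:U\to\mathbb{R}$ is codifferentiable at $x\in U$ if there is a pair $DF(x)=[\underline{d}F(x),\overline{d}F(x)]$ (a codifferential) of convex subsets of $\mathbb{R}\times X^*$, compact in the product of the standard topology and the weak$^*$ topology, such that $\Phi_F(x,0)=\Psi_F(x,0)=0$ and for all $\Delta x\in X$ $$\lim_{\alpha\to+0}\frac1\alpha\big|F(x+\alpha\Delta x)-F(x)-\Phi_F(x,\alpha\Delta x)-\Psi_F(x,\alpha\Delta x)\big|=0,$$ where $\Phi_F(x,\Delta x)=\max_{(a,x^* )\in\underline{d}F(x)}(a+\langle x^*,\Delta x\rangle)$ and $\Psi_F(x,\Delta x)=\min_{(b,y^* )\in\overline{d}F(x)}(b+\langle y^*,\Delta x\rangle)$. Codifferentials are not unique. $F$ is quasidifferentiable at $x$ if the directional derivative $F'(x,v)=\lim_{\alpha\to+0}(F(x+\alpha v)-F(x))/\alpha$ exists and is finite for all $v\in X$ and there is a pair $[\underline{\partial}F(x),\overline{\partial}F(x)]$ (a quasidifferential) of convex weak$^*$ compact subsets of $X^*$ with $F'(x,v)=\max_{x^*\in\underline{\partial}F(x)}\langle x^*,v\rangle+\min_{y^*\in\overline{\partial}F(x)}\langle y^*,v\rangle$ for all $v\in X$. It is Hadamard quasidifferentiable at $x$ if in addition, for every $v\in X$ and $\varepsilon>0$, there is $\delta>0$ such that $|(F(x+\alpha v')-F(x))/\alpha-F'(x,v)|<\varepsilon$ for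 all $0<\alpha<\delta$ and $\|v'-v\|\le\delta$. **Setting.** $\Omega\subseteq\mathbb{R}^d$ is an open set (not necessarily bounded), $f:\Omega\times\mathbb{R}^m\times\mathbb{R}^{m\times d}\to\mathbb{R}$, $f=f(x,u,\xi)$. $W^{1,p}(\Omega;\mathbb{R}^m)$, $1\le p\le+\infty$, is the Sobolev space with norm $\|u\|_{1,p}=(\|u\|_p^p+\|\nabla u\|_p^p)^{1/p}$ for $p<+\infty$, $\|u\|_{1,\infty}=\max\{\|u\|_\infty,\|\nabla u\|_\infty\}$; $1/p+1/p'=1$; $|\cdot|$ is the Euclidean norm; $\operatorname{co}$ is the convex hull. For a.e. $x\in\Omega$ the function $(u,\xi)\mapsto f(x,u,\xi)$ is assumed codifferentiable at every point of $\mathbb{R}^m\times\mathbb{R}^{m\times d}$; $[\underline{d}_{u,\xi}f(x,u,\xi),\overline{d}_{u,\xi}f(x,u,\xi)]$ denotes a fixed choice of its codifferential, consisting of convex compact subsets of $\mathbb{R}\times\mathbb{R}^m\times\mathbb{R}^{m\times d}$. A (set-valued or single-valued) map $F(x,y)$ is a Carathéodory map if it is measurable in $x$ for every $y$ and continuous in $y$ for (a.e.) every $x$ (for compact-valued maps into $\mathbb{R}^k$: Hausdorff continuous). A measurable selection of a multifunction $G$ on $\Omega$ is a measurable $z$ with $z(x)\in G(x)$ for a.e. $x$. **Codifferentiability conditions of order $p$.** $f$ satisfies them if: (1) $f$ is a Carathéodory function, and: if $1\le p<+\infty$, there are an a.e. nonnegative $\beta\in L^1(\Omega)$ and $C>0$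 with $|f(x,u,\xi)|\le\beta(x)+C(|u|^p+|\xi|^p)$ for a.e. $x$ and all $(u,\xi)$; if $p=+\infty$, for any $N>0$ there is an a.e. nonnegative $\beta_N\in L^1(\Omega)$ with $|f(x,u,\xi)|\le\beta_N(x)$ for a.e. $x$ and all $(u,\xi)$ with $\max\{|u|,|\xi|\}\le N$; (2) for a.e. $x$ the function $(u,\xi)\mapsto f(x,u,\xi)$ is codifferentiable on $\mathbb{R}^m\times\mathbb{R}^{m\times d}$, both $\underline{d}_{u,\xi}f$ and $\overline{d}_{u,\xi}f$ are Carathéodory maps, and: if $1\le p<+\infty$, there are $C>0$ and a.e. nonnegative $\beta\in L^1(\Omega)$, $\gamma\in L^{p'}(\Omega)$ such that for a.e. $x$, all $(u,\xi)$, all $(a,v_1,v_2)\in\underline{d}_{u,\xi}f(x,u,\xi)$ and $(b,w_1,w_2)\in\overline{d}_{u,\xi}f(x,u,\xi)$: $\max\{|a|,|b|\}\le\beta(x)+C(|u|^p+|\xi|^p)$ and $\max\{|v_1|,|v_2|,|w_1|,|w_2|\}\le\gamma(x)+C(|u|^{p-1}+|\xi|^{p-1})$; if $p=+\infty$, for any $N>0$ there is an a.e. nonnegative $\beta_N\in L^1(\Omega)$ such that $\max\{|a|,|v_1|,|v_2|,|b|,|w_1|,|w_2|\}\le\beta_N(x)$ for a.e. $x$, for all such triples and all $(u,\xi)$ with $\max\{|u|,|\xi|\}\le N$. **Segment property.** $\Omega$ has the segment property if for every $x\in\partial\Omega$ there are a neighbourhood $U_x\subset\mathbb{R}^d$ of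 $x$ and a nonzero $y_x\in\mathbb{R}^d$ such that for any $z\in\operatorname{cl}\Omega\cap U_x$ one has $z+ty_x\in\Omega$ for all $t\in(0,1)$. *)

theory Defs
  imports "HOL-Analysis.Analysis" "HOL-Probability.Essential_Supremum"
begin

section \<open>Lebesgue and Sobolev spaces on an open set\<close>

definition in_Lp :: "ennreal \<Rightarrow> (real^'d) set \<Rightarrow> (real^'d \<Rightarrow> 'b::euclidean_space) \<Rightarrow> bool" where
  "in_Lp p \<Omega> u \<longleftrightarrow> u \<in> borel_measurable (lebesgue_on \<Omega>) \<and>
     (if p = \<infinity> then esssup (lebesgue_on \<Omega>) (\<lambda>x. ennreal (norm (u x))) < \<infinity>
      else integrable (lebesgue_on \<Omega>) (\<lambda>x. norm (u x) powr enn2real p))"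

definition Lp_norm :: "ennreal \<Rightarrow> (real^'d) set \<Rightarrow> (real^'d \<Rightarrow> 'b::euclidean_space) \<Rightarrow> real" where
  "Lp_norm p \<Omega> u =
     (if p = \<infinity> then enn2real (esssup (lebesgue_on \<Omega>) (\<lambda>x. ennreal (norm (u x))))
      else (LINT x|lebesgue_on \<Omega>. norm (u x) powr enn2real p) powr (1 / enn2real p))"

text \<open>The solution \<open>p'\<close> of \<open>1/p + 1/p' = 1\<close> in \<open>[1,\<infinity>]\<close>, using \<open>1/\<infinity> = 0\<close> and \<open>1/0 = \<infinity>\<close>.\<close>

definition conj_exponent :: "ennreal \<Rightarrow> ennreal" where
  "conj_exponent p = inverse (1 - inverse p)"

definition partial_deriv :: "'d \<Rightarrow> (real^'d \<Rightarrow> real) \<Rightarrow> real^'d \<Rightarrow> real" where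
  "partial_deriv j g x = frechet_derivative g (at x) (axis j 1)"

text \<open>All iterated partial derivatives exist and are differentiable, i.e.\ \<open>g\<close> is
  \<open>C\<^sup>\<infinity>\<close> on the whole space.\<close>

definition smooth_fun :: "(real^'d \<Rightarrow> real) \<Rightarrow> bool" where
  "smooth_fun g \<longleftrightarrow> (\<forall>js x. foldr partial_deriv js g differentiable (at x))"

definition test_fun :: "(real^'d) set \<Rightarrow> (real^'d \<Rightarrow> real) \<Rightarrow> bool" where
  "test_fun \<Omega> \<phi> \<longleftrightarrow> smooth_fun \<phi> \<and> compact (closure {x. \<phi> x \<noteq> 0}) \<and> closure {x. \<phi> x \<noteq> 0} \<subseteq> \<Omega>"

definition locally_integrable :: "(real^'d) set \<Rightarrow> (real^'d \<Rightarrow> 'b::euclidean_space) \<Rightarrow> bool" where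
  "locally_integrable \<Omega> u \<longleftrightarrow> (\<forall>K. compact K \<and> K \<subseteq> \<Omega> \<longrightarrow> integrable (lebesgue_on K) u)"

text \<open>A gradient is an \<open>m \<times> d\<close> matrix, with entry \<open>g x $ i $ j\<close> the weak derivative of
  \<open>u\<^sub>i\<close> in direction \<open>j\<close>. The norm and the inner product on the type of matrices are the
  Euclidean (Frobenius) ones.\<close>

definition has_weak_gradient ::
    "(real^'d) set \<Rightarrow> (real^'d \<Rightarrow> real^'m) \<Rightarrow> (real^'d \<Rightarrow> real^'d^'m) \<Rightarrow> bool" where
  "has_weak_gradient \<Omega> u g \<longleftrightarrow> locally_integrable \<Omega> u \<and> locally_integrable \<Omega> g \<and>
     (\<forall>\<phi> i j. test_fun \<Omega> \<phi> \<longrightarrow>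
        (LINT x|lebesgue_on \<Omega>. u x $ i * partial_deriv j \<phi> x) =
        - (LINT x|lebesgue_on \<Omega>. g x $ i $ j * \<phi> x))"

text \<open>The weak gradient is unique only up to null sets; one representative is chosen.\<close>

definition weak_grad :: "(real^'d) set \<Rightarrow> (real^'d \<Rightarrow> real^'m) \<Rightarrow> real^'d \<Rightarrow> real^'d^'m" where
  "weak_grad \<Omega> u = (SOME g. has_weak_gradient \<Omega> u g)"

text \<open>\<open>W\<^sup>1\<^sup>,\<^sup>p(\<Omega>; \<real>\<^sup>m)\<close> is represented by the set of its representatives, functions whose
  values outside \<open>\<Omega>\<close> are irrelevant; \<open>W1p_norm\<close> vanishes exactly on the representatives of
  the zero class.\<close>

definition W1p :: "ennreal \<Rightarrow> (real^'d) set \<Rightarrow> (real^'d \<Rightarrow> real^'m) set" where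
  "W1p p \<Omega> = {u. in_Lp p \<Omega> u \<and> (\<exists>g. has_weak_gradient \<Omega> u g) \<and> in_Lp p \<Omega> (weak_grad \<Omega> u)}"

definition W1p_norm :: "ennreal \<Rightarrow> (real^'d) set \<Rightarrow> (real^'d \<Rightarrow> real^'m) \<Rightarrow> real" where
  "W1p_norm p \<Omega> u =
     (if p = \<infinity> then max (Lp_norm p \<Omega> u) (Lp_norm p \<Omega> (weak_grad \<Omega> u))
      else (Lp_norm p \<Omega> u powr enn2real p + Lp_norm p \<Omega> (weak_grad \<Omega> u) powr enn2real p)
             powr (1 / enn2real p))"

section \<open>Quasidifferentiability on a space of functions\<close>

text \<open>A normed space of classes of functions is given by the set \<open>X\<close> of representatives, closed
  under pointwise addition and scaling, and a seminorm \<open>N\<close> on \<open>X\<close>. A linear functional bounded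
  with respect to \<open>N\<close> is constant on classes, so the dual below is that of the normed quotient.
  Its elements are made \<open>undefined\<close> outside \<open>X\<close>, so that they are points of a product
  topology over \<open>X\<close>.\<close>

definition dual_space ::
    "('a \<Rightarrow> 'b::real_normed_vector) set \<Rightarrow> (('a \<Rightarrow> 'b) \<Rightarrow> real) \<Rightarrow> (('a \<Rightarrow> 'b) \<Rightarrow> real) set" where
  "dual_space X N = {\<phi> \<in> extensional X.
     (\<forall>u\<in>X. \<forall>v\<in>X. \<phi> (\<lambda>x. u x + v x) = \<phi> u + \<phi> v) \<and>
     (\<forall>c. \<forall>u\<in>X. \<phi> (\<lambda>x. c *\<^sub>R u x) = c * \<phi> u) \<and>
     (\<exists>C. \<forall>u\<in>X. \<bar>\<phi> u\<bar> \<le> C * N u)}"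

definition weak_star_topology ::
    "('a \<Rightarrow> 'b::real_normed_vector) set \<Rightarrow> (('a \<Rightarrow> 'b) \<Rightarrow> real) \<Rightarrow> (('a \<Rightarrow> 'b) \<Rightarrow> real) topology" where
  "weak_star_topology X N =
     subtopology (product_topology (\<lambda>_. euclideanreal) X) (dual_space X N)"

definition convex_functionals :: "('a \<Rightarrow> 'b) set \<Rightarrow> (('a \<Rightarrow> 'b) \<Rightarrow> real) set \<Rightarrow> bool" where
  "convex_functionals X K \<longleftrightarrow> (\<forall>\<phi>\<in>K. \<forall>\<psi>\<in>K. \<forall>t\<in>{0..1}.
     restrict (\<lambda>u. (1 - t) * \<phi> u + t * \<psi> u) X \<in> K)"

definition has_dir_deriv ::
    "(('a \<Rightarrow> 'b::real_normed_vector) \<Rightarrow> real) \<Rightarrow> ('a \<Rightarrow> 'b) \<Rightarrow> ('a \<Rightarrow> 'b) \<Rightarrow> real \<Rightarrow> bool" where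
  "has_dir_deriv F u v D \<longleftrightarrow>
     ((\<lambda>\<alpha>. (F (\<lambda>x. u x + \<alpha> *\<^sub>R v x) - F u) / \<alpha>) \<longlongrightarrow> D) (at_right 0)"

text \<open>Supremum and infimum are attained, since evaluation at \<open>v\<close> is weak\<open>*\<close> continuous and
  \<open>P\<close> and \<open>Q\<close> are nonempty and weak\<open>*\<close> compact. Nonemptiness is implicit in the maximum and
  the minimum of the usual definition.\<close>

definition is_quasidifferential ::
    "('a \<Rightarrow> 'b::real_normed_vector) set \<Rightarrow> (('a \<Rightarrow> 'b) \<Rightarrow> real) \<Rightarrow> (('a \<Rightarrow> 'b) \<Rightarrow> real) \<Rightarrow> ('a \<Rightarrow> 'b)
      \<Rightarrow> (('a \<Rightarrow> 'b) \<Rightarrow> real) set \<Rightarrow> (('a \<Rightarrow> 'b) \<Rightarrow> real) set \<Rightarrow> bool" where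
  "is_quasidifferential X N F u P Q \<longleftrightarrow>
     P \<noteq> {} \<and> convex_functionals X P \<and> compactin (weak_star_topology X N) P \<and>
     Q \<noteq> {} \<and> convex_functionals X Q \<and> compactin (weak_star_topology X N) Q \<and>
     (\<forall>v\<in>X. has_dir_deriv F u v ((SUP \<phi>\<in>P. \<phi> v) + (INF \<psi>\<in>Q. \<psi> v)))"

definition hadamard_quasidifferentiable ::
    "('a \<Rightarrow> 'b::real_normed_vector) set \<Rightarrow> (('a \<Rightarrow> 'b) \<Rightarrow> real) \<Rightarrow> (('a \<Rightarrow> 'b) \<Rightarrow> real) \<Rightarrow> ('a \<Rightarrow> 'b)
      \<Rightarrow> bool" where
  "hadamard_quasidifferentiable X N F u \<longleftrightarrow>
     (\<exists>P Q. is_quasidifferential X N F u P Q) \<and>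
     (\<forall>v\<in>X. \<exists>D. has_dir_deriv F u v D \<and>
        (\<forall>\<epsilon>>0. \<exists>\<delta>>0. \<forall>\<alpha>. \<forall>w\<in>X. 0 < \<alpha> \<and> \<alpha> < \<delta> \<and> N (\<lambda>x. w x - v x) \<le> \<delta> \<longrightarrow>
           \<bar>(F (\<lambda>x. u x + \<alpha> *\<^sub>R w x) - F u) / \<alpha> - D\<bar> < \<epsilon>))"

definition locally_lipschitz ::
    "('a \<Rightarrow> 'b::real_normed_vector) set \<Rightarrow> (('a \<Rightarrow> 'b) \<Rightarrow> real) \<Rightarrow> (('a \<Rightarrow> 'b) \<Rightarrow> real) \<Rightarrow> bool" where
  "locally_lipschitz X N F \<longleftrightarrow> (\<forall>u\<in>X. \<exists>\<epsilon>>0. \<exists>L. \<forall>v\<in>X. \<forall>w\<in>X.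
     N (\<lambda>x. v x - u x) < \<epsilon> \<and> N (\<lambda>x. w x - u x) < \<epsilon> \<longrightarrow>
     \<bar>F v - F w\<bar> \<le> L * N (\<lambda>x. v x - w x))"

section \<open>Codifferentials in Euclidean spaces\<close>

text \<open>The dual of a Euclidean space is identified with the space by the inner product, and its
  weak\<open>*\<close> topology with the usual one.\<close>

definition codiff_Phi :: "(real \<times> 'a::euclidean_space) set \<Rightarrow> 'a \<Rightarrow> real" where
  "codiff_Phi D h = (SUP (a, v)\<in>D. a + v \<bullet> h)"

definition codiff_Psi :: "(real \<times> 'a::euclidean_space) set \<Rightarrow> 'a \<Rightarrow> real" where
  "codiff_Psi D h = (INF (b, w)\<in>D. b + w \<bullet> h)"

definition is_codifferential ::
    "('a::euclidean_space \<Rightarrow> real) \<Rightarrow> 'a \<Rightarrow> (real \<times> 'a) set \<Rightarrow> (real \<times> 'a) set \<Rightarrow> bool" where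
  "is_codifferential F y D E \<longleftrightarrow>
     D \<noteq> {} \<and> convex D \<and> compact D \<and> E \<noteq> {} \<and> convex E \<and> compact E \<and>
     codiff_Phi D 0 = 0 \<and> codiff_Psi E 0 = 0 \<and>
     (\<forall>h. ((\<lambda>\<alpha>. \<bar>F (y + \<alpha> *\<^sub>R h) - F y - codiff_Phi D (\<alpha> *\<^sub>R h) - codiff_Psi E (\<alpha> *\<^sub>R h)\<bar> / \<alpha>)
            \<longlongrightarrow> 0) (at_right 0))"

section \<open>Caratheodory maps and the codifferentiability conditions\<close>

definition caratheodory_fun ::
    "(real^'d) set \<Rightarrow> (real^'d \<Rightarrow> 'y::topological_space \<Rightarrow> real) \<Rightarrow> bool" where
  "caratheodory_fun \<Omega> g \<longleftrightarrow> (\<forall>y. (\<lambda>x. g x y) \<in> borel_measurable (lebesgue_on \<Omega>)) \<and>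
     (AE x in lebesgue_on \<Omega>. continuous_on UNIV (g x))"

definition hausdorff_dist :: "'b::metric_space set \<Rightarrow> 'b set \<Rightarrow> real" where
  "hausdorff_dist A B = max (SUP a\<in>A. infdist a B) (SUP b\<in>B. infdist b A)"

definition measurable_multifun :: "(real^'d) set \<Rightarrow> (real^'d \<Rightarrow> 'b::topological_space set) \<Rightarrow> bool" where
  "measurable_multifun \<Omega> G \<longleftrightarrow>
     (\<forall>V. open V \<longrightarrow> {x \<in> \<Omega>. G x \<inter> V \<noteq> {}} \<in> sets (lebesgue_on \<Omega>))"

definition caratheodory_multifun ::
    "(real^'d) set \<Rightarrow> (real^'d \<Rightarrow> 'y::topological_space \<Rightarrow> 'b::metric_space set) \<Rightarrow> bool" where
  "caratheodory_multifun \<Omega> G \<longleftrightarrow> (\<forall>y. measurable_multifun \<Omega> (\<lambda>x. G x y)) \<and>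
     (AE x in lebesgue_on \<Omega>. \<forall>y. ((\<lambda>z. hausdorff_dist (G x z) (G x y)) \<longlongrightarrow> 0) (at y))"

text \<open>\<open>t\<^sup>s\<close> with \<open>t\<^sup>0 = 1\<close> also for \<open>t = 0\<close>, whereas \<open>0 powr 0 = 0\<close>; this matters for
  \<open>t\<^sup>p\<^sup>-\<^sup>1\<close> with \<open>p = 1\<close>.\<close>

definition rpow :: "real \<Rightarrow> real \<Rightarrow> real" where
  "rpow t s = (if s = 0 then 1 else t powr s)"

definition growth_condition ::
    "ennreal \<Rightarrow> (real^'d) set \<Rightarrow> (real^'d \<Rightarrow> (real^'m) \<times> (real^'d^'m) \<Rightarrow> real) \<Rightarrow> bool" where
  "growth_condition p \<Omega> f \<longleftrightarrow>
     (if p < \<infinity> then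
        (\<exists>\<beta> C. integrable (lebesgue_on \<Omega>) \<beta> \<and> (AE x in lebesgue_on \<Omega>. 0 \<le> \<beta> x) \<and> 0 < C \<and>
           (AE x in lebesgue_on \<Omega>. \<forall>u \<xi>.
              \<bar>f x (u, \<xi>)\<bar> \<le> \<beta> x + C * (norm u powr enn2real p + norm \<xi> powr enn2real p)))
      else
        (\<forall>N>0. \<exists>\<beta>. integrable (lebesgue_on \<Omega>) \<beta> \<and> (AE x in lebesgue_on \<Omega>. 0 \<le> \<beta> x) \<and>
           (AE x in lebesgue_on \<Omega>. \<forall>u \<xi>. max (norm u) (norm \<xi>) \<le> N \<longrightarrow> \<bar>f x (u, \<xi>)\<bar> \<le> \<beta> x)))"

text \<open>This is used with \<open>G x y\<close> the union of the two sets of a codifferential, so that both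
  are bounded with the same \<open>\<beta>\<close>, \<open>\<gamma>\<close> and \<open>C\<close>.\<close>

definition codiff_growth_condition ::
    "ennreal \<Rightarrow> (real^'d) set \<Rightarrow> (real^'d \<Rightarrow> (real^'m) \<times> (real^'d^'m) \<Rightarrow> (real \<times> (real^'m) \<times> (real^'d^'m)) set)
      \<Rightarrow> bool" where
  "codiff_growth_condition p \<Omega> G \<longleftrightarrow>
     (if p < \<infinity> then
        (\<exists>\<beta> \<gamma> C. integrable (lebesgue_on \<Omega>) \<beta> \<and> (AE x in lebesgue_on \<Omega>. 0 \<le> \<beta> x) \<and>
           in_Lp (conj_exponent p) \<Omega> \<gamma> \<and> (AE x in lebesgue_on \<Omega>. 0 \<le> \<gamma> x) \<and> 0 < C \<and>
           (AE x in lebesgue_on \<Omega>. \<forall>u \<xi>. \<forall>(a, v1, v2) \<in> G x (u, \<xi>).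
              \<bar>a\<bar> \<le> \<beta> x + C * (norm u powr enn2real p + norm \<xi> powr enn2real p) \<and>
              max (norm v1) (norm v2) \<le>
                \<gamma> x + C * (rpow (norm u) (enn2real p - 1) + rpow (norm \<xi>) (enn2real p - 1))))
      else
        (\<forall>N>0. \<exists>\<beta>. integrable (lebesgue_on \<Omega>) \<beta> \<and> (AE x in lebesgue_on \<Omega>. 0 \<le> \<beta> x) \<and>
           (AE x in lebesgue_on \<Omega>. \<forall>u \<xi>. max (norm u) (norm \<xi>) \<le> N \<longrightarrow>
              (\<forall>(a, v1, v2) \<in> G x (u, \<xi>). max \<bar>a\<bar> (max (norm v1) (norm v2)) \<le> \<beta> x))))"

definition codifferentiability_conditions ::
    "ennreal \<Rightarrow> (real^'d) set \<Rightarrow> (real^'d \<Rightarrow> (real^'m) \<times> (real^'d^'m) \<Rightarrow> real)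
      \<Rightarrow> (real^'d \<Rightarrow> (real^'m) \<times> (real^'d^'m) \<Rightarrow> (real \<times> (real^'m) \<times> (real^'d^'m)) set)
      \<Rightarrow> (real^'d \<Rightarrow> (real^'m) \<times> (real^'d^'m) \<Rightarrow> (real \<times> (real^'m) \<times> (real^'d^'m)) set) \<Rightarrow> bool" where
  "codifferentiability_conditions p \<Omega> f dlo dup \<longleftrightarrow>
     caratheodory_fun \<Omega> f \<and> growth_condition p \<Omega> f \<and>
     (AE x in lebesgue_on \<Omega>. \<forall>y. is_codifferential (f x) y (dlo x y) (dup x y)) \<and>
     caratheodory_multifun \<Omega> dlo \<and> caratheodory_multifun \<Omega> dup \<and>
     codiff_growth_condition p \<Omega> (\<lambda>x y. dlo x y \<union> dup x y)"

definition segment_property :: "(real^'d) set \<Rightarrow> bool" where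
  "segment_property \<Omega> \<longleftrightarrow> (\<forall>x\<in>frontier \<Omega>. \<exists>U y. open U \<and> x \<in> U \<and> y \<noteq> 0 \<and>
     (\<forall>z\<in>closure \<Omega> \<inter> U. \<forall>t. 0 < t \<and> t < 1 \<longrightarrow> z + t *\<^sub>R y \<in> \<Omega>))"

definition constant_slope_hull ::
    "(real^'d) set \<Rightarrow> (real^'d \<Rightarrow> (real^'m) \<times> (real^'d^'m) \<Rightarrow> (real \<times> (real^'m) \<times> (real^'d^'m)) set) \<Rightarrow> bool" where
  "constant_slope_hull \<Omega> G \<longleftrightarrow>
     (\<exists>(l::nat) g v1 v2. (\<forall>i\<in>{1..l}. caratheodory_fun \<Omega> (g i)) \<and>
        (AE x in lebesgue_on \<Omega>. \<forall>y. G x y = convex hull {(g i x y, v1 i, v2 i) | i. i \<in> {1..l}}))"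

section \<open>The integral functional\<close>

definition int_functional ::
    "(real^'d) set \<Rightarrow> (real^'d \<Rightarrow> (real^'m) \<times> (real^'d^'m) \<Rightarrow> real) \<Rightarrow> (real^'d \<Rightarrow> real^'m) \<Rightarrow> real" where
  "int_functional \<Omega> f u = (LINT x|lebesgue_on \<Omega>. f x (u x, weak_grad \<Omega> u x))"

definition measurable_selection ::
    "(real^'d) set \<Rightarrow> (real^'d \<Rightarrow> 'b::euclidean_space set) \<Rightarrow> (real^'d \<Rightarrow> 'b) \<Rightarrow> bool" where
  "measurable_selection \<Omega> G z \<longleftrightarrow> z \<in> borel_measurable (lebesgue_on \<Omega>) \<and>
     (AE x in lebesgue_on \<Omega>. z x \<in> G x)"

text \<open>Applied to \<open>G = dlo\<close> and \<open>G = dup\<close>, this gives the two halves of the codifferential of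
  the integral functional at \<open>u\<close>.\<close>

definition functional_codiff ::
    "ennreal \<Rightarrow> (real^'d) set
      \<Rightarrow> (real^'d \<Rightarrow> (real^'m) \<times> (real^'d^'m) \<Rightarrow> (real \<times> (real^'m) \<times> (real^'d^'m)) set)
      \<Rightarrow> (real^'d \<Rightarrow> real^'m) \<Rightarrow> (real \<times> ((real^'d \<Rightarrow> real^'m) \<Rightarrow> real)) set" where
  "functional_codiff p \<Omega> G u =
     {(A, \<phi>) | A \<phi>. \<phi> \<in> dual_space (W1p p \<Omega>) (W1p_norm p \<Omega>) \<and>
        (\<exists>a v1 v2. measurable_selection \<Omega> (\<lambda>x. G x (u x, weak_grad \<Omega> u x)) (\<lambda>x. (a x, v1 x, v2 x)) \<and>
           has_bochner_integral (lebesgue_on \<Omega>) a A \<and>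
           (\<forall>h\<in>W1p p \<Omega>. has_bochner_integral (lebesgue_on \<Omega>)
              (\<lambda>x. v1 x \<bullet> h x + v2 x \<bullet> weak_grad \<Omega> h x) (\<phi> h)))}"

definition functional_quasidiff ::
    "ennreal \<Rightarrow> (real^'d) set
      \<Rightarrow> (real^'d \<Rightarrow> (real^'m) \<times> (real^'d^'m) \<Rightarrow> (real \<times> (real^'m) \<times> (real^'d^'m)) set)
      \<Rightarrow> (real^'d \<Rightarrow> real^'m) \<Rightarrow> ((real^'d \<Rightarrow> real^'m) \<Rightarrow> real) set" where
  "functional_quasidiff p \<Omega> G u =
     {\<phi> \<in> dual_space (W1p p \<Omega>) (W1p_norm p \<Omega>). (0, \<phi>) \<in> functional_codiff p \<Omega> G u}"

end

theory Submission
  imports Defs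
begin

text \<open>At a point \<open>u\<close> the directional derivative of the integral functional in direction \<open>h\<close> is
  obtained pointwise, by dominated convergence: continuous functions with bounded one-sided
  derivatives are Lipschitz, so the growth conditions give \<open>|f(x,y) - f(x,z)| \<le> 2 M(x) |y - z|\<close>
  with a weight \<open>M\<close> that pairs with \<open>W\<^sup>1\<^sup>,\<^sup>p\<close>. The derivative is
  \<open>\<integral> \<sigma>(x, (h, \<nabla>h)) - \<integral> \<tau>(x, -(h, \<nabla>h))\<close>, where \<open>\<sigma>(x, \<cdot>)\<close> and \<open>\<tau>(x, \<cdot>)\<close> are the support functions of
  the slices \<open>a = 0\<close> of the two sets of the codifferential. The linear functionals below the sublinear
  functional \<open>q \<mapsto> \<integral> \<sigma>(x, q(x))\<close> on the weighted space \<open>L\<^sup>1(M dx)\<close> form a compact set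
  (Tychonoff), are exactly the integrals against measurable selections of the slices
  (Radon--Nikodym and separation), and attain the value of the sublinear functional at each point
  (Hahn--Banach). Composition with \<open>h \<mapsto> (h, \<nabla>h)\<close>, which is linear up to null sets by the
  uniqueness of weak gradients, carries these facts over to the quasidifferential.\<close>

section \<open>Linear functionals below a sublinear one\<close>

text \<open>The functionals of interest act on jets \<open>(h, \<nabla>h)\<close>, and a jet cannot
  be cut off by an indicator function, so a functional on the Sobolev space alone cannot be
  localized to reveal a pointwise density. It is therefore extended to all measurable fields
  \<open>q\<close> with \<open>M * norm q\<close> integrable. A weighted \<open>L\<^sup>1\<close>
  space is used because it treats every exponent alike: its bounded functionals are given by
  densities bounded by a multiple of \<open>M\<close>, whereas compactness of selections in the dual
  \<open>L\<^sup>p\<close> scale changes character at the end exponents. Hahn-Banach followed by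
  Radon-Nikodym also produces measurable selections, so nonemptiness and attainment come together.
  Passing from \<open>A = 0\<close> to the slices \<open>a = 0\<close> rests on a sign:
  \<open>a \<le> 0\<close> holds in the lower set and \<open>b \<ge> 0\<close> in the upper one, so
  a vanishing integral forces the function itself to vanish almost everywhere. A factor
  \<open>c = 1\<close> or \<open>c = -1\<close> records this sign, and since a minimum at
  \<open>h\<close> is minus a maximum at \<open>- h\<close>, one argument serves both
  halves.\<close>

definition fun_subspace :: "('a \<Rightarrow> 'b::real_vector) set \<Rightarrow> bool" where
  "fun_subspace E \<longleftrightarrow> (\<lambda>_. 0) \<in> E \<and> (\<forall>x\<in>E. \<forall>y\<in>E. (\<lambda>a. x a + y a) \<in> E) \<and>
     (\<forall>c. \<forall>x\<in>E. (\<lambda>a. c *\<^sub>R x a) \<in> E)"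

definition sublinear_on :: "('a \<Rightarrow> 'b::real_vector) set \<Rightarrow> (('a \<Rightarrow> 'b) \<Rightarrow> real) \<Rightarrow> bool" where
  "sublinear_on E q \<longleftrightarrow> (\<forall>x\<in>E. \<forall>y\<in>E. q (\<lambda>a. x a + y a) \<le> q x + q y) \<and>
     (\<forall>c\<ge>0. \<forall>x\<in>E. q (\<lambda>a. c *\<^sub>R x a) = c * q x)"

definition linear_on_funs :: "('a \<Rightarrow> 'b::real_vector) set \<Rightarrow> (('a \<Rightarrow> 'b) \<Rightarrow> real) \<Rightarrow> bool" where
  "linear_on_funs E q \<longleftrightarrow> (\<forall>x\<in>E. \<forall>y\<in>E. q (\<lambda>a. x a + y a) = q x + q y) \<and>
     (\<forall>c. \<forall>x\<in>E. q (\<lambda>a. c *\<^sub>R x a) = c * q x)"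

lemma fun_subspaceD:
  assumes "fun_subspace E"
  shows fun_subspace_0: "(\<lambda>_. 0) \<in> E"
    and fun_subspace_add: "x \<in> E \<Longrightarrow> y \<in> E \<Longrightarrow> (\<lambda>a. x a + y a) \<in> E"
    and fun_subspace_scale: "x \<in> E \<Longrightarrow> (\<lambda>a. c *\<^sub>R x a) \<in> E"
    and fun_subspace_uminus: "x \<in> E \<Longrightarrow> (\<lambda>a. - x a) \<in> E"
proof -
  show u: "x \<in> E \<Longrightarrow> (\<lambda>a. c *\<^sub>R x a) \<in> E" for c x
    using assms by (simp add: fun_subspace_def)
  show "x \<in> E \<Longrightarrow> (\<lambda>a. - x a) \<in> E" using u[of x "-1"] by simp
qed (use assms in \<open>auto simp: fun_subspace_def\<close>)

lemma sublinear_onD: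
  assumes "sublinear_on E q"
  shows sublinear_on_add: "x \<in> E \<Longrightarrow> y \<in> E \<Longrightarrow> q (\<lambda>a. x a + y a) \<le> q x + q y"
    and sublinear_on_scale: "x \<in> E \<Longrightarrow> 0 \<le> c \<Longrightarrow> q (\<lambda>a. c *\<^sub>R x a) = c * q x"
  using assms by (auto simp: sublinear_on_def)

lemma sublinear_on_0: "fun_subspace E \<Longrightarrow> sublinear_on E q \<Longrightarrow> q (\<lambda>_. 0) = 0"
  using sublinear_on_scale[of E q "\<lambda>_. 0" 0] fun_subspace_0 by force

text \<open>From \<open>0 = x + (- x)\<close>. Applied to functionals below a fixed one, it keeps
  their pointwise infima finite.\<close>

lemma sublinear_on_lower:
  assumes "fun_subspace E" "sublinear_on E q" "x \<in> E"
  shows "- q (\<lambda>a. - x a) \<le> q x"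
proof -
  have "q (\<lambda>a. x a + - x a) \<le> q x + q (\<lambda>a. - x a)"
    using assms by (intro sublinear_on_add fun_subspace_uminus) auto
  then show ?thesis using sublinear_on_0[OF assms(1,2)] by simp
qed

text \<open>The largest sublinear \<open>m \<le> q\<close> with \<open>m (x + t y) = m x + t q y\<close> for \<open>t \<ge> 0\<close>.\<close>

definition ray_minorant :: "(('a \<Rightarrow> 'b::real_vector) \<Rightarrow> real) \<Rightarrow> ('a \<Rightarrow> 'b) \<Rightarrow> ('a \<Rightarrow> 'b) \<Rightarrow> real" where
  "ray_minorant q y x = (INF t\<in>{0..}. q (\<lambda>a. x a + t *\<^sub>R y a) - t * q y)"

lemma ray_minorant_le:
  assumes E: "fun_subspace E" "sublinear_on E q" and x: "x \<in> E" "y \<in> E" and "0 \<le> t"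
  shows "ray_minorant q y x \<le> q (\<lambda>a. x a + t *\<^sub>R y a) - t * q y"
  unfolding ray_minorant_def
proof (rule cINF_lower)
  \<comment> \<open>A lower bound free of \<open>s\<close>, from
    \<open>s y = (x + s y) + (- x)\<close>; without it the infimum in \<open>ray_minorant\<close>
    would carry no information.\<close>
  have "- q (\<lambda>a. - x a) \<le> q (\<lambda>a. x a + s *\<^sub>R y a) - s * q y" if "0 \<le> s" for s
  proof -
    have "q (\<lambda>a. (x a + s *\<^sub>R y a) + - x a) \<le> q (\<lambda>a. x a + s *\<^sub>R y a) + q (\<lambda>a. - x a)"
      by (intro sublinear_on_add[OF E(2)] fun_subspace_add[OF E(1)] fun_subspace_uminus[OF E(1)]
          fun_subspace_scale[OF E(1)] x)
    moreover have "(\<lambda>a. (x a + s *\<^sub>R y a) + - x a) = (\<lambda>a. s *\<^sub>R y a)" by auto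
    ultimately show ?thesis using sublinear_on_scale[OF E(2) x(2) that] by simp
  qed
  then show "bdd_below ((\<lambda>t. q (\<lambda>a. x a + t *\<^sub>R y a) - t * q y) ` {0..})"
    by (intro bdd_belowI2) auto
qed (use assms in auto)

text \<open>Parameters \<open>s\<close> for \<open>x\<close> and \<open>t\<close> for
  \<open>z\<close> combine to the admissible parameter \<open>s + t\<close> for the sum, and scaling
  by \<open>c\<close> turns \<open>t\<close> into \<open>c * t\<close>.\<close>

lemma ray_minorant_sublinear:
  assumes E: "fun_subspace E" "sublinear_on E q" and y: "y \<in> E"
  shows "sublinear_on E (ray_minorant q y)"
proof -
  note cl = fun_subspace_add[OF E(1)] fun_subspace_scale[OF E(1)]
  have add: "ray_minorant q y (\<lambda>a. x a + z a) \<le> ray_minorant q y x + ray_minorant q y z"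
    if x: "x \<in> E" "z \<in> E" for x z
  proof -
    have *: "ray_minorant q y (\<lambda>a. x a + z a) \<le>
        (q (\<lambda>a. x a + s *\<^sub>R y a) - s * q y) + (q (\<lambda>a. z a + t *\<^sub>R y a) - t * q y)"
      if "0 \<le> s" "0 \<le> t" for s t
    proof -
      have "ray_minorant q y (\<lambda>a. x a + z a) \<le> q (\<lambda>a. (x a + z a) + (s + t) *\<^sub>R y a) - (s + t) * q y"
        using that x y by (intro ray_minorant_le[OF E] cl) auto
      also have "(\<lambda>a. (x a + z a) + (s + t) *\<^sub>R y a) = (\<lambda>a. (x a + s *\<^sub>R y a) + (z a + t *\<^sub>R y a))"
        by (auto simp: algebra_simps)
      also have "q \<dots> \<le> q (\<lambda>a. x a + s *\<^sub>R y a) + q (\<lambda>a. z a + t *\<^sub>R y a)"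
        using x y by (intro sublinear_on_add[OF E(2)] cl) auto
      finally show ?thesis by (simp add: algebra_simps)
    qed
    have "ray_minorant q y (\<lambda>a. x a + z a) - (q (\<lambda>a. x a + s *\<^sub>R y a) - s * q y) \<le> ray_minorant q y z"
      if "0 \<le> s" for s
      unfolding ray_minorant_def[of q y z] by (rule cINF_greatest) (use *[OF that] in force)+
    then have "ray_minorant q y (\<lambda>a. x a + z a) - ray_minorant q y z \<le> ray_minorant q y x"
      unfolding ray_minorant_def[of q y x] by (intro cINF_greatest) force+
    then show ?thesis by simp
  qed
  have sc: "ray_minorant q y (\<lambda>a. c *\<^sub>R x a) \<le> c * ray_minorant q y x" if x: "x \<in> E" and c: "0 < c" for x c
  proof -
    have "ray_minorant q y (\<lambda>a. c *\<^sub>R x a) / c \<le> q (\<lambda>a. x a + t *\<^sub>R y a) - t * q y" if "0 \<le> t" for t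
    proof -
      have "ray_minorant q y (\<lambda>a. c *\<^sub>R x a) \<le> q (\<lambda>a. c *\<^sub>R x a + (c * t) *\<^sub>R y a) - (c * t) * q y"
        using that x y c by (intro ray_minorant_le[OF E] cl) auto
      also have "(\<lambda>a. c *\<^sub>R x a + (c * t) *\<^sub>R y a) = (\<lambda>a. c *\<^sub>R (x a + t *\<^sub>R y a))"
        by (auto simp: algebra_simps)
      also have "q \<dots> = c * q (\<lambda>a. x a + t *\<^sub>R y a)"
        using x y c by (intro sublinear_on_scale[OF E(2)] cl) auto
      finally show ?thesis using c by (simp add: field_simps)
    qed
    then have "ray_minorant q y (\<lambda>a. c *\<^sub>R x a) / c \<le> ray_minorant q y x"
      unfolding ray_minorant_def[of q y x] by (intro cINF_greatest) force+
    then show ?thesis using c by (simp add: field_simps)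
  qed
  have "ray_minorant q y (\<lambda>a. c *\<^sub>R x a) = c * ray_minorant q y x" if x: "x \<in> E" and c: "0 \<le> c" for x c
  proof (cases "c = 0")
    case True
    have "ray_minorant q y (\<lambda>_. 0) = (INF t\<in>{0::real..}. (0::real))"
      unfolding ray_minorant_def
      by (intro arg_cong[where f = Inf] image_cong refl) (simp add: sublinear_on_scale[OF E(2) y])
    then show ?thesis using True by simp
  next
    case False
    then have c: "0 < c" using c by simp
    \<comment> \<open>The reverse inequality is \<open>sc\<close> itself, for the factor
      \<open>inverse c\<close> at the point \<open>c x\<close>.\<close>
    have "ray_minorant q y (\<lambda>a. inverse c *\<^sub>R (c *\<^sub>R x a)) \<le> inverse c * ray_minorant q y (\<lambda>a. c *\<^sub>R x a)"
      using c x by (intro sc cl) auto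
    then have "c * ray_minorant q y x \<le> ray_minorant q y (\<lambda>a. c *\<^sub>R x a)"
      using c by (simp add: field_simps)
    with sc[OF x c] show ?thesis by simp
  qed
  with add show ?thesis by (auto simp: sublinear_on_def)
qed

text \<open>Zorn's lemma for the reversed pointwise order. The bound of a chain is its pointwise
  infimum, finite because every member lies above \<open>- q (- x)\<close>, and subadditive because
  of two members of a chain the smaller one can be used for both summands.\<close>

lemma exists_minimal_sublinear:
  assumes E: "fun_subspace E" and q: "sublinear_on E q"
  obtains m where "sublinear_on E m" "\<And>x. x \<in> E \<Longrightarrow> m x \<le> q x"
    "\<And>m' x. sublinear_on E m' \<Longrightarrow> (\<And>x. x \<in> E \<Longrightarrow> m' x \<le> m x) \<Longrightarrow> x \<in> E \<Longrightarrow> m' x = m x"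
proof -
  \<comment> \<open>Members are extensional, so agreement on \<open>E\<close> is equality and the
    order is antisymmetric.\<close>
  define A where "A = {m \<in> extensional E. sublinear_on E m \<and> (\<forall>x\<in>E. m x \<le> q x)}"
  define R where "R = (\<lambda>m m' :: ('a \<Rightarrow> 'b) \<Rightarrow> real. \<forall>x\<in>E. m' x \<le> m x)"
  have restr: "sublinear_on E (restrict m E)" if "sublinear_on E m" for m
    using that E by (simp add: sublinear_on_def fun_subspace_def)
  have po: "partial_order_on A (relation_of R A)"
  proof (rule partial_order_on_relation_ofI)
    show "R a b" if "R a c" "R c b" for a b c using that unfolding R_def by force
    show "a = b" if "a \<in> A" "b \<in> A" "R a b" "R b a" for a b
      using that unfolding A_def R_def by (intro extensionalityI[of a E b]) (auto intro: antisym)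
  qed (simp add: R_def)
  have "\<exists>m\<in>A. \<forall>a\<in>A. R m a \<longrightarrow> a = m"
  proof (rule predicate_Zorn[OF po])
    fix C assume "C \<in> Chains (relation_of R A)"
    then have CA: "C \<subseteq> A" and ch: "\<And>m m'. m \<in> C \<Longrightarrow> m' \<in> C \<Longrightarrow> R m m' \<or> R m' m"
      by (auto simp: Chains_def relation_of_def)
    show "\<exists>u\<in>A. \<forall>a\<in>C. R a u"
    proof (cases "C = {}")
      case True
      then show ?thesis using restr[OF q] by (intro bexI[of _ "restrict q E"]) (auto simp: A_def)
    next
      case False
      define u where "u = restrict (\<lambda>x. INF m\<in>C. m x) E"
      have sub: "sublinear_on E m" "\<And>x. x \<in> E \<Longrightarrow> m x \<le> q x" if "m \<in> C" for m
        using that CA by (auto simp: A_def)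
      have lb: "- q (\<lambda>a. - x a) \<le> m x" if "m \<in> C" "x \<in> E" for m x
        using sublinear_on_lower[OF E sub(1)[OF that(1)] that(2)]
          sub(2)[OF that(1) fun_subspace_uminus[OF E that(2)]] by simp
      have bdd: "bdd_below ((\<lambda>m. m x) ` C)" if "x \<in> E" for x
        using lb[OF _ that] by (intro bdd_belowI2) auto
      have le: "u x \<le> m x" if "m \<in> C" "x \<in> E" for m x
        using that bdd by (auto simp: u_def intro: cINF_lower)
      have ge: "b \<le> u x" if "\<And>m. m \<in> C \<Longrightarrow> b \<le> m x" "x \<in> E" for b x
        using that False by (auto simp: u_def intro: cINF_greatest)
      have add: "u (\<lambda>a. x a + y a) \<le> u x + u y" if xy: "x \<in> E" "y \<in> E" for x y
      proof -
        have *: "u (\<lambda>a. x a + y a) \<le> m x + m' y" if m: "m \<in> C" "m' \<in> C" for m m'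
        proof -
          obtain n where n: "n \<in> C" "n x \<le> m x" "n y \<le> m' y"
            using ch[OF m] m xy unfolding R_def by blast
          have "u (\<lambda>a. x a + y a) \<le> n (\<lambda>a. x a + y a)"
            using n(1) xy by (intro le fun_subspace_add[OF E])
          also have "\<dots> \<le> n x + n y" using sub(1)[OF n(1)] xy by (rule sublinear_on_add)
          finally show ?thesis using n by simp
        qed
        have "u (\<lambda>a. x a + y a) - m x \<le> u y" if "m \<in> C" for m
          using *[OF that] xy by (intro ge) (auto simp: algebra_simps)
        then have "u (\<lambda>a. x a + y a) - u y \<le> u x"
          using xy by (intro ge) (auto simp: algebra_simps)
        then show ?thesis by simp
      qed
      have sc: "u (\<lambda>a. c *\<^sub>R x a) = c * u x" if "0 \<le> c" and x: "x \<in> E" for c x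
      proof -
        have "u (\<lambda>a. c *\<^sub>R x a) = (INF m\<in>C. c * m x)"
          unfolding u_def using fun_subspace_scale[OF E x]
          by (simp add: sublinear_on_scale[OF sub(1) x that(1)] cong: INF_cong)
        also have "\<dots> = c * (INF m\<in>C. m x)"
        proof -
          have "continuous (at_right (INF m\<in>C. m x)) (\<lambda>z. c * z)" by (intro continuous_intros)
          moreover have "mono (\<lambda>z. c * z)" using that by (simp add: mono_def mult_left_mono)
          ultimately have "c * (INF m\<in>C. m x) = (INF z\<in>(\<lambda>m. m x) ` C. c * z)"
            using bdd[OF x] False by (intro continuous_at_Inf_mono) auto
          then show ?thesis by (simp add: image_image)
        qed
        finally show ?thesis using x by (simp add: u_def)
      qed
      obtain m0 where m0: "m0 \<in> C" using False by blast
      have "u x \<le> q x" if "x \<in> E" for x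
        using le[OF m0 that] sub(2)[OF m0 that] by simp
      then have "u \<in> A" using add sc by (simp add: A_def sublinear_on_def) (simp add: u_def)
      moreover have "\<forall>a\<in>C. R a u" using le by (auto simp: R_def)
      ultimately show ?thesis by blast
    qed
  qed
  then obtain m where m: "m \<in> A" "\<And>a. a \<in> A \<Longrightarrow> R m a \<Longrightarrow> a = m" by blast
  show thesis
  proof (rule that[of m])
    fix m' x assume m': "sublinear_on E m'" "\<And>x. x \<in> E \<Longrightarrow> m' x \<le> m x" and x: "x \<in> E"
    have "restrict m' E \<in> A" using m' m(1) restr[OF m'(1)] by (force simp: A_def)
    then have "restrict m' E = m" by (rule m(2)) (simp add: R_def m')
    then show "m' x = m x" using x by (metis restrict_apply')
  qed (use m(1) in \<open>auto simp: A_def\<close>)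
qed

text \<open>Hahn--Banach: a minimal sublinear functional \<open>m\<close> agrees with each of its minorants
  \<open>ray_minorant m z\<close> and is therefore linear.\<close>

lemma exists_linear_minorant:
  assumes E: "fun_subspace E" and q: "sublinear_on E q" and y: "y \<in> E"
  obtains \<psi> where "linear_on_funs E \<psi>" "\<And>x. x \<in> E \<Longrightarrow> \<psi> x \<le> q x" "\<psi> y = q y"
proof -
  \<comment> \<open>Minimizing below \<open>ray_minorant q y\<close> instead of \<open>q\<close>
    pins the value at \<open>y\<close>, because that minorant is at most \<open>- q y\<close> at
    \<open>- y\<close>.\<close>
  obtain m where m: "sublinear_on E m" "\<And>x. x \<in> E \<Longrightarrow> m x \<le> ray_minorant q y x"
    and min: "\<And>m' x. sublinear_on E m' \<Longrightarrow> (\<And>x. x \<in> E \<Longrightarrow> m' x \<le> m x) \<Longrightarrow> x \<in> E \<Longrightarrow> m' x = m x"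
    using exists_minimal_sublinear[OF E ray_minorant_sublinear[OF E q y]] by blast
  have rm: "ray_minorant m z x = m x" if "x \<in> E" "z \<in> E" for x z
  proof (rule min)
    show "ray_minorant m z x \<le> m x" if "x \<in> E" for x
      using ray_minorant_le[OF E m(1) that \<open>z \<in> E\<close>, of 0] by simp
  qed (use ray_minorant_sublinear[OF E m(1)] that in auto)
  have add: "m (\<lambda>a. x a + z a) = m x + m z" if "x \<in> E" "z \<in> E" for x z
    using ray_minorant_le[OF E m(1) that, of 1] rm[OF that] sublinear_on_add[OF m(1) that] by simp
  have neg: "m (\<lambda>a. - x a) = - m x" if "x \<in> E" for x
    using add[OF that fun_subspace_uminus[OF E that]] sublinear_on_0[OF E m(1)] by simp
  have sc: "m (\<lambda>a. c *\<^sub>R x a) = c * m x" if x: "x \<in> E" for c x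
  proof (cases "0 \<le> c")
    case False
    then have "m (\<lambda>a. (- c) *\<^sub>R (- x a)) = (- c) * m (\<lambda>a. - x a)"
      by (intro sublinear_on_scale[OF m(1)] fun_subspace_uminus[OF E x]) simp
    then show ?thesis using neg[OF x] by simp
  qed (simp add: sublinear_on_scale[OF m(1) x])
  have le: "m x \<le> q x" if "x \<in> E" for x
    using m(2)[OF that] ray_minorant_le[OF E q that y, of 0] by simp
  have "m (\<lambda>a. - y a) \<le> q (\<lambda>a. - y a + 1 *\<^sub>R y a) - 1 * q y"
    using m(2)[OF fun_subspace_uminus[OF E y]]
      ray_minorant_le[OF E q fun_subspace_uminus[OF E y] y, of 1] by simp
  then have "q y \<le> m y" using neg[OF y] sublinear_on_0[OF E q] by simp
  then show thesis using that[of m] add sc le le[OF y] by (auto simp: linear_on_funs_def)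
qed

text \<open>Each value \<open>\<psi> x\<close> is confined to an interval that does not depend on
  \<psi>, so the set lies in a compact product. Linearity and domination involve finitely many
  coordinates at a time and are closed conditions.\<close>

lemma compactin_linear_minorants:
  assumes E: "fun_subspace E"
  shows "compactin (product_topology (\<lambda>_. euclideanreal) E)
    {\<psi> \<in> extensional E. linear_on_funs E \<psi> \<and> (\<forall>x\<in>E. \<psi> x \<le> q x)}" (is "compactin ?T ?Q")
proof (rule closed_compactin)
  define B where "B = PiE E (\<lambda>x. {- q (\<lambda>a. - x a)..q x})"
  show "compactin ?T B"
    unfolding B_def by (simp add: compactin_PiE compactin_euclidean_iff)
  show "?Q \<subseteq> B"
  proof
    fix \<psi> assume \<psi>: "\<psi> \<in> ?Q"
    have "- q (\<lambda>a. - x a) \<le> \<psi> x" if "x \<in> E" for x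
    proof -
      have "\<psi> (\<lambda>a. - 1 *\<^sub>R x a) = - 1 * \<psi> x" using \<psi> that unfolding linear_on_funs_def by blast
      then show ?thesis using \<psi> fun_subspace_uminus[OF E that] by force
    qed
    then show "\<psi> \<in> B" using \<psi> by (auto simp: B_def PiE_def)
  qed
  have ev: "continuous_map ?T euclideanreal (\<lambda>\<psi>. \<psi> x)" if "x \<in> E" for x
    using that by (rule continuous_map_product_projection)
  have le: "closedin ?T {\<psi> \<in> topspace ?T. \<psi> x \<le> q x}" if "x \<in> E" for x
    using closedin_continuous_map_preimage[OF ev[OF that], of "{..q x}"] by simp
  have eq: "closedin ?T {\<psi> \<in> topspace ?T. g \<psi> = h \<psi>}"
    if "continuous_map ?T euclideanreal g" "continuous_map ?T euclideanreal h" for g h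
    using closedin_continuous_map_preimage[OF continuous_map_diff[OF that], of "{0}"] by simp
  have add: "closedin ?T {\<psi> \<in> topspace ?T. \<psi> (\<lambda>a. x a + y a) = \<psi> x + \<psi> y}" if "x \<in> E" "y \<in> E" for x y
    using that by (intro eq continuous_map_add ev fun_subspace_add[OF E])
  have sc: "closedin ?T {\<psi> \<in> topspace ?T. \<psi> (\<lambda>a. c *\<^sub>R x a) = c * \<psi> x}" if "x \<in> E" for c x
    using that by (intro eq continuous_map_real_mult continuous_map_const[THEN iffD2] ev
        fun_subspace_scale[OF E]) auto
  have "?Q = (\<Inter>x\<in>E. {\<psi> \<in> topspace ?T. \<psi> x \<le> q x}) \<inter>
     (\<Inter>x\<in>E. \<Inter>y\<in>E. {\<psi> \<in> topspace ?T. \<psi> (\<lambda>a. x a + y a) = \<psi> x + \<psi> y}) \<inter>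
     (\<Inter>x\<in>E. \<Inter>c. {\<psi> \<in> topspace ?T. \<psi> (\<lambda>a. c *\<^sub>R x a) = c * \<psi> x})"
    using fun_subspace_0[OF E] by (auto simp: linear_on_funs_def PiE_def)
  moreover have "E \<noteq> {}" using fun_subspace_0[OF E] by blast
  ultimately show "closedin ?T ?Q"
    by (simp only:) (intro closedin_Int closedin_INT le add sc UNIV_not_empty; assumption)
qed

section \<open>Representation of dominated functionals on weighted \<open>L\<^sup>1\<close> spaces\<close>

text \<open>The space \<open>L\<^sup>1\<close> of the measure with density \<open>M\<close>, kept as
  a space of functions rather than classes; where \<open>M\<close> vanishes, the size of
  \<open>q\<close> is unrestricted.\<close>

definition weighted_L1 :: "'a measure \<Rightarrow> ('a \<Rightarrow> real) \<Rightarrow> ('a \<Rightarrow> 'b::euclidean_space) set" where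
  "weighted_L1 N M = {q \<in> borel_measurable N. integrable N (\<lambda>x. M x * norm (q x))}"

lemma weighted_L1D:
  assumes "q \<in> weighted_L1 N M"
  shows weighted_L1_measurable: "q \<in> borel_measurable N"
    and weighted_L1_integrable: "integrable N (\<lambda>x. M x * norm (q x))"
  using assms by (auto simp: weighted_L1_def)

lemma weighted_L1_dominated:
  assumes "M \<in> borel_measurable N" "\<And>x. 0 \<le> M x" "q \<in> borel_measurable N"
    "integrable N g" "AE x in N. M x * norm (q x) \<le> g x"
  shows "q \<in> weighted_L1 N M"
proof -
  note [measurable] = assms(1,3)
  have "integrable N (\<lambda>x. M x * norm (q x))"
    by (rule Bochner_Integration.integrable_bound[OF assms(4)])
       (use assms(5) in \<open>auto simp: assms(2) abs_mult elim!: eventually_mono\<close>)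
  then show ?thesis using assms(3) by (simp add: weighted_L1_def)
qed

lemma fun_subspace_weighted_L1:
  assumes "M \<in> borel_measurable N" "\<And>x. 0 \<le> M x"
  shows "fun_subspace (weighted_L1 N M)"
  unfolding fun_subspace_def
proof (intro conjI ballI allI)
  fix q r :: "'a \<Rightarrow> 'b" and c :: real assume q: "q \<in> weighted_L1 N M"
  note [measurable] = assms(1) weighted_L1_measurable[OF q]
  show "(\<lambda>a. c *\<^sub>R q a) \<in> weighted_L1 N M"
    by (rule weighted_L1_dominated[where g = "\<lambda>x. \<bar>c\<bar> * (M x * norm (q x))"])
       (auto intro: assms weighted_L1_integrable[OF q])
  assume r: "r \<in> weighted_L1 N M"
  note [measurable] = weighted_L1_measurable[OF r]
  show "(\<lambda>a. q a + r a) \<in> weighted_L1 N M"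
  proof (rule weighted_L1_dominated[where g = "\<lambda>x. M x * norm (q x) + M x * norm (r x)"])
    show "AE x in N. M x * norm (q x + r x) \<le> M x * norm (q x) + M x * norm (r x)"
      unfolding distrib_left[symmetric] using assms(2) by (intro AE_I2 mult_left_mono norm_triangle_ineq)
  qed (auto intro: assms weighted_L1_integrable[OF q] weighted_L1_integrable[OF r])
qed (use assms in \<open>auto simp: weighted_L1_def\<close>)

text \<open>The single test set \<open>{h > 0}\<close> decides: the integral of a nonnegative
  function over it is at most \<open>0\<close>, so that function vanishes almost everywhere.\<close>

lemma AE_nonpos_of_set_integrals:
  fixes h :: "'a \<Rightarrow> real"
  assumes h: "integrable N h" and le: "\<And>A. A \<in> sets N \<Longrightarrow> (\<integral>x. indicator A x * h x \<partial>N) \<le> 0"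
  shows "AE x in N. h x \<le> 0"
proof -
  note [measurable] = borel_measurable_integrable[OF h]
  define A where "A = {x \<in> space N. 0 < h x}"
  have [measurable]: "A \<in> sets N" unfolding A_def by measurable
  have i: "integrable N (\<lambda>x. indicator A x * h x)"
    using integrable_real_mult_indicator[OF _ h, of A] by (simp add: mult.commute)
  have nn: "AE x in N. 0 \<le> indicator A x * h x"
    by (auto simp: A_def indicator_def)
  have "(\<integral>x. indicator A x * h x \<partial>N) = 0"
    using le[of A] integral_nonneg_AE[OF nn] by simp
  then have "AE x in N. indicator A x * h x = 0"
    using integral_nonneg_eq_0_iff_AE[OF i nn] by simp
  then show ?thesis
    using AE_space by eventually_elim (auto simp: A_def indicator_def split: if_splits)
qed

lemma linear_on_funs_0:
  assumes E: "fun_subspace E" and L: "linear_on_funs E L"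
  shows "L (\<lambda>_. 0) = 0"
proof -
  have "\<forall>x\<in>E. L (\<lambda>a. 0 *\<^sub>R x a) = 0 * L x" 
    by (rule L[unfolded linear_on_funs_def, THEN conjunct2, THEN spec[of _ 0]])
  from bspec[OF this fun_subspace_0[OF E]] show ?thesis by simp
qed

lemma linear_on_funs_sum:
  assumes E: "fun_subspace E" and L: "linear_on_funs E L"
    and q: "\<And>i. i \<in> I \<Longrightarrow> q i \<in> E"
  shows "L (\<lambda>x. \<Sum>i\<in>I. q i x) = (\<Sum>i\<in>I. L (q i)) \<and> (\<lambda>x. \<Sum>i\<in>I. q i x) \<in> E"
  using q
proof (induction I rule: infinite_finite_induct)
  case (insert i I)
  then show ?case
    using L fun_subspace_add[OF E] by (simp add: linear_on_funs_def)
next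
  case (infinite I)
  then show ?case using fun_subspace_0[OF E] linear_on_funs_0[OF E L] by simp
next
  case empty
  then show ?case using fun_subspace_0[OF E] linear_on_funs_0[OF E L] by simp
qed

text \<open>With such a \<open>w\<close>, the function \<open>indicator A * w\<close> lies in the
  weighted space for every measurable \<open>A\<close>, while a plain indicator may have infinite
  weighted norm. Dividing a positive integrable \<open>f\<close> by \<open>1 + W\<close> works
  because \<open>W / (1 + W) \<le> 1\<close>.\<close>

lemma (in sigma_finite_measure) obtain_weight:
  assumes [measurable]: "W \<in> borel_measurable M" and W: "\<And>x. 0 \<le> W x"
  obtains w :: "'a \<Rightarrow> real" where "w \<in> borel_measurable M" "\<And>x. 0 < w x"
    "integrable M (\<lambda>x. W x * w x)"
proof -
  obtain f :: "'a \<Rightarrow> real" where f[measurable]: "f \<in> borel_measurable M" "\<And>x. 0 < f x"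
    and i: "integrable M f"
    using obtain_positive_integrable_function by metis
  have le: "W x * (f x / (1 + W x)) \<le> f x" for x
    using f(2)[of x] W[of x] by (auto simp: field_simps)
  have [simp]: "\<bar>1 + W x\<bar> = 1 + W x" for x using W[of x] by simp
  have nn: "0 < f x / (1 + W x)" for x using f(2)[of x] W[of x] by (intro divide_pos_pos) auto
  show thesis
  proof (rule that)
    show "integrable M (\<lambda>x. W x * (f x / (1 + W x)))"
      using nn le W by (intro Bochner_Integration.integrable_bound[OF i])
        (auto intro!: AE_I2 simp: less_imp_le abs_of_pos f(2) abs_mult)
  qed (use nn in auto)
qed

text \<open>Adding \<open>\<integral> W s\<close> turns a functional dominated by \<open>\<integral> W \<bar>s\<bar>\<close> into a positive one, to which
  Radon--Nikodym applies without a Jordan decomposition.\<close>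

lemma (in sigma_finite_measure) dominated_functional_density:
  fixes L :: "('a \<Rightarrow> real) \<Rightarrow> real"
  assumes W[measurable]: "W \<in> borel_measurable M" and W0: "\<And>x. 0 \<le> W x"
    and L: "linear_on_funs (weighted_L1 M W) L"
    and le: "\<And>s. s \<in> weighted_L1 M W \<Longrightarrow> L s \<le> (\<integral>x. W x * \<bar>s x\<bar> \<partial>M)"
  obtains v where "v \<in> borel_measurable M"
    "\<And>s. s \<in> weighted_L1 M W \<Longrightarrow> integrable M (\<lambda>x. v x * s x) \<and> L s = (\<integral>x. v x * s x \<partial>M)"
proof -
  let ?E = "weighted_L1 M W :: ('a \<Rightarrow> real) set"
  obtain w :: "'a \<Rightarrow> real" where w[measurable]: "w \<in> borel_measurable M" and w0: "\<And>x. 0 < w x"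
    and Ww: "integrable M (\<lambda>x. W x * w x)"
    using obtain_weight[OF W W0] by metis
  have E: "fun_subspace ?E" by (rule fun_subspace_weighted_L1[OF W W0])
  have iW: "integrable M (\<lambda>x. W x * \<bar>s x\<bar>)" "integrable M (\<lambda>x. W x * s x)" if "s \<in> ?E" for s
  proof -
    note [measurable] = weighted_L1_measurable[OF that]
    show i: "integrable M (\<lambda>x. W x * \<bar>s x\<bar>)" using weighted_L1_integrable[OF that] by simp
    show "integrable M (\<lambda>x. W x * s x)"
      by (rule Bochner_Integration.integrable_bound[OF i]) (auto simp: abs_mult)
  qed
  have Ladd: "L (\<lambda>x. s x + t x) = L s + L t" if "s \<in> ?E" "t \<in> ?E" for s t
    using L that by (simp add: linear_on_funs_def)
  have Lsc: "L (\<lambda>x. c * s x) = c * L s" if "s \<in> ?E" for c s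
    using L that unfolding linear_on_funs_def by simp
  define \<Lambda> where "\<Lambda> s = L s + (\<integral>x. W x * s x \<partial>M)" for s
  have \<Lambda>add: "\<Lambda> (\<lambda>x. s x + t x) = \<Lambda> s + \<Lambda> t" if "s \<in> ?E" "t \<in> ?E" for s t
    using that iW(2) by (simp add: \<Lambda>_def Ladd distrib_left)
  have \<Lambda>sc: "\<Lambda> (\<lambda>x. c * s x) = c * \<Lambda> s" if "s \<in> ?E" for c s
    using that by (simp add: \<Lambda>_def Lsc mult.left_commute[of _ c] distrib_left)
  have Ln: "- L s \<le> (\<integral>x. W x * \<bar>s x\<bar> \<partial>M)" if "s \<in> ?E" for s
    using le[OF fun_subspace_uminus[OF E that]] Lsc[OF that, of "-1"] by simp
  have \<Lambda>0: "0 \<le> \<Lambda> s" if "s \<in> ?E" "\<And>x. 0 \<le> s x" for s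
    using Ln[OF that(1)] that(2) by (simp add: \<Lambda>_def abs_of_nonneg)
  have \<Lambda>le: "\<bar>\<Lambda> s\<bar> \<le> 2 * (\<integral>x. W x * \<bar>s x\<bar> \<partial>M)" if "s \<in> ?E" for s
  proof -
    have "\<bar>\<integral>x. W x * s x \<partial>M\<bar> \<le> (\<integral>x. \<bar>W x * s x\<bar> \<partial>M)" by (rule integral_abs_bound)
    then show ?thesis using le[OF that] Ln[OF that] by (simp add: \<Lambda>_def abs_mult W0)
  qed
  \<comment> \<open>Dominated convergence for \<Lambda>. It is used twice: for countable additivity
    of the set function \<open>m\<close> and for the limit step of the induction over integrable
    functions.\<close>
  have cont: "(\<lambda>n. \<Lambda> (s n)) \<longlonglongrightarrow> \<Lambda> t"
    if s: "\<And>n. s n \<in> borel_measurable M" and t: "t \<in> borel_measurable M" and g: "g \<in> ?E"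
      and lim: "\<And>x. x \<in> space M \<Longrightarrow> (\<lambda>n. s n x) \<longlonglongrightarrow> t x"
      and bd: "\<And>n x. x \<in> space M \<Longrightarrow> \<bar>s n x\<bar> \<le> \<bar>g x\<bar>" for s t g
  proof -
    note [measurable] = s t weighted_L1_measurable[OF g]
    have bt: "\<bar>t x\<bar> \<le> \<bar>g x\<bar>" if "x \<in> space M" for x
      using bd[OF that] by (intro tendsto_upperbound[OF tendsto_rabs[OF lim[OF that]]]) auto
    have in_E: "r \<in> ?E" if [measurable]: "r \<in> borel_measurable M" and "\<And>x. x \<in> space M \<Longrightarrow> \<bar>r x\<bar> \<le> \<bar>g x\<bar>" for r
      by (rule weighted_L1_dominated[OF W W0 that(1) iW(1)[OF g]]) (use that W0 in \<open>auto intro!: AE_I2 mult_left_mono\<close>)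
    have sE: "s n \<in> ?E" "t \<in> ?E" for n using bd bt by (auto intro!: in_E)
    have dE: "(\<lambda>x. s n x - t x) \<in> ?E" for n
      using fun_subspace_add[OF E sE(1) fun_subspace_uminus[OF E sE(2)]] by simp
    have "(\<lambda>n. \<integral>x. W x * \<bar>s n x - t x\<bar> \<partial>M) \<longlonglongrightarrow> (\<integral>x. 0 \<partial>M)"
    proof (rule integral_dominated_convergence[where w = "\<lambda>x. 2 * (W x * \<bar>g x\<bar>)"])
      show "AE x in M. (\<lambda>n. W x * \<bar>s n x - t x\<bar>) \<longlonglongrightarrow> 0"
      proof (rule AE_I2)
        fix x assume "x \<in> space M"
        then have "(\<lambda>n. W x * \<bar>s n x - t x\<bar>) \<longlonglongrightarrow> W x * \<bar>t x - t x\<bar>"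
          by (intro tendsto_intros lim)
        then show "(\<lambda>n. W x * \<bar>s n x - t x\<bar>) \<longlonglongrightarrow> 0" by simp
      qed
      show "AE x in M. norm (W x * \<bar>s n x - t x\<bar>) \<le> 2 * (W x * \<bar>g x\<bar>)" for n
      proof (rule AE_I2)
        fix x assume x: "x \<in> space M"
        have "W x * \<bar>s n x - t x\<bar> \<le> W x * (\<bar>g x\<bar> + \<bar>g x\<bar>)"
          using bd[OF x, of n] bt[OF x] W0[of x] by (intro mult_left_mono) auto
        then show "norm (W x * \<bar>s n x - t x\<bar>) \<le> 2 * (W x * \<bar>g x\<bar>)" using W0[of x] by (simp add: abs_mult)
      qed
    qed (use iW(1)[OF g] in auto)
    then have lim0: "(\<lambda>n. 2 * (\<integral>x. W x * \<bar>s n x - t x\<bar> \<partial>M)) \<longlonglongrightarrow> 0"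
      by (auto intro: tendsto_eq_intros)
    have "\<bar>\<Lambda> (s n) - \<Lambda> t\<bar> \<le> 2 * (\<integral>x. W x * \<bar>s n x - t x\<bar> \<partial>M)" for n
      using \<Lambda>le[OF dE[of n]] \<Lambda>add[OF dE[of n] sE(2)] by simp
    then have "(\<lambda>n. \<Lambda> (s n) - \<Lambda> t) \<longlonglongrightarrow> 0"
      by (intro Lim_null_comparison[OF _ lim0]) auto
    then show ?thesis by (rule LIM_zero_cancel)
  qed
  \<comment> \<open>These values form a finite measure. Its density with respect to
    \<open>M\<close>, divided by \<open>w\<close>, is the density of \<Lambda>.\<close>
  define m where "m A = \<Lambda> (\<lambda>x. indicator A x * w x)" for A
  have wE: "w \<in> ?E" using Ww w0 by (simp add: weighted_L1_def abs_of_pos)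
  have AE': "(\<lambda>x. indicator A x * w x) \<in> ?E" if [measurable]: "A \<in> sets M" for A
    by (rule weighted_L1_dominated[OF W W0 _ Ww])
       (auto intro!: AE_I2 simp: indicator_def W0 w0 less_imp_le abs_mult)
  have m0: "0 \<le> m A" if "A \<in> sets M" for A
    unfolding m_def using w0 by (intro \<Lambda>0 AE' that) (simp add: less_imp_le)
  have \<Lambda>z: "\<Lambda> (\<lambda>_. 0) = 0" using \<Lambda>sc[OF wE, of 0] by simp
  have mle: "m A \<le> 2 * (\<integral>x. indicator A x * (W x * w x) \<partial>M)" if "A \<in> sets M" for A
    using \<Lambda>le[OF AE'[OF that]] w0 by (simp add: m_def abs_mult abs_of_pos mult.left_commute)
  have mU: "(\<Sum>i<n. m (A i)) = \<Lambda> (\<lambda>x. indicator (\<Union>i<n. A i) x * w x)"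
    if "\<And>i. A i \<in> sets M" "disjoint_family A" for n and A :: "nat \<Rightarrow> 'a set"
  proof (induction n)
    case (Suc n)
    have "A n \<inter> A i = {}" if "i < n" for i
      using disjoint_family_onD[OF \<open>disjoint_family A\<close>, of n i] that by simp
    then have d: "A n \<inter> (\<Union>i<n. A i) = {}" by blast
    have "(\<Sum>i<Suc n. m (A i)) =
        \<Lambda> (\<lambda>x. indicator (\<Union>i<n. A i) x * w x) + \<Lambda> (\<lambda>x. indicator (A n) x * w x)"
      using Suc by (simp add: m_def[of "A n"])
    also have "\<dots> = \<Lambda> (\<lambda>x. indicator (\<Union>i<n. A i) x * w x + indicator (A n) x * w x)"
      using that(1) by (intro \<Lambda>add[symmetric] AE' sets.finite_UN) auto
    also have "(\<lambda>x. indicator (\<Union>i<n. A i) x * w x + indicator (A n) x * w x) =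
        (\<lambda>x. indicator (\<Union>i<Suc n. A i) x * w x)"
      using d by (auto simp: fun_eq_iff indicator_def lessThan_Suc)
    finally show ?case .
  qed (simp add: \<Lambda>z)
  have ca: "(\<lambda>i. m (A i)) sums m (\<Union>i. A i)"
    if A[measurable]: "\<And>i. A i \<in> sets M" and d: "disjoint_family A" for A :: "nat \<Rightarrow> 'a set"
    unfolding sums_def mU[OF that] m_def[of "\<Union>i. A i"]
  proof (rule cont[OF _ _ wE])
    fix x
    show "(\<lambda>n. indicator (\<Union>i<n. A i) x * w x) \<longlonglongrightarrow> indicator (\<Union>i. A i) x * w x"
      by (intro tendsto_intros) (rule LIMSEQ_indicator_UN)
  qed (auto simp: indicator_def)
  define \<mu> where "\<mu> = measure_of (space M) (sets M) (\<lambda>A. ennreal (m A))"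
  have sets\<mu>: "sets \<mu> = sets M" by (simp add: \<mu>_def)
  have em: "emeasure \<mu> A = ennreal (m A)" if "A \<in> sets M" for A
  proof (rule emeasure_measure_of[OF \<mu>_def])
    show "positive (sets \<mu>) (\<lambda>A. ennreal (m A))"
      by (simp add: positive_def m_def \<Lambda>z)
    show "countably_additive (sets \<mu>) (\<lambda>A. ennreal (m A))"
    proof (rule countably_additiveI)
      fix A :: "nat \<Rightarrow> 'a set" assume "range A \<subseteq> sets \<mu>" "disjoint_family A" "\<Union> (range A) \<in> sets \<mu>"
      then have A: "A i \<in> sets M" "\<Union> (range A) \<in> sets M" "disjoint_family A" for i by (auto simp: sets\<mu>)
      have "(\<lambda>i. ennreal (m (A i))) sums ennreal (m (\<Union> (range A)))"
        using A by (subst sums_ennreal) (auto intro: ca m0)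
      then show "(\<Sum>i. ennreal (m (A i))) = ennreal (m (\<Union> (range A)))" by (rule sums_unique[symmetric])
    qed
  qed (use that sets.space_closed in \<open>auto simp: sets\<mu>\<close>)
  have "absolutely_continuous M \<mu>"
    unfolding absolutely_continuous_def
  proof
    fix A assume A: "A \<in> null_sets M"
    then have "AE x in M. x \<notin> A" "A \<in> sets M" by (auto intro: AE_not_in)
    have "(\<integral>x. indicator A x * (W x * w x) \<partial>M) = (\<integral>x. 0 \<partial>M)"
      using \<open>AE x in M. x \<notin> A\<close> \<open>A \<in> sets M\<close> by (intro integral_cong_AE) (auto elim!: eventually_mono)
    then have "m A = 0" using mle m0 \<open>A \<in> sets M\<close> by (metis antisym integral_zero mult_zero_right)
    then show "A \<in> null_sets \<mu>" using em \<open>A \<in> sets M\<close> sets\<mu> by (auto intro: null_setsI)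
  qed
  from Radon_Nikodym[OF this sets\<mu>] obtain g where g[measurable]: "g \<in> borel_measurable M"
    and gd: "density M g = \<mu>" by auto
  have gA: "(\<integral>\<^sup>+x. g x * indicator A x \<partial>M) = ennreal (m A)" if "A \<in> sets M" for A
    using em[OF that] that by (simp add: gd[symmetric] emeasure_density)
  have "(\<integral>\<^sup>+x. g x \<partial>M) = (\<integral>\<^sup>+x. g x * indicator (space M) x \<partial>M)" by (intro nn_integral_cong) simp
  then have "(\<integral>\<^sup>+x. g x \<partial>M) \<noteq> \<infinity>" using gA[of "space M"] by simp
  then have gfin: "AE x in M. g x \<noteq> \<infinity>" by (rule nn_integral_PInf_AE[OF g])
  define \<gamma> where "\<gamma> x = enn2real (g x)" for x
  have \<gamma>m[measurable]: "\<gamma> \<in> borel_measurable M" unfolding \<gamma>_def by measurable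
  have hb: "has_bochner_integral M (\<lambda>x. indicator A x * \<gamma> x) (m A)" if [measurable]: "A \<in> sets M" for A
  proof (rule has_bochner_integral_nn_integral)
    have "(\<integral>\<^sup>+x. ennreal (indicator A x * \<gamma> x) \<partial>M) = (\<integral>\<^sup>+x. g x * indicator A x \<partial>M)"
      using gfin by (intro nn_integral_cong_AE, eventually_elim)
        (auto simp: \<gamma>_def indicator_def less_top)
    then show "(\<integral>\<^sup>+x. ennreal (indicator A x * \<gamma> x) \<partial>M) = ennreal (m A)" using gA that by simp
  qed (auto simp: m0 \<gamma>_def)
  have \<gamma>i: "integrable M \<gamma>"
  proof -
    have "integrable M (\<lambda>x. indicator (space M) x * \<gamma> x)" using hb[of "space M"] by (auto simp: has_bochner_integral_iff)
    then show ?thesis by (rule Bochner_Integration.integrable_cong[THEN iffD1, rotated -1]) auto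
  qed
  have Wi: "integrable M (\<lambda>x. indicator A x * (W x * w x))" if "A \<in> sets M" for A
    using integrable_real_mult_indicator[OF that Ww] by (simp add: mult.commute)
  \<comment> \<open>The bound on \<open>m\<close> passes to its density; it makes
    \<open>f * \<gamma>\<close> integrable whenever \<open>W * w * f\<close> is.\<close>
  have \<gamma>le: "AE x in M. \<gamma> x \<le> 2 * (W x * w x)"
  proof -
    have "AE x in M. \<gamma> x - 2 * (W x * w x) \<le> 0"
    proof (rule AE_nonpos_of_set_integrals)
      fix A assume A: "A \<in> sets M"
      have "(\<integral>x. indicator A x * (\<gamma> x - 2 * (W x * w x)) \<partial>M) =
          (\<integral>x. indicator A x * \<gamma> x - 2 * (indicator A x * (W x * w x)) \<partial>M)"
        by (intro Bochner_Integration.integral_cong) (auto simp: algebra_simps)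
      also have "\<dots> = m A - 2 * (\<integral>x. indicator A x * (W x * w x) \<partial>M)"
        using hb[OF A] Wi[OF A] by (subst Bochner_Integration.integral_diff) (auto simp: has_bochner_integral_iff)
      finally show "(\<integral>x. indicator A x * (\<gamma> x - 2 * (W x * w x)) \<partial>M) \<le> 0" using mle[OF A] by simp
    qed (use \<gamma>i Ww in auto)
    then show ?thesis by simp
  qed
  \<comment> \<open>For this measure, integrability of \<open>f\<close> means that
    \<open>f * w\<close> lies in the weighted space. Every element \<open>s\<close> of that space
    has this form with \<open>f = s / w\<close>, so the induction over integrable functions reaches
    all of it.\<close>
  let ?\<kappa> = "density M (\<lambda>x. ennreal (W x * w x))"
  have Ww0: "0 \<le> W x * w x" for x using W0[of x] w0[of x] by simp
  have \<kappa>: "integrable ?\<kappa> f \<longleftrightarrow> integrable M (\<lambda>x. W x * w x * f x)" if "f \<in> borel_measurable M" for f :: "'a \<Rightarrow> real"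
    using that Ww0 by (intro integrable_real_density) auto
  have \<kappa>m: "f \<in> borel_measurable M" if "integrable ?\<kappa> f" for f :: "'a \<Rightarrow> real"
    using borel_measurable_integrable[OF that] by simp
  have \<kappa>i: "integrable M (\<lambda>x. W x * w x * \<bar>f x\<bar>)" if "integrable ?\<kappa> f" for f :: "'a \<Rightarrow> real"
    using integrable_norm[OF \<kappa>[OF \<kappa>m[OF that], THEN iffD1, OF that]] Ww0 by (simp add: abs_mult abs_of_pos w0 W0)
  have \<kappa>E: "(\<lambda>x. f x * w x) \<in> ?E" if "integrable ?\<kappa> f" for f :: "'a \<Rightarrow> real"
  proof -
    note [measurable] = \<kappa>m[OF that]
    show ?thesis
      by (rule weighted_L1_dominated[OF W W0 _ \<kappa>i[OF that]]) (auto simp: abs_mult w0 abs_of_pos)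
  qed
  have \<gamma>f: "integrable M (\<lambda>x. f x * \<gamma> x)" if "integrable ?\<kappa> f" for f :: "'a \<Rightarrow> real"
  proof -
    note [measurable] = \<kappa>m[OF that]
    show ?thesis
    proof (rule Bochner_Integration.integrable_bound[OF integrable_mult_right[OF \<kappa>i[OF that], of 2]])
      show "AE x in M. norm (f x * \<gamma> x) \<le> norm (2 * (W x * w x * \<bar>f x\<bar>))"
        using \<gamma>le
      proof eventually_elim
        case (elim x)
        then have "\<bar>f x\<bar> * \<gamma> x \<le> \<bar>f x\<bar> * (2 * (W x * w x))" by (intro mult_left_mono) auto
        then show ?case using Ww0[of x] by (simp add: abs_mult abs_of_nonneg \<gamma>_def W0 w0 less_imp_le algebra_simps)
      qed
    qed simp
  qed
  have rep: "\<Lambda> (\<lambda>x. f x * w x) = (\<integral>x. f x * \<gamma> x \<partial>M)" if "integrable ?\<kappa> f" for f :: "'a \<Rightarrow> real"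
    using that
  proof (induction f rule: integrable_induct)
    case (base A c)
    then have A: "A \<in> sets M" by simp
    have "\<Lambda> (\<lambda>x. c * (indicator A x * w x)) = c * m A" unfolding m_def by (rule \<Lambda>sc[OF AE'[OF A]])
    also have "\<dots> = (\<integral>x. c * (indicator A x * \<gamma> x) \<partial>M)" using hb[OF A] by (simp add: has_bochner_integral_iff)
    finally show ?case by (simp add: ac_simps)
  next
    case (add f g)
    have "\<Lambda> (\<lambda>x. (f x + g x) * w x) = \<Lambda> (\<lambda>x. f x * w x) + \<Lambda> (\<lambda>x. g x * w x)"
      using \<Lambda>add[OF \<kappa>E[OF add.hyps(1)] \<kappa>E[OF add.hyps(2)]] by (simp add: distrib_right)
    also have "\<dots> = (\<integral>x. (f x + g x) * \<gamma> x \<partial>M)"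
      using add \<gamma>f by (simp add: distrib_right)
    finally show ?case .
  next
    case (lim f s)
    note [measurable] = \<kappa>m[OF lim.hyps(1)] \<kappa>m[OF lim.hyps(4)]
    have 1: "(\<lambda>n. \<Lambda> (\<lambda>x. s n x * w x)) \<longlonglongrightarrow> \<Lambda> (\<lambda>x. f x * w x)"
    proof (rule cont[OF _ _ fun_subspace_scale[OF E \<kappa>E[OF lim.hyps(4)], of 2]])
      fix x n assume x: "x \<in> space M"
      then show "(\<lambda>n. s n x * w x) \<longlonglongrightarrow> f x * w x" using lim.hyps(2) by (intro tendsto_intros) auto
      have "\<bar>s n x\<bar> * w x \<le> (2 * \<bar>f x\<bar>) * w x"
        using lim.hyps(3)[of x n] x w0[of x] by (intro mult_right_mono) auto
      then show "\<bar>s n x * w x\<bar> \<le> \<bar>2 *\<^sub>R (f x * w x)\<bar>" using w0[of x] by (simp add: abs_mult)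
    qed auto
    have 2: "(\<lambda>n. \<integral>x. s n x * \<gamma> x \<partial>M) \<longlonglongrightarrow> (\<integral>x. f x * \<gamma> x \<partial>M)"
    proof (rule integral_dominated_convergence[where w = "\<lambda>x. 2 * \<bar>f x * \<gamma> x\<bar>"])
      show "AE x in M. (\<lambda>n. s n x * \<gamma> x) \<longlonglongrightarrow> f x * \<gamma> x"
        using lim.hyps(2) by (intro AE_I2 tendsto_intros) auto
      show "AE x in M. norm (s n x * \<gamma> x) \<le> 2 * \<bar>f x * \<gamma> x\<bar>" for n
      proof (rule AE_I2)
        fix x assume x: "x \<in> space M"
        have "\<bar>s n x\<bar> * \<gamma> x \<le> (2 * \<bar>f x\<bar>) * \<gamma> x"
          using lim.hyps(3)[of x n] x by (intro mult_right_mono) (auto simp: \<gamma>_def)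
        then show "norm (s n x * \<gamma> x) \<le> 2 * \<bar>f x * \<gamma> x\<bar>" by (simp add: abs_mult \<gamma>_def)
      qed
    qed (use integrable_abs[OF \<gamma>f[OF lim.hyps(4)]] in auto)
    show ?case using 1 unfolding lim.IH by (rule LIMSEQ_unique[OF _ 2])
  qed
  show thesis
  proof (rule that)
    \<comment> \<open>Division by \<open>w\<close> undoes the substitution
      \<open>s = (s / w) * w\<close>, and \<open>- W\<close> takes back the integral that was added
      to \<open>L\<close> in \<Lambda>.\<close>
    show "(\<lambda>x. \<gamma> x / w x - W x) \<in> borel_measurable M" by measurable
    fix s assume s: "s \<in> ?E"
    note [measurable] = weighted_L1_measurable[OF s]
    have i: "integrable ?\<kappa> (\<lambda>x. s x / w x)"
      using iW(2)[OF s] w0 by (subst \<kappa>) (auto simp: less_imp_neq[THEN not_sym])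
    have eq: "(\<lambda>x. s x / w x * w x) = s" using w0 by (auto simp: less_imp_neq[THEN not_sym])
    have 1: "\<Lambda> s = (\<integral>x. s x / w x * \<gamma> x \<partial>M)" using rep[OF i] unfolding eq .
    have 2: "(\<lambda>x. (\<gamma> x / w x - W x) * s x) = (\<lambda>x. s x / w x * \<gamma> x - W x * s x)"
      by (auto simp: field_simps)
    show "integrable M (\<lambda>x. (\<gamma> x / w x - W x) * s x) \<and> L s = (\<integral>x. (\<gamma> x / w x - W x) * s x \<partial>M)"
      unfolding 2 using \<gamma>f[OF i] iW(2)[OF s] 1 by (simp add: \<Lambda>_def)
  qed
qed

text \<open>Scalar densities of the coordinates are assembled into one vector field. For the
  pointwise bound, \<open>indicator A * w\<close> times a fixed \<xi> is inserted; positive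
  homogeneity moves the scalar out of \<sigma>, which leaves an inequality of integrals over every
  \<open>A\<close>. The exceptional null set depends on \<xi>, and a countable dense set of \<xi>
  together with continuity of \<sigma> removes that dependence.\<close>

lemma (in sigma_finite_measure) dominated_functional_representation:
  fixes \<psi> :: "('a \<Rightarrow> 'b::euclidean_space) \<Rightarrow> real"
  assumes W[measurable]: "W \<in> borel_measurable M" and W0: "\<And>x. 0 \<le> W x"
    and L: "linear_on_funs (weighted_L1 M W) \<psi>"
    and le: "\<And>q. q \<in> weighted_L1 M W \<Longrightarrow> \<psi> q \<le> (\<integral>x. \<sigma> x (q x) \<partial>M)"
    and \<sigma>[measurable]: "\<And>\<xi>. (\<lambda>x. \<sigma> x \<xi>) \<in> borel_measurable M"
    and \<sigma>W: "AE x in M. \<forall>\<xi>. \<bar>\<sigma> x \<xi>\<bar> \<le> W x * norm \<xi>"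
    and \<sigma>c: "AE x in M. continuous_on UNIV (\<sigma> x)"
    and \<sigma>h: "\<And>x c \<xi>. 0 \<le> c \<Longrightarrow> \<sigma> x (c *\<^sub>R \<xi>) = c * \<sigma> x \<xi>"
  obtains v where "v \<in> borel_measurable M"
    "\<And>q. q \<in> weighted_L1 M W \<Longrightarrow> has_bochner_integral M (\<lambda>x. v x \<bullet> q x) (\<psi> q)"
    "AE x in M. \<forall>\<xi>. v x \<bullet> \<xi> \<le> \<sigma> x \<xi>"
proof -
  let ?E = "weighted_L1 M W :: ('a \<Rightarrow> 'b) set" and ?E1 = "weighted_L1 M W :: ('a \<Rightarrow> real) set"
  have E: "fun_subspace ?E" by (rule fun_subspace_weighted_L1[OF W W0])
  have bE: "(\<lambda>x. s x *\<^sub>R b) \<in> ?E" if s: "s \<in> ?E1" for s and b :: 'b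
  proof -
    note [measurable] = weighted_L1_measurable[OF s]
    show ?thesis
      by (rule weighted_L1_dominated[OF W W0 _ integrable_mult_left[OF weighted_L1_integrable[OF s], of "norm b"]])
         (auto simp: mult_ac)
  qed
  have \<psi>le: "\<psi> q \<le> (\<integral>x. W x * norm (q x) \<partial>M)" if q: "q \<in> ?E" for q
  proof -
    have "(\<integral>x. \<sigma> x (q x) \<partial>M) \<le> (\<integral>x. W x * norm (q x) \<partial>M)"
    proof (cases "integrable M (\<lambda>x. \<sigma> x (q x))")
      case True
      then show ?thesis
        using \<sigma>W by (intro integral_mono_AE weighted_L1_integrable[OF q]) (auto elim!: eventually_mono dest: abs_le_D1)
    next
      case False
      \<comment> \<open>A non-integrable integrand has integral \<open>0\<close> by convention, and
        the right side is nonnegative.\<close>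
      then show ?thesis using W0 by (simp add: not_integrable_integral_eq integral_nonneg_AE)
    qed
    with le[OF q] show ?thesis by simp
  qed
  have "\<exists>v. v \<in> borel_measurable M \<and> (\<forall>s\<in>?E1. integrable M (\<lambda>x. v x * s x) \<and>
      \<psi> (\<lambda>x. s x *\<^sub>R b) = (\<integral>x. v x * s x \<partial>M))" if b: "b \<in> Basis" for b :: 'b
  proof -
    have lin: "linear_on_funs ?E1 (\<lambda>s. \<psi> (\<lambda>x. s x *\<^sub>R b))"
      unfolding linear_on_funs_def
    proof (intro conjI ballI allI)
      fix s t c assume s: "s \<in> ?E1"
      show "\<psi> (\<lambda>x. (c *\<^sub>R s x) *\<^sub>R b) = c * \<psi> (\<lambda>x. s x *\<^sub>R b)"
        using L[unfolded linear_on_funs_def, THEN conjunct2, THEN spec[of _ c], THEN bspec, OF bE[OF s, of b]]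
        by (simp add: scaleR_scaleR)
      assume t: "t \<in> ?E1"
      show "\<psi> (\<lambda>x. (s x + t x) *\<^sub>R b) = \<psi> (\<lambda>x. s x *\<^sub>R b) + \<psi> (\<lambda>x. t x *\<^sub>R b)"
        using L[unfolded linear_on_funs_def, THEN conjunct1, THEN bspec, OF bE[OF s, of b], THEN bspec, OF bE[OF t, of b]]
        by (simp add: scaleR_left_distrib)
    qed
    have le':  "\<psi> (\<lambda>x. s x *\<^sub>R b) \<le> (\<integral>x. W x * \<bar>s x\<bar> \<partial>M)" if "s \<in> ?E1" for s
      using \<psi>le[OF bE[OF that, of b]] b by simp
    show ?thesis
      by (rule dominated_functional_density[OF W W0 lin le']) blast+
  qed
  then have "\<forall>b\<in>Basis. \<exists>v. v \<in> borel_measurable M \<and> (\<forall>s\<in>?E1. integrable M (\<lambda>x. v x * s x) \<and>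
      \<psi> (\<lambda>x. s x *\<^sub>R b) = (\<integral>x. v x * s x \<partial>M))" by blast
  from bchoice[OF this] obtain v where v': "\<forall>b\<in>Basis. v b \<in> borel_measurable M \<and>
      (\<forall>s\<in>?E1. integrable M (\<lambda>x. v b x * s x) \<and> \<psi> (\<lambda>x. s x *\<^sub>R b) = (\<integral>x. v b x * s x \<partial>M))" ..
  have v[measurable]: "v b \<in> borel_measurable M" if "b \<in> Basis" for b using v' that by blast
  have vi: "integrable M (\<lambda>x. v b x * s x)" and v\<psi>: "\<psi> (\<lambda>x. s x *\<^sub>R b) = (\<integral>x. v b x * s x \<partial>M)"
    if "b \<in> Basis" "s \<in> ?E1" for b s using v' that by blast+
  define V where "V x = (\<Sum>b\<in>Basis. v b x *\<^sub>R b)" for x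
  have Vm[measurable]: "V \<in> borel_measurable M" unfolding V_def by measurable
  have rep: "has_bochner_integral M (\<lambda>x. V x \<bullet> q x) (\<psi> q)" if q: "q \<in> ?E" for q
  proof -
    note [measurable] = weighted_L1_measurable[OF q]
    have c: "(\<lambda>x. q x \<bullet> b) \<in> ?E1" if "b \<in> Basis" for b
      using that W0
      by (intro weighted_L1_dominated[OF W W0 _ weighted_L1_integrable[OF q]])
        (auto intro!: AE_I2 mult_left_mono Basis_le_norm)
    have "\<psi> q = \<psi> (\<lambda>x. \<Sum>b\<in>Basis. (q x \<bullet> b) *\<^sub>R b)" by (simp add: euclidean_representation)
    also have "\<dots> = (\<Sum>b\<in>Basis. \<psi> (\<lambda>x. (q x \<bullet> b) *\<^sub>R b))"
      using linear_on_funs_sum[OF E L, of Basis "\<lambda>b x. (q x \<bullet> b) *\<^sub>R b"] bE c by blast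
    also have "\<dots> = (\<Sum>b\<in>Basis. \<integral>x. v b x * (q x \<bullet> b) \<partial>M)"
      using v\<psi> c by (intro sum.cong) auto
    also have "\<dots> = (\<integral>x. (\<Sum>b\<in>Basis. v b x * (q x \<bullet> b)) \<partial>M)"
      using vi c by (subst Bochner_Integration.integral_sum) auto
    finally have "\<psi> q = \<dots>" .
    moreover have "(\<lambda>x. V x \<bullet> q x) = (\<lambda>x. \<Sum>b\<in>Basis. v b x * (q x \<bullet> b))"
      by (simp add: V_def inner_sum_left inner_commute[of "q _"])
    ultimately show ?thesis
      using vi c by (simp add: has_bochner_integral_iff)
  qed
  obtain w :: "'a \<Rightarrow> real" where w[measurable]: "w \<in> borel_measurable M" and w0: "\<And>x. 0 < w x"
    and Ww: "integrable M (\<lambda>x. W x * w x)"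
    using obtain_weight[OF W W0] by metis
  have pt: "AE x in M. V x \<bullet> \<xi> \<le> \<sigma> x \<xi>" for \<xi>
  proof -
    have wA: "(\<lambda>x. (indicator A x * w x) *\<^sub>R \<xi>) \<in> ?E" if [measurable]: "A \<in> sets M" for A
      using w0 W0 by (intro bE weighted_L1_dominated[OF W W0 _ Ww])
        (auto intro!: AE_I2 simp: indicator_def abs_mult abs_of_pos less_imp_le)
    have i\<sigma>: "integrable M (\<lambda>x. w x * \<sigma> x \<xi>)"
    proof (rule Bochner_Integration.integrable_bound[OF integrable_mult_left[OF Ww, of "norm \<xi>"]])
      show "AE x in M. norm (w x * \<sigma> x \<xi>) \<le> norm (W x * w x * norm \<xi>)"
        using \<sigma>W
      proof eventually_elim
        case (elim x)
        then have "w x * \<bar>\<sigma> x \<xi>\<bar> \<le> w x * (W x * norm \<xi>)" using w0[of x] by (intro mult_left_mono) auto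
        then show ?case using w0[of x] W0[of x] by (simp add: abs_mult ac_simps)
      qed
    qed simp
    have iV: "integrable M (\<lambda>x. w x * (V x \<bullet> \<xi>))"
    proof -
      have "integrable M (\<lambda>x. V x \<bullet> (indicator (space M) x * w x) *\<^sub>R \<xi>)"
        using rep[OF wA[of "space M"]] by (simp add: has_bochner_integral_iff)
      then show ?thesis by (rule Bochner_Integration.integrable_cong[THEN iffD1, rotated -1]) auto
    qed
    have "AE x in M. w x * (V x \<bullet> \<xi>) - w x * \<sigma> x \<xi> \<le> 0"
    proof (rule AE_nonpos_of_set_integrals)
      fix A assume A[measurable]: "A \<in> sets M"
      have "\<psi> (\<lambda>x. (indicator A x * w x) *\<^sub>R \<xi>) \<le> (\<integral>x. \<sigma> x ((indicator A x * w x) *\<^sub>R \<xi>) \<partial>M)"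
        by (rule le[OF wA[OF A]])
      also have "\<dots> = (\<integral>x. indicator A x * (w x * \<sigma> x \<xi>) \<partial>M)"
        using w0 by (simp add: \<sigma>h less_imp_le mult.assoc)
      finally have 1: "\<psi> (\<lambda>x. (indicator A x * w x) *\<^sub>R \<xi>) \<le> (\<integral>x. indicator A x * (w x * \<sigma> x \<xi>) \<partial>M)" .
      have "\<psi> (\<lambda>x. (indicator A x * w x) *\<^sub>R \<xi>) = (\<integral>x. V x \<bullet> (indicator A x * w x) *\<^sub>R \<xi> \<partial>M)"
        using rep[OF wA[OF A]] by (simp add: has_bochner_integral_iff)
      also have "\<dots> = (\<integral>x. indicator A x * (w x * (V x \<bullet> \<xi>)) \<partial>M)"
        by (simp add: mult.assoc)
      finally have 2: "(\<integral>x. indicator A x * (w x * (V x \<bullet> \<xi>)) \<partial>M) \<le> (\<integral>x. indicator A x * (w x * \<sigma> x \<xi>) \<partial>M)"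
        using 1 by simp
      have "(\<integral>x. indicator A x * (w x * (V x \<bullet> \<xi>) - w x * \<sigma> x \<xi>) \<partial>M) =
          (\<integral>x. indicator A x * (w x * (V x \<bullet> \<xi>)) - indicator A x * (w x * \<sigma> x \<xi>) \<partial>M)"
        by (simp add: right_diff_distrib)
      also have "\<dots> = (\<integral>x. indicator A x * (w x * (V x \<bullet> \<xi>)) \<partial>M) - (\<integral>x. indicator A x * (w x * \<sigma> x \<xi>) \<partial>M)"
        using integrable_real_mult_indicator[OF A iV] integrable_real_mult_indicator[OF A i\<sigma>]
        by (intro Bochner_Integration.integral_diff) (simp_all add: mult.commute)
      finally show "(\<integral>x. indicator A x * (w x * (V x \<bullet> \<xi>) - w x * \<sigma> x \<xi>) \<partial>M) \<le> 0" using 2 by simp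
    qed (use iV i\<sigma> in auto)
    then show ?thesis
    proof eventually_elim
      case (elim x)
      then have "w x * (V x \<bullet> \<xi>) \<le> w x * \<sigma> x \<xi>" by simp
      then show ?case using w0[of x] by simp
    qed
  qed
  obtain D :: "'b set" where D: "countable D" "\<And>X. open X \<Longrightarrow> X \<noteq> {} \<Longrightarrow> \<exists>d\<in>D. d \<in> X"
    using countable_dense_setE by metis
  have "AE x in M. \<forall>\<xi>\<in>D. V x \<bullet> \<xi> \<le> \<sigma> x \<xi>"
    using pt D(1) by (simp add: AE_ball_countable)
  then have "AE x in M. \<forall>\<xi>. V x \<bullet> \<xi> \<le> \<sigma> x \<xi>"
    using \<sigma>c
  proof eventually_elim
    case (elim x)
    have "open {\<xi>. \<sigma> x \<xi> < V x \<bullet> \<xi>}"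
      using elim(2) by (intro open_Collect_less continuous_intros)
    then have "{\<xi>. \<sigma> x \<xi> < V x \<bullet> \<xi>} = {}" using D(2) elim(1) by fastforce
    then show ?case by (auto simp: not_less)
  qed
  then show thesis using that[OF Vm rep] by blast
qed

section \<open>Codifferentials and support functions\<close>

text \<open>For \<open>c = 1\<close> this is \<open>codiff_Phi\<close>, and for
  \<open>c = -1\<close> at \<open>- h\<close> it is the negative of \<open>codiff_Psi\<close>. Large
  absolute values of \<open>c\<close> come from rescaling by a small step.\<close>

definition tilted_sup :: "(real \<times> 'a::euclidean_space) set \<Rightarrow> real \<Rightarrow> 'a \<Rightarrow> real" where
  "tilted_sup G c \<xi> = (SUP (a, v)\<in>G. c * a + v \<bullet> \<xi>)"

definition zero_slice :: "(real \<times> 'a) set \<Rightarrow> 'a set" where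
  "zero_slice G = {v. (0, v) \<in> G}"

definition support_fun :: "'a::euclidean_space set \<Rightarrow> 'a \<Rightarrow> real" where
  "support_fun K \<xi> = (SUP v\<in>K. v \<bullet> \<xi>)"

lemma bdd_above_compact_image:
  fixes f :: "'a::topological_space \<Rightarrow> real"
  assumes "compact K" "continuous_on K f"
  shows "bdd_above (f ` K)"
  using compact_continuous_image[OF assms(2,1)] by (intro bounded_imp_bdd_above compact_imp_bounded)

lemma tilted_sup_upper:
  assumes "compact G" "(a, v) \<in> G"
  shows "c * a + v \<bullet> \<xi> \<le> tilted_sup G c \<xi>"
proof -
  have "bdd_above ((\<lambda>p. c * fst p + snd p \<bullet> \<xi>) ` G)"
    using assms(1) by (intro bdd_above_compact_image continuous_intros)
  from cSUP_upper[OF assms(2) this] show ?thesis by (simp add: tilted_sup_def case_prod_beta')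
qed

lemma tilted_sup_least:
  assumes "G \<noteq> {}" "\<And>a v. (a, v) \<in> G \<Longrightarrow> c * a + v \<bullet> \<xi> \<le> b"
  shows "tilted_sup G c \<xi> \<le> b"
  unfolding tilted_sup_def using assms by (intro cSUP_least) auto

lemma less_tilted_sup_iff:
  assumes "compact G" "G \<noteq> {}"
  shows "b < tilted_sup G c \<xi> \<longleftrightarrow> (\<exists>(a, v)\<in>G. b < c * a + v \<bullet> \<xi>)"
  using tilted_sup_least[OF assms(2), of c \<xi> b] tilted_sup_upper[OF assms(1), of _ _ c \<xi>]
  by (force simp: not_less[symmetric])

lemma support_fun_upper:
  assumes "compact K" "v \<in> K"
  shows "v \<bullet> \<xi> \<le> support_fun K \<xi>"
  unfolding support_fun_def using assms
  by (intro cSUP_upper bdd_above_compact_image continuous_intros)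

lemma support_fun_least:
  assumes "K \<noteq> {}" "\<And>v. v \<in> K \<Longrightarrow> v \<bullet> \<xi> \<le> b"
  shows "support_fun K \<xi> \<le> b"
  unfolding support_fun_def using assms by (intro cSUP_least) auto

lemma support_fun_add_le:
  assumes "compact K" "K \<noteq> {}"
  shows "support_fun K (\<xi> + \<eta>) \<le> support_fun K \<xi> + support_fun K \<eta>"
  using support_fun_upper[OF assms(1), of _ \<xi>] support_fun_upper[OF assms(1), of _ \<eta>]
  by (intro support_fun_least assms) (force simp: inner_add_right intro: add_mono)

lemma support_fun_scale:
  assumes K: "compact K" "K \<noteq> {}" and c: "0 \<le> c"
  shows "support_fun K (c *\<^sub>R \<xi>) = c * support_fun K \<xi>"
proof (cases "c = 0")
  case True
  then show ?thesis using K by (simp add: support_fun_def)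
next
  case False
  with c have c: "0 < c" by simp
  show ?thesis
  proof (rule antisym)
    show "support_fun K (c *\<^sub>R \<xi>) \<le> c * support_fun K \<xi>"
      using c support_fun_upper[OF K(1)] by (intro support_fun_least K) (simp add: mult_left_mono)
    have "support_fun K \<xi> \<le> support_fun K (c *\<^sub>R \<xi>) / c"
      using c support_fun_upper[OF K(1), of _ "c *\<^sub>R \<xi>"]
      by (intro support_fun_least K) (simp add: pos_le_divide_eq mult.commute)
    then show "c * support_fun K \<xi> \<le> support_fun K (c *\<^sub>R \<xi>)"
      using c by (simp add: pos_le_divide_eq mult.commute)
  qed
qed

lemma abs_support_fun_le:
  assumes "compact K" "K \<noteq> {}" "\<And>v. v \<in> K \<Longrightarrow> norm v \<le> R"
  shows "\<bar>support_fun K \<xi>\<bar> \<le> R * norm \<xi>"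
proof -
  have b: "\<bar>v \<bullet> \<xi>\<bar> \<le> R * norm \<xi>" if "v \<in> K" for v
    using Cauchy_Schwarz_ineq2[of v \<xi>] assms(3)[OF that]
    by (meson mult_right_mono norm_ge_zero order_trans)
  obtain v where v: "v \<in> K" using assms(2) by blast
  have "support_fun K \<xi> \<le> R * norm \<xi>" using b by (intro support_fun_least assms) (auto dest: abs_le_D1)
  moreover have "- (R * norm \<xi>) \<le> support_fun K \<xi>"
    using support_fun_upper[OF assms(1) v, of \<xi>] b[OF v] by linarith
  ultimately show ?thesis by linarith
qed

lemma continuous_on_support_fun:
  assumes "compact K" "K \<noteq> {}"
  shows "continuous_on UNIV (support_fun K)"
proof -
  obtain R where R: "0 < R" "\<And>v. v \<in> K \<Longrightarrow> norm v \<le> R"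
    using compact_imp_bounded[OF assms(1)] by (auto simp: bounded_pos)
  have "R-lipschitz_on UNIV (support_fun K)"
  proof (rule lipschitz_onI)
    fix \<xi> \<eta> :: 'a
    have d: "support_fun K \<xi> - support_fun K \<eta> \<le> R * norm (\<xi> - \<eta>)" for \<xi> \<eta>
      using support_fun_add_le[OF assms, of "\<xi> - \<eta>" \<eta>] abs_support_fun_le[OF assms R(2), of "\<xi> - \<eta>"] by simp
    show "dist (support_fun K \<xi>) (support_fun K \<eta>) \<le> R * dist \<xi> \<eta>"
      using d[of \<xi> \<eta>] d[of \<eta> \<xi>] by (simp add: dist_norm norm_minus_commute abs_le_iff)
  qed (use R in auto)
  then show ?thesis by (rule lipschitz_on_continuous_on)
qed

lemma in_of_le_support_fun:
  assumes "compact K" "convex K" "K \<noteq> {}" and le: "\<And>\<xi>. v \<bullet> \<xi> \<le> support_fun K \<xi>"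
  shows "v \<in> K"
proof (rule ccontr)
  assume "v \<notin> K"
  then obtain a b where ab: "a \<bullet> v < b" "\<And>x. x \<in> K \<Longrightarrow> b < a \<bullet> x"
    using separating_hyperplane_closed_point[OF assms(2) compact_imp_closed[OF assms(1)]] by blast
  have "support_fun K (- a) \<le> - b"
    using ab(2) by (intro support_fun_least assms) (auto simp: inner_commute less_imp_le)
  with le[of "- a"] ab(1) show False by (simp add: inner_commute)
qed

lemma compact_zero_slice:
  assumes "compact G" shows "compact (zero_slice G)"
proof -
  have "compact (G \<inter> ({0} \<times> UNIV))"
    using assms by (intro compact_Int_closed closed_Times) auto
  then have "compact (snd ` (G \<inter> ({0} \<times> UNIV)))" by (intro compact_continuous_image continuous_intros)
  moreover have "snd ` (G \<inter> ({0} \<times> UNIV)) = zero_slice G" by (force simp: zero_slice_def)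
  ultimately show ?thesis by simp
qed

lemma convex_zero_slice:
  assumes "convex G" shows "convex (zero_slice G)"
  unfolding convex_alt zero_slice_def
  using assms[unfolded convex_alt, rule_format, of "(0, _)" "(0, _)"] by simp

text \<open>Tilting penalizes the points with \<open>a \<noteq> 0\<close> more and more as \<open>t\<close> grows.\<close>

lemma tilted_sup_tendsto:
  assumes G: "compact G" and sign: "\<And>a v. (a, v) \<in> G \<Longrightarrow> c * a \<le> 0" and c: "c \<noteq> 0"
    and ne: "zero_slice G \<noteq> {}"
  shows "((\<lambda>t. tilted_sup G (t * c) \<xi>) \<longlongrightarrow> support_fun (zero_slice G) \<xi>) at_top"
proof (rule order_tendstoI)
  let ?\<sigma> = "support_fun (zero_slice G) \<xi>"
  have Gne: "G \<noteq> {}" using ne by (auto simp: zero_slice_def)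
  have "?\<sigma> \<le> tilted_sup G (t * c) \<xi>" for t
    using tilted_sup_upper[OF G, of 0 _ "t * c" \<xi>] by (intro support_fun_least ne) (simp add: zero_slice_def)
  then show "\<forall>\<^sub>F t in at_top. b < tilted_sup G (t * c) \<xi>" if "b < ?\<sigma>" for b
    using that by (intro always_eventually allI) (metis less_le_trans)
  fix b assume b: "?\<sigma> < b"
  define e where "e = (b - ?\<sigma>) / 2"
  have e: "?\<sigma> + e < b" "0 < e" using b by (auto simp: e_def field_simps)
  \<comment> \<open>The points whose slope in direction \<xi> beats the slice by at least
    \<open>e\<close>. None of them has \<open>a = 0\<close>, so by compactness \<open>c * a\<close>
    stays below some \<open>- \<eta>\<close> on \<open>B\<close>.\<close>
  define B where "B = G \<inter> {p. ?\<sigma> + e \<le> snd p \<bullet> \<xi>}"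
  have B: "compact B" unfolding B_def using G
    by (intro compact_Int_closed closed_Collect_le continuous_intros)
  obtain R where R: "0 < R" "\<And>a v. (a, v) \<in> G \<Longrightarrow> v \<bullet> \<xi> \<le> R"
  proof -
    have "bdd_above ((\<lambda>p. snd p \<bullet> \<xi>) ` G)" using G by (intro bdd_above_compact_image continuous_intros)
    then obtain r where "\<And>p. p \<in> G \<Longrightarrow> snd p \<bullet> \<xi> \<le> r" by (auto simp: bdd_above_def)
    then show thesis by (intro that[of "max r 1"]) (force simp: le_max_iff_disj)+
  qed
  have "\<exists>\<eta>>0. \<forall>(a, v)\<in>B. c * a \<le> - \<eta>"
  proof (cases "B = {}")
    case False
    have "continuous_on B (\<lambda>p. c * fst p)" by (intro continuous_intros)
    from continuous_attains_sup[OF B False this] obtain a0 v0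
      where 0: "(a0, v0) \<in> B" "\<And>a v. (a, v) \<in> B \<Longrightarrow> c * a \<le> c * a0" by force
    have "a0 \<noteq> 0"
    proof
      assume "a0 = 0"
      then have "v0 \<in> zero_slice G" using 0(1) by (simp add: B_def zero_slice_def)
      from support_fun_upper[OF compact_zero_slice[OF G] this, of \<xi>] show False
        using 0(1) e by (simp add: B_def)
    qed
    then have "c * a0 < 0" using sign[of a0 v0] 0(1) c by (simp add: B_def less_le)
    then show ?thesis using 0(2) by (intro exI[of _ "- (c * a0)"]) auto
  qed (auto intro: exI[of _ 1])
  then obtain \<eta> where \<eta>: "0 < \<eta>" "\<And>a v. (a, v) \<in> B \<Longrightarrow> c * a \<le> - \<eta>" by blast
  \<comment> \<open>From this threshold on, the penalty \<open>t * \<eta>\<close> on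
    \<open>B\<close> absorbs the largest slope \<open>R\<close> and brings the value down to at most
    \<open>- \<bar>?\<sigma>\<bar>\<close>. Off \<open>B\<close> the slope alone is small
    enough.\<close>
  have "tilted_sup G (t * c) \<xi> < b" if t: "t \<ge> (R + \<bar>?\<sigma>\<bar>) / \<eta>" "0 \<le> t" for t
  proof -
    have "tilted_sup G (t * c) \<xi> \<le> ?\<sigma> + e"
    proof (rule tilted_sup_least[OF Gne])
      fix a v assume av: "(a, v) \<in> G"
      show "t * c * a + v \<bullet> \<xi> \<le> ?\<sigma> + e"
      proof (cases "(a, v) \<in> B")
        case True
        have "t * (c * a) \<le> t * (- \<eta>)" using \<eta>(2)[OF True] t(2) by (rule mult_left_mono)
        moreover have "R + \<bar>?\<sigma>\<bar> \<le> t * \<eta>" using t(1) \<eta>(1) by (simp add: field_simps)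
        ultimately have "t * (c * a) + v \<bullet> \<xi> \<le> ?\<sigma> + e" using R(2)[OF av] e(2) by simp
        then show ?thesis by (simp add: mult.assoc)
      next
        case False
        have "t * (c * a) \<le> 0" using sign[OF av] t(2) by (simp add: mult_nonneg_nonpos)
        moreover have "v \<bullet> \<xi> < ?\<sigma> + e" using False av by (simp add: B_def)
        ultimately show ?thesis by (simp add: mult.assoc)
      qed
    qed
    with e show ?thesis by simp
  qed
  then show "\<forall>\<^sub>F t in at_top. tilted_sup G (t * c) \<xi> < b"
    by (intro eventually_mono[OF eventually_ge_at_top[of "max ((R + \<bar>?\<sigma>\<bar>) / \<eta>) 0"]]) auto
qed

text \<open>At \<open>h = 0\<close> only the constants \<open>a\<close> remain, so their maximum is
  \<open>0\<close>; a point that attains it lies in the zero slice.\<close>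

lemma codiff_Phi_0:
  assumes "compact D" "D \<noteq> {}" "codiff_Phi D 0 = 0"
  shows "\<And>a v. (a, v) \<in> D \<Longrightarrow> 1 * a \<le> 0" "zero_slice D \<noteq> {}"
proof -
  have 0: "tilted_sup D 1 0 = 0" using assms(3) by (simp add: codiff_Phi_def tilted_sup_def)
  then show le: "(a, v) \<in> D \<Longrightarrow> 1 * a \<le> 0" for a v using tilted_sup_upper[OF assms(1), of a v 1 0] by simp
  have "continuous_on D fst" by (intro continuous_intros)
  from continuous_attains_sup[OF assms(1,2) this] obtain a v
    where av: "(a, v) \<in> D" "\<And>a' v'. (a', v') \<in> D \<Longrightarrow> a' \<le> a" by force
  then have "tilted_sup D 1 0 \<le> a" by (intro tilted_sup_least assms) auto
  with 0 le[OF av(1)] have "a = 0" by simp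
  then show "zero_slice D \<noteq> {}" using av by (auto simp: zero_slice_def)
qed

text \<open>Turns the minimum into a maximum, so that the upper set falls under the same lemmas with
  \<open>c = -1\<close>.\<close>

lemma codiff_Psi_eq: "codiff_Psi E h = - tilted_sup E (-1) (- h)"
proof -
  have "uminus ` (\<lambda>(b, w). b + w \<bullet> h) ` E = (\<lambda>(b, w). - 1 * b + w \<bullet> (- h)) ` E"
    unfolding image_image by (intro image_cong) auto
  then show ?thesis by (simp only: codiff_Psi_def tilted_sup_def Inf_real_def)
qed

lemma codiff_Psi_0:
  assumes "compact E" "E \<noteq> {}" "codiff_Psi E 0 = 0"
  shows "\<And>b w. (b, w) \<in> E \<Longrightarrow> -1 * b \<le> 0" "zero_slice E \<noteq> {}"
proof -
  have 0: "tilted_sup E (-1) 0 = 0" using assms(3) by (simp add: codiff_Psi_eq)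
  then show le: "(b, w) \<in> E \<Longrightarrow> -1 * b \<le> 0" for b w using tilted_sup_upper[OF assms(1), of b w "-1" 0] by simp
  have "continuous_on E (\<lambda>p. - fst p)" by (intro continuous_intros)
  from continuous_attains_sup[OF assms(1,2) this] obtain a v
    where av: "(a, v) \<in> E" "\<And>a' v'. (a', v') \<in> E \<Longrightarrow> - a' \<le> - a" by force
  then have "tilted_sup E (-1) 0 \<le> - a" by (intro tilted_sup_least assms) auto
  with 0 le[OF av(1)] have "a = 0" by simp
  then show "zero_slice E \<noteq> {}" using av by (auto simp: zero_slice_def)
qed

lemma SUP_cmult_pos:
  fixes f :: "'a \<Rightarrow> real"
  assumes "bdd_above (f ` A)" "A \<noteq> {}" "0 < c"
  shows "(SUP x\<in>A. c * f x) = c * (SUP x\<in>A. f x)"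
proof (rule antisym)
  show "(SUP x\<in>A. c * f x) \<le> c * (SUP x\<in>A. f x)"
    using assms by (intro cSUP_least) (auto intro: mult_left_mono cSUP_upper)
  have b: "bdd_above ((\<lambda>x. c * f x) ` A)"
  proof -
    obtain r where r: "\<And>x. x \<in> A \<Longrightarrow> f x \<le> r" using assms(1) by (auto simp: bdd_above_def)
    show ?thesis by (rule bdd_aboveI2[of _ _ "c * r"]) (use r assms(3) in auto)
  qed
  have "(SUP x\<in>A. f x) \<le> (SUP x\<in>A. c * f x) / c"
    using assms(2,3) cSUP_upper[OF _ b] by (intro cSUP_least) (auto simp: field_simps)
  then show "c * (SUP x\<in>A. f x) \<le> (SUP x\<in>A. c * f x)" using assms(3) by (simp add: field_simps)
qed

text \<open>Taking the step \<alpha> out leaves the slopes unchanged and multiplies the constants by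
  \<open>1 / \<alpha>\<close>: a small step is a strong tilt.\<close>

lemma tilted_sup_scale:
  assumes "compact G" "G \<noteq> {}" "0 < \<alpha>"
  shows "tilted_sup G c (\<alpha> *\<^sub>R \<xi>) = \<alpha> * tilted_sup G (1 / \<alpha> * c) \<xi>"
proof -
  have "bdd_above ((\<lambda>(a, v). 1 / \<alpha> * c * a + v \<bullet> \<xi>) ` G)"
    unfolding case_prod_beta' using assms by (intro bdd_above_compact_image continuous_intros)
  from SUP_cmult_pos[OF this assms(2,3)]
  have "\<alpha> * tilted_sup G (1 / \<alpha> * c) \<xi> = (SUP (a, v)\<in>G. \<alpha> * (1 / \<alpha> * c * a + v \<bullet> \<xi>))"
    by (simp add: tilted_sup_def case_prod_beta')
  also have "(\<lambda>(a, v). \<alpha> * (1 / \<alpha> * c * a + v \<bullet> \<xi>)) = (\<lambda>(a, v). c * a + v \<bullet> \<alpha> *\<^sub>R \<xi>)"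
    using assms(3) by (auto simp: fun_eq_iff distrib_left)
  finally show ?thesis by (simp add: tilted_sup_def)
qed

lemma codiff_Phi_eq: "codiff_Phi D h = tilted_sup D 1 h"
  by (simp add: codiff_Phi_def tilted_sup_def)

text \<open>Divided by \<alpha>, the two parts of the approximation are tilted suprema with tilt
  \<open>1 / \<alpha>\<close> and \<open>- 1 / \<alpha>\<close>, whose limits are the support
  functions of the slices. The remainder \<open>r\<close> tends to \<open>0\<close> by the
  definition of a codifferential.\<close>

lemma is_codifferential_dir_deriv:
  assumes F: "is_codifferential F y D E"
  shows "((\<lambda>\<alpha>. (F (y + \<alpha> *\<^sub>R h) - F y) / \<alpha>) \<longlongrightarrow>
     support_fun (zero_slice D) h - support_fun (zero_slice E) (- h)) (at_right 0)"
proof -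
  have D: "D \<noteq> {}" "compact D" "codiff_Phi D 0 = 0" and E: "E \<noteq> {}" "compact E" "codiff_Psi E 0 = 0"
    and lim: "((\<lambda>\<alpha>. \<bar>F (y + \<alpha> *\<^sub>R h) - F y - codiff_Phi D (\<alpha> *\<^sub>R h) - codiff_Psi E (\<alpha> *\<^sub>R h)\<bar> / \<alpha>)
            \<longlongrightarrow> 0) (at_right 0)"
    using F by (auto simp: is_codifferential_def)
  note D0 = codiff_Phi_0[OF D(2,1,3)] and E0 = codiff_Psi_0[OF E(2,1,3)]
  have inv: "filterlim (\<lambda>\<alpha>::real. 1 / \<alpha>) at_top (at_right 0)"
    using filterlim_inverse_at_top_right by (simp add: inverse_eq_divide)
  have 1: "((\<lambda>\<alpha>. tilted_sup D (1 / \<alpha> * 1) h) \<longlongrightarrow> support_fun (zero_slice D) h) (at_right 0)"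
    by (rule filterlim_compose[OF tilted_sup_tendsto inv]) (use D D0 in auto)
  have 2: "((\<lambda>\<alpha>. tilted_sup E (1 / \<alpha> * -1) (- h)) \<longlongrightarrow> support_fun (zero_slice E) (- h)) (at_right 0)"
    by (rule filterlim_compose[OF tilted_sup_tendsto inv]) (use E E0 in auto)
  define r where "r \<alpha> = (F (y + \<alpha> *\<^sub>R h) - F y) / \<alpha> - tilted_sup D (1 / \<alpha> * 1) h
     + tilted_sup E (1 / \<alpha> * -1) (- h)" for \<alpha>
  have "\<forall>\<^sub>F \<alpha> in at_right 0. \<bar>F (y + \<alpha> *\<^sub>R h) - F y - codiff_Phi D (\<alpha> *\<^sub>R h) - codiff_Psi E (\<alpha> *\<^sub>R h)\<bar> / \<alpha> = \<bar>r \<alpha>\<bar>"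
    using eventually_at_right_less
  proof eventually_elim
    case (elim \<alpha>)
    have "codiff_Phi D (\<alpha> *\<^sub>R h) = \<alpha> * tilted_sup D (1 / \<alpha> * 1) h"
      unfolding codiff_Phi_eq by (rule tilted_sup_scale[OF D(2,1) elim])
    moreover have "codiff_Psi E (\<alpha> *\<^sub>R h) = - (\<alpha> * tilted_sup E (1 / \<alpha> * -1) (- h))"
      using tilted_sup_scale[OF E(2,1) elim, of "-1" "- h"] by (simp add: codiff_Psi_eq)
    ultimately have "F (y + \<alpha> *\<^sub>R h) - F y - codiff_Phi D (\<alpha> *\<^sub>R h) - codiff_Psi E (\<alpha> *\<^sub>R h) = \<alpha> * r \<alpha>"
      using elim by (simp add: r_def field_simps)
    then show ?case using elim by (simp add: abs_mult)
  qed
  from tendsto_cong[OF this] lim have "((\<lambda>\<alpha>. \<bar>r \<alpha>\<bar>) \<longlongrightarrow> 0) (at_right 0)" by simp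
  then have "(r \<longlongrightarrow> 0) (at_right 0)" by (rule tendsto_rabs_zero_cancel)
  from tendsto_add[OF this tendsto_diff[OF 1 2]] show ?thesis
    by (simp add: r_def)
qed

text \<open>Only right derivatives are at hand, so a continuation argument takes the place of the
  mean value theorem: the points where the bound with slope \<open>L + e\<close> holds form a
  compact set, and its largest element could be moved further right unless it is \<open>1\<close>.
  The slack \<open>e\<close> makes the bound on the derivative strict, hence valid for small
  difference quotients.\<close>

lemma bounded_increment_of_right_derivatives:
  fixes g :: "real \<Rightarrow> real"
  assumes cont: "continuous_on {0..1} g"
    and deriv: "\<And>t. 0 \<le> t \<Longrightarrow> t < 1 \<Longrightarrow> \<exists>D. \<bar>D\<bar> \<le> L \<and> ((\<lambda>s. (g (t + s) - g t) / s) \<longlongrightarrow> D) (at_right 0)"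
  shows "\<bar>g 1 - g 0\<bar> \<le> L"
proof (rule field_le_epsilon)
  fix e :: real assume e: "0 < e"
  define A where "A = {t \<in> {0..1}. \<bar>g t - g 0\<bar> \<le> (L + e) * t}"
  have "closed A" unfolding A_def
    by (rule continuous_on_closed_Collect_le) (intro continuous_intros cont closed_atLeastAtMost)+
  then have "compact ({0..1} \<inter> A)" by (intro compact_Int_closed compact_Icc)
  moreover have "{0..1} \<inter> A = A" by (auto simp: A_def)
  ultimately have "compact A" by simp
  moreover have "0 \<in> A" by (simp add: A_def)
  ultimately obtain t where t: "t \<in> A" "\<And>s. s \<in> A \<Longrightarrow> s \<le> t"
    using compact_attains_sup[of A] by blast
  have "t = 1"
  proof (rule ccontr)
    assume "t \<noteq> 1"
    with t(1) have t01: "0 \<le> t" "t < 1" by (auto simp: A_def)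
    from deriv[OF this] obtain D where D: "\<bar>D\<bar> \<le> L"
      and lim: "((\<lambda>s. (g (t + s) - g t) / s) \<longlongrightarrow> D) (at_right 0)" by blast
    have "\<forall>\<^sub>F s in at_right 0. \<bar>(g (t + s) - g t) / s\<bar> < L + e"
      using D e by (intro order_tendstoD(2)[OF tendsto_rabs[OF lim]]) auto
    moreover have "\<forall>\<^sub>F s in at_right 0. s < 1 - t"
      using t01 by (intro eventually_at_rightI[of 0 "1 - t"]) auto
    ultimately have "\<forall>\<^sub>F s in at_right 0. 0 < s \<and> s < 1 - t \<and> \<bar>(g (t + s) - g t) / s\<bar> < L + e"
      using eventually_at_right_less by eventually_elim simp
    then obtain s where s: "0 < s" "s < 1 - t" "\<bar>(g (t + s) - g t) / s\<bar> < L + e"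
      using eventually_happens by force
    then have "\<bar>g (t + s) - g t\<bar> \<le> (L + e) * s" by (simp add: field_simps abs_divide)
    moreover have "\<bar>g t - g 0\<bar> \<le> (L + e) * t" using t(1) by (simp add: A_def)
    ultimately have "t + s \<in> A" using s t01 by (auto simp: A_def algebra_simps)
    with t(2)[of "t + s"] s show False by simp
  qed
  with t(1) show "\<bar>g 1 - g 0\<bar> \<le> L + e" by (simp add: A_def)
qed

text \<open>The factor \<open>2\<close> counts the slices: the right derivative along the segment is
  a difference of two support functions, each bounded by \<open>R * norm (y' - y)\<close>.\<close>

lemma codifferentiable_lipschitz_on_segment:
  assumes cont: "continuous_on UNIV F"
    and F: "\<And>z. z \<in> closed_segment y y' \<Longrightarrow> is_codifferential F z (D z) (E z)"
    and bd: "\<And>z a v. z \<in> closed_segment y y' \<Longrightarrow> (a, v) \<in> D z \<union> E z \<Longrightarrow> norm v \<le> R"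
  shows "\<bar>F y' - F y\<bar> \<le> 2 * R * norm (y' - y)"
proof -
  define g where "g t = F (y + t *\<^sub>R (y' - y))" for t
  have "\<bar>g 1 - g 0\<bar> \<le> 2 * R * norm (y' - y)"
  proof (rule bounded_increment_of_right_derivatives)
    show "continuous_on {0..1} g"
      unfolding g_def by (intro continuous_on_compose2[OF cont] continuous_intros) auto
    fix t :: real assume t: "0 \<le> t" "t < 1"
    define z where "z = y + t *\<^sub>R (y' - y)"
    have z: "z \<in> closed_segment y y'"
      using t by (auto simp: z_def in_segment algebra_simps intro!: exI[of _ t])
    let ?h = "y' - y"
    have ne: "compact (D z)" "zero_slice (D z) \<noteq> {}" "compact (E z)" "zero_slice (E z) \<noteq> {}"
      using F[OF z] codiff_Phi_0(2)[of "D z"] codiff_Psi_0(2)[of "E z"]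
      unfolding is_codifferential_def by simp_all
    have b: "\<bar>support_fun (zero_slice (D z)) ?h\<bar> \<le> R * norm ?h"
      "\<bar>support_fun (zero_slice (E z)) (- ?h)\<bar> \<le> R * norm (- ?h)"
      using bd[OF z] by (intro abs_support_fun_le ne compact_zero_slice; force simp: zero_slice_def)+
    show "\<exists>d. \<bar>d\<bar> \<le> 2 * R * norm ?h \<and> ((\<lambda>s. (g (t + s) - g t) / s) \<longlongrightarrow> d) (at_right 0)"
      using is_codifferential_dir_deriv[OF F[OF z], of ?h] b
      by (intro exI[of _ "support_fun (zero_slice (D z)) ?h - support_fun (zero_slice (E z)) (- ?h)"])
        (auto simp: g_def z_def algebra_simps norm_minus_commute)
  qed
  then show ?thesis by (simp add: g_def)
qed

text \<open>Exchanging a point for a nearest one of the other set changes \<open>c * a\<close> by at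
  most \<open>\<bar>c\<bar>\<close> and \<open>v \<bullet> \<xi>\<close> by at most
  \<open>norm \<xi>\<close> times the Hausdorff distance. This carries Hausdorff continuity over to
  real functions.\<close>

lemma tilted_sup_hausdorff:
  assumes "compact A" "A \<noteq> {}" "compact B" "B \<noteq> {}"
  shows "\<bar>tilted_sup A c \<xi> - tilted_sup B c \<xi>\<bar> \<le> (\<bar>c\<bar> + norm \<xi>) * hausdorff_dist A B"
proof -
  have one: "tilted_sup A c \<xi> \<le> tilted_sup B c \<xi> + (\<bar>c\<bar> + norm \<xi>) * d"
    if AB: "compact A" "A \<noteq> {}" "compact B" "B \<noteq> {}" and d: "(SUP p\<in>A. infdist p B) \<le> d" for A B d
  proof (rule tilted_sup_least[OF AB(2)])
    fix a v assume av: "(a, v) \<in> A"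
    have "bdd_above ((\<lambda>p. infdist p B) ` A)"
      using AB(1) by (intro bdd_above_compact_image continuous_intros)
    from cSUP_upper[OF av this] d have "infdist (a, v) B \<le> d" by simp
    moreover obtain q where "q \<in> B" "infdist (a, v) B = dist (a, v) q"
      by (rule infdist_attains_inf[OF compact_imp_closed[OF AB(3)] AB(4)])
    moreover obtain a' v' where "q = (a', v')" by (cases q)
    ultimately have q: "(a', v') \<in> B" "infdist (a, v) B = dist (a, v) (a', v')" "infdist (a, v) B \<le> d"
      by simp_all
    then have dd: "dist (a, v) (a', v') \<le> d" by simp
    have 1: "\<bar>a - a'\<bar> \<le> d" "norm (v - v') \<le> d"
      using dist_fst_le[of "(a, v)" "(a', v')"] dist_snd_le[of "(a, v)" "(a', v')"] dd
      by (auto simp: dist_norm)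
    have "c * (a - a') \<le> \<bar>c\<bar> * d"
      using mult_left_mono[OF 1(1), of "\<bar>c\<bar>"] by (simp add: abs_mult[symmetric])
    moreover have "(v - v') \<bullet> \<xi> \<le> norm \<xi> * d"
      using norm_cauchy_schwarz[of "v - v'" \<xi>] mult_right_mono[OF 1(2), of "norm \<xi>"] by (simp add: mult.commute)
    ultimately show "c * a + v \<bullet> \<xi> \<le> tilted_sup B c \<xi> + (\<bar>c\<bar> + norm \<xi>) * d"
      using tilted_sup_upper[OF AB(3) q(1), of c \<xi>] by (simp add: algebra_simps inner_diff_left)
  qed
  show ?thesis
    using one[OF assms, of "hausdorff_dist A B"] one[OF assms(3,4,1,2), of "hausdorff_dist A B"]
    by (simp add: hausdorff_dist_def abs_le_iff)
qed

section \<open>Superpositions and complete measures\<close>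

lemma caratheodory_measurable:
  fixes g :: "'a \<Rightarrow> 'y::{metric_space, second_countable_topology} \<Rightarrow> real"
  assumes g: "\<And>y. (\<lambda>x. g x y) \<in> borel_measurable N"
    and cont: "\<And>x. x \<in> space N \<Longrightarrow> continuous_on UNIV (g x)"
    and u: "u \<in> borel_measurable N"
  shows "(\<lambda>x. g x (u x)) \<in> borel_measurable N"
proof -
  obtain s where s: "\<And>i. simple_function N (s i)" "\<And>x. x \<in> space N \<Longrightarrow> (\<lambda>i. s i x) \<longlonglongrightarrow> u x"
    using borel_measurable_implies_sequence_metric[OF u, of undefined] by blast
  show ?thesis
  proof (rule borel_measurable_LIMSEQ_real)
    show "(\<lambda>i. g x (s i x)) \<longlonglongrightarrow> g x (u x)" if "x \<in> space N" for x
      using cont[OF that] s(2)[OF that]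
      by (auto simp: continuous_on_eq_continuous_at intro: isCont_tendsto_compose)
    \<comment> \<open>A simple inner function has countably many values, so the composition is glued
      from the measurable sections of \<open>g\<close>.\<close>
    show "(\<lambda>x. g x (s i x)) \<in> borel_measurable N" for i
    proof (rule measurable_compose_countable'[of "s i ` space N" "\<lambda>y x. g x y"])
      show "s i \<in> measurable N (count_space (s i ` space N))"
        using s(1)[of i] by (auto simp: simple_function_def measurable_count_space_eq2)
      show "countable (s i ` space N)" using s(1)[of i] by (auto simp: simple_function_def intro: countable_finite)
    qed (rule g)
  qed
qed

lemma complete_measure_lebesgue_on:
  assumes "\<Omega> \<in> sets lebesgue" shows "complete_measure (lebesgue_on \<Omega>)"
proof
  fix A B assume "A \<subseteq> B" "B \<in> null_sets (lebesgue_on \<Omega>)"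
  then have "B \<in> null_sets lebesgue" "A \<subseteq> \<Omega>"
    using assms by (auto simp: null_sets_restrict_space dest: sets.sets_into_space)
  then have "A \<in> null_sets lebesgue" using \<open>A \<subseteq> B\<close> by (metis completion.complete2)
  then show "A \<in> sets (lebesgue_on \<Omega>)"
    using assms \<open>A \<subseteq> \<Omega>\<close> by (auto simp: sets_restrict_space_iff)
qed

text \<open>The hypotheses on the integrand hold almost everywhere and say nothing about
  measurability of the set where they hold; completeness supplies it, so that functions can be
  redefined off that set.\<close>

lemma (in complete_measure) sets_Collect_AE:
  assumes "AE x in M. P x" shows "{x \<in> space M. P x} \<in> sets M"
  by (rule in_sets_AE[OF _ sets.top]) (use assms in \<open>auto elim: eventually_mono\<close>)

lemma (in complete_measure) measurable_AE_eq:
  assumes f: "f \<in> measurable M N" and eq: "AE x in M. f x = g x" and g: "g \<in> space M \<rightarrow> space N"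
  shows "g \<in> measurable M N"
proof (rule measurableI)
  fix A assume "A \<in> sets N"
  then have "f -` A \<inter> space M \<in> sets M" using f by (rule measurable_sets[rotated])
  then show "g -` A \<inter> space M \<in> sets M"
    by (rule in_sets_AE[rotated]) (use eq AE_space in \<open>auto elim: eventually_elim2\<close>)
qed (use g in auto)

section \<open>Test functions and the fundamental lemma of the calculus of variations\<close>

text \<open>For \<open>q = 1\<close> this is the standard \<open>C\<^sup>\<infinity>\<close> function \<open>exp (-1/s)\<close>; the polynomial factor makes
  the family closed under differentiation.\<close>

definition flat :: "real poly \<Rightarrow> real \<Rightarrow> real" where
  "flat q s = (if 0 < s then poly q (1 / s) * exp (- 1 / s) else 0)"

lemma poly_div_exp_tendsto_0: "((\<lambda>x. poly q x / exp x) \<longlongrightarrow> (0::real)) at_top"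
proof -
  have "((\<lambda>x. \<Sum>i\<le>degree q. coeff q i * (x ^ i / exp x)) \<longlongrightarrow> (\<Sum>i\<le>degree q. coeff q i * 0)) at_top"
    by (intro tendsto_intros tendsto_power_div_exp_0)
  then show ?thesis by (simp add: poly_altdef sum_divide_distrib)
qed

text \<open>With \<open>r = 1 / s\<close> the chain rule contributes \<open>- r^2\<close>, and
  \<open>q(r) * exp (- r)\<close> has the derivative \<open>(q'(r) - q(r)) * exp (- r)\<close> in
  \<open>r\<close>; \<open>[:0, 0, 1:]\<close> is the polynomial \<open>r^2\<close>.\<close>

lemma flat_has_derivative:
  "(flat q has_real_derivative flat ([:0, 0, 1:] * (q - pderiv q)) s) (at s)"
proof -
  consider "0 < s" | "s < 0" | "s = 0" by linarith
  then show ?thesis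
  proof cases
    case 1
    have "((\<lambda>s. poly q (1 / s) * exp (- 1 / s)) has_real_derivative
        flat ([:0, 0, 1:] * (q - pderiv q)) s) (at s)"
      using 1 by (auto intro!: derivative_eq_intros DERIV_chain'[OF _ poly_DERIV]
          simp: flat_def field_simps power2_eq_square)
    then show ?thesis
      by (rule has_field_derivative_transform_within_open[where S = "{0<..}"]) (use 1 in \<open>auto simp: flat_def\<close>)
  next
    case 2
    have "((\<lambda>s. 0) has_real_derivative 0) (at s)" by simp
    then have "(flat q has_real_derivative 0) (at s)"
      by (rule has_field_derivative_transform_within_open[where S = "{..<0}"]) (use 2 in \<open>auto simp: flat_def\<close>)
    then show ?thesis using 2 by (simp add: flat_def)
  next
    case 3
    have inv: "filterlim (\<lambda>h::real. 1 / h) at_top (at_right 0)"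
      using filterlim_inverse_at_top_right by (simp add: inverse_eq_divide)
    \<comment> \<open>The quotient at \<open>0\<close> is \<open>r * q(r) * exp (- r)\<close> with
      \<open>r = 1 / h\<close>, which explains the polynomial \<open>pCons 0 q\<close>.\<close>
    have r: "((\<lambda>h. flat q h / h) \<longlongrightarrow> 0) (at_right 0)"
    proof (rule Lim_transform_eventually[OF filterlim_compose[OF poly_div_exp_tendsto_0[of "pCons 0 q"] inv]])
      show "\<forall>\<^sub>F h in at_right 0. poly (pCons 0 q) (1 / h) / exp (1 / h) = flat q h / h"
        using eventually_at_right_less
        by eventually_elim (simp add: flat_def exp_minus field_simps)
    qed
    have l: "((\<lambda>h. flat q h / h) \<longlongrightarrow> 0) (at_left 0)"
    proof (rule tendsto_eventually)
      show "\<forall>\<^sub>F h in at_left 0. flat q h / h = 0"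
        by (rule eventually_at_leftI[of "-1"]) (auto simp: flat_def)
    qed
    have "((\<lambda>h. flat q h / h) \<longlongrightarrow> 0) (at 0)" using l r by (simp add: filterlim_split_at)
    then show ?thesis using 3 by (simp add: DERIV_def flat_def)
  qed
qed

text \<open>A class closed under partial derivatives and made of differentiable functions is smooth,
  by induction on the list of derivatives. The generators allow every polynomial \<open>q\<close>,
  because differentiation changes it.\<close>

inductive_set smooth_algebra :: "(real^'d \<Rightarrow> real) set" where
  const: "(\<lambda>_. c) \<in> smooth_algebra"
| flat: "(\<lambda>x. flat q (a * (x $ i) + b)) \<in> smooth_algebra"
| add: "f \<in> smooth_algebra \<Longrightarrow> g \<in> smooth_algebra \<Longrightarrow> (\<lambda>x. f x + g x) \<in> smooth_algebra"
| mult: "f \<in> smooth_algebra \<Longrightarrow> g \<in> smooth_algebra \<Longrightarrow> (\<lambda>x. f x * g x) \<in> smooth_algebra"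

lemma smooth_algebra_has_derivative:
  assumes "f \<in> smooth_algebra"
  shows "\<exists>f'. (\<forall>x. (f has_derivative f' x) (at x)) \<and> (\<forall>j. (\<lambda>x. f' x (axis j 1)) \<in> smooth_algebra)"
  using assms
proof induction
  case (const c)
  show ?case by (intro exI[of _ "\<lambda>_ _. 0"]) (auto intro: smooth_algebra.const)
next
  case (flat q a i b)
  let ?q = "[:0, 0, 1:] * (q - pderiv q)"
  have "((\<lambda>x. flat q (a * (x $ i) + b)) has_derivative (\<lambda>h. flat ?q (a * (x $ i) + b) * (a * h $ i))) (at x)" for x
  proof -
    have "((\<lambda>x. a * (x $ i) + b) has_derivative (\<lambda>h. a * h $ i)) (at x)"
      by (auto intro!: derivative_eq_intros bounded_linear_imp_has_derivative bounded_linear_vec_nth)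
    from has_derivative_compose[OF this flat_has_derivative[of q, unfolded has_field_derivative_def]]
    show ?thesis .
  qed
  moreover have "(\<lambda>x. flat ?q (a * (x $ i) + b) * (a * axis j 1 $ i)) \<in> smooth_algebra" for j
    by (intro smooth_algebra.intros)
  ultimately show ?case
    by (intro exI[of _ "\<lambda>x h. flat ?q (a * (x $ i) + b) * (a * h $ i)"]) simp
next
  case (add f g)
  then obtain f' g' where "\<And>x. (f has_derivative f' x) (at x)" "\<And>x. (g has_derivative g' x) (at x)"
    "\<And>j. (\<lambda>x. f' x (axis j 1)) \<in> smooth_algebra" "\<And>j. (\<lambda>x. g' x (axis j 1)) \<in> smooth_algebra" by blast
  then show ?case
    by (intro exI[of _ "\<lambda>x h. f' x h + g' x h"]) (auto intro: has_derivative_add smooth_algebra.add)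
next
  case (mult f g)
  then obtain f' g' where "\<And>x. (f has_derivative f' x) (at x)" "\<And>x. (g has_derivative g' x) (at x)"
    "\<And>j. (\<lambda>x. f' x (axis j 1)) \<in> smooth_algebra" "\<And>j. (\<lambda>x. g' x (axis j 1)) \<in> smooth_algebra" by blast
  then show ?case
    using mult.hyps by (intro exI[of _ "\<lambda>x h. f x * g' x h + f' x h * g x"] conjI allI
        has_derivative_mult smooth_algebra.add[OF smooth_algebra.mult smooth_algebra.mult])
qed

lemma smooth_algebra_partial_deriv:
  assumes "f \<in> smooth_algebra" shows "partial_deriv j f \<in> smooth_algebra"
proof -
  obtain f' where f': "\<And>x. (f has_derivative f' x) (at x)" "(\<lambda>x. f' x (axis j 1)) \<in> smooth_algebra"
    using smooth_algebra_has_derivative[OF assms] by blast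
  have "partial_deriv j f = (\<lambda>x. f' x (axis j 1))"
    unfolding partial_deriv_def using frechet_derivative_at[OF f'(1)] by metis
  with f'(2) show ?thesis by simp
qed

lemma smooth_algebra_smooth:
  assumes "f \<in> smooth_algebra" shows "smooth_fun f"
proof -
  have "foldr partial_deriv js f \<in> smooth_algebra" for js
    using assms by (induction js) (auto intro: smooth_algebra_partial_deriv)
  then show ?thesis
    unfolding smooth_fun_def using smooth_algebra_has_derivative by (blast intro: differentiableI)
qed

lemma smooth_algebra_prod:
  "(\<And>i. i \<in> I \<Longrightarrow> f i \<in> smooth_algebra) \<Longrightarrow> (\<lambda>x. \<Prod>i\<in>I. f i x) \<in> smooth_algebra"
  by (induction I rule: infinite_finite_induct) (auto intro: smooth_algebra.intros)

text \<open>The factor \<open>n\<close> drives each \<open>exp (- 1 / (n * c))\<close> with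
  \<open>c > 0\<close> to \<open>1\<close>, so the limit is the indicator of the open box. The
  arguments are written out in the affine form of the generators of
  \<open>smooth_algebra\<close>.\<close>

definition box_bump :: "nat \<Rightarrow> real^'d \<Rightarrow> real^'d \<Rightarrow> real^'d \<Rightarrow> real" where
  "box_bump n a b x =
     (\<Prod>i\<in>UNIV. flat 1 (real n * x $ i + - (real n * a $ i)) * flat 1 (- real n * x $ i + real n * b $ i))"

lemma flat_1_bounds: "0 \<le> flat 1 s" "flat 1 s \<le> 1"
  by (auto simp: flat_def)

lemma box_bump_bounds: "0 \<le> box_bump n a b x" "box_bump n a b x \<le> 1"
  unfolding box_bump_def
  by (auto intro!: prod_nonneg prod_le_1 mult_nonneg_nonneg mult_le_one flat_1_bounds)

lemma box_bump_outside:
  assumes "x \<notin> box a b" shows "box_bump n a b x = 0"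
proof -
  obtain i where i: "\<not> (a $ i < x $ i \<and> x $ i < b $ i)" using assms by (auto simp: mem_box_cart)
  have "real n * x $ i + - (real n * a $ i) = real n * (x $ i - a $ i)"
    "- real n * x $ i + real n * b $ i = real n * (b $ i - x $ i)" by (simp_all add: algebra_simps)
  then have "flat 1 (real n * x $ i + - (real n * a $ i)) * flat 1 (- real n * x $ i + real n * b $ i) = 0"
    using i by (auto simp: flat_def zero_less_mult_iff)
  then show ?thesis unfolding box_bump_def by (intro prod_zero) auto
qed

lemma box_bump_tendsto: "(\<lambda>n. box_bump n a b x) \<longlonglongrightarrow> indicator (box a b) x"
proof (cases "x \<in> box a b")
  case True
  have 1: "(\<lambda>n. flat 1 (real n * c)) \<longlonglongrightarrow> 1" if "0 < c" for c
  proof (rule Lim_transform_eventually)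
    have "(\<lambda>n. - (1 / c) * (1 / real n)) \<longlonglongrightarrow> - (1 / c) * 0"
      by (intro tendsto_intros lim_1_over_n)
    then have "(\<lambda>n. exp (- (1 / c) * (1 / real n))) \<longlonglongrightarrow> exp (- (1 / c) * 0)" by (intro tendsto_exp)
    then show "(\<lambda>n. exp (- (1 / c) * (1 / real n))) \<longlonglongrightarrow> 1" by simp
    show "\<forall>\<^sub>F n in sequentially. exp (- (1 / c) * (1 / real n)) = flat 1 (real n * c)"
      using eventually_gt_at_top[of 0] by eventually_elim (use that in \<open>auto simp: flat_def field_simps\<close>)
  qed
  have "(\<lambda>n. box_bump n a b x) \<longlonglongrightarrow> (\<Prod>i\<in>(UNIV::'a set). 1 * 1)"
    unfolding box_bump_def
  proof (intro tendsto_prod tendsto_mult)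
    fix i
    have e: "real n * x $ i + - (real n * a $ i) = real n * (x $ i - a $ i)"
      "- real n * x $ i + real n * b $ i = real n * (b $ i - x $ i)" for n by (simp_all add: algebra_simps)
    have "0 < x $ i - a $ i" "0 < b $ i - x $ i" using True by (auto simp: mem_box_cart)
    from 1[OF this(1)] 1[OF this(2)]
    show "(\<lambda>n. flat 1 (real n * x $ i + - (real n * a $ i))) \<longlonglongrightarrow> 1"
      "(\<lambda>n. flat 1 (- real n * x $ i + real n * b $ i)) \<longlonglongrightarrow> 1" unfolding e by simp_all
  qed
  then show ?thesis using True by simp
qed (simp add: box_bump_outside)

lemma test_fun_box_bump:
  assumes "cbox a b \<subseteq> \<Omega>" shows "test_fun \<Omega> (box_bump n a b)"
proof -
  have "box_bump n a b \<in> smooth_algebra"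
    unfolding box_bump_def by (intro smooth_algebra_prod smooth_algebra.intros)
  moreover have "closure {x. box_bump n a b x \<noteq> 0} \<subseteq> cbox a b"
    using box_bump_outside box_subset_cbox by (intro closure_minimal closed_cbox) blast
  ultimately show ?thesis
    using assms smooth_algebra_smooth unfolding test_fun_def
    by (metis bounded_cbox bounded_subset closed_closure compact_eq_bounded_closed subset_trans)
qed

lemma box_Int_box_cart:
  fixes a b c d :: "real^'d"
  shows "box a b \<inter> box c d = box (\<chi> i. max (a $ i) (c $ i)) (\<chi> i. min (b $ i) (d $ i))"
  by (auto simp: mem_box_cart set_eq_iff)

text \<open>A Dynkin argument: open boxes are stable under intersection and generate the Borel sets,
  and a Lebesgue set differs from a countable union of closed sets by a null set.\<close>

lemma AE_zero_of_box_integrals: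
  fixes G :: "real^'d \<Rightarrow> real"
  assumes G: "integrable lebesgue G" and out: "\<And>x. x \<notin> box c d \<Longrightarrow> G x = 0"
    and box: "\<And>a b. (\<integral>x. indicator (box a b) x * G x \<partial>lebesgue) = 0"
  shows "AE x in lebesgue. G x = 0"
proof -
  note [measurable] = borel_measurable_integrable[OF G]
  have iA: "integrable lebesgue (\<lambda>x. indicator A x * G x)" if "A \<in> sets lebesgue" for A
    using integrable_real_mult_indicator[OF that G] by (simp add: mult.commute)
  \<comment> \<open>The complement step of the induction needs the integral over the whole space; it
    vanishes because \<open>G\<close> is supported in a box.\<close>
  have tot: "(\<integral>x. G x \<partial>lebesgue) = 0"
  proof -
    have "(\<lambda>x. indicator (box c d) x * G x) = G" using out by (auto simp: fun_eq_iff indicator_def)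
    with box[of c d] show ?thesis by simp
  qed
  have IS: "Int_stable (range (\<lambda>(a, b). box a b :: (real^'d) set))"
  proof (rule Int_stableI)
    fix X Y assume "X \<in> range (\<lambda>(a, b). box a b :: (real^'d) set)" "Y \<in> range (\<lambda>(a, b). box a b :: (real^'d) set)"
    then obtain a b a' b' where "X = box a b" "Y = box a' b'" by auto
    then show "X \<inter> Y \<in> range (\<lambda>(a, b). box a b)" by (simp add: box_Int_box_cart) blast
  qed
  have sig: "sigma_sets UNIV (range (\<lambda>(a, b). box a b :: (real^'d) set)) \<subseteq> sets lebesgue"
  proof -
    have "sigma_sets UNIV (range (\<lambda>(a, b). box a b :: (real^'d) set)) = sets borel"
      by (subst borel_eq_box) simp
    then show ?thesis by auto
  qed
  have bor: "(\<integral>x. indicator A x * G x \<partial>lebesgue) = 0"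
    if "A \<in> sigma_sets UNIV (range (\<lambda>(a, b). box a b))" for A
  proof (rule sigma_sets_induct_disjoint[OF IS _ that])
    fix A assume "A \<in> range (\<lambda>(a, b). box a b :: (real^'d) set)"
    then show "(\<integral>x. indicator A x * G x \<partial>lebesgue) = 0" using box by auto
  next
    fix A assume "A \<in> sigma_sets UNIV (range (\<lambda>(a, b). box a b))"
      and 0: "(\<integral>x. indicator A x * G x \<partial>lebesgue) = 0"
    then have A: "A \<in> sets lebesgue" using sig by blast
    have "(\<integral>x. indicator (UNIV - A) x * G x \<partial>lebesgue) = (\<integral>x. G x - indicator A x * G x \<partial>lebesgue)"
      by (intro Bochner_Integration.integral_cong) (auto simp: indicator_def)
    also have "\<dots> = 0" using 0 iA[OF A] G tot by simp
    finally show "(\<integral>x. indicator (UNIV - A) x * G x \<partial>lebesgue) = 0" .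
  next
    fix A :: "nat \<Rightarrow> (real^'d) set"
    assume d: "disjoint_family A" and "range A \<subseteq> sigma_sets UNIV (range (\<lambda>(a, b). box a b))"
      and 0: "\<And>i. (\<integral>x. indicator (A i) x * G x \<partial>lebesgue) = 0"
    then have A: "A i \<in> sets lebesgue" for i using sig by blast
    have "(LINT x:(\<Union>i. A i)|lebesgue. G x) = (\<Sum>i. (LINT x:(A i)|lebesgue. G x))"
      using d A G unfolding disjoint_family_on_def
      by (intro lebesgue_integral_countable_add) (auto simp: set_integrable_def intro!: iA sets.countable_UN)
    then show "(\<integral>x. indicator (\<Union>i. A i) x * G x \<partial>lebesgue) = 0" using 0 by (simp add: set_lebesgue_integral_def)
  qed auto
  have leb: "(\<integral>x. indicator A x * G x \<partial>lebesgue) = 0" if A: "A \<in> sets lebesgue" for A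
  proof -
    obtain C T where C: "fsigma C" "T \<in> null_sets lebesgue" "C \<union> T = A" "disjnt C T"
      by (rule lebesgue_set_almost_fsigma[OF A])
    have CB: "C \<in> sets borel" using C(1) by cases (auto intro!: sets.countable_UN)
    then have "C \<in> sigma_sets UNIV (range (\<lambda>(a, b). box a b))"
      by (subst (asm) borel_eq_box) simp
    from bor[OF this] have 0: "(\<integral>x. indicator C x * G x \<partial>lebesgue) = 0" .
    have nT: "AE x in lebesgue. x \<notin> T" using C(2) by (rule AE_not_in)
    have "(\<integral>x. indicator A x * G x \<partial>lebesgue) = (\<integral>x. indicator C x * G x \<partial>lebesgue)"
    proof (rule integral_cong_AE)
      show "(\<lambda>x. indicator A x * G x) \<in> borel_measurable lebesgue"
        using A by (intro borel_measurable_times borel_measurable_indicator) auto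
      show "(\<lambda>x. indicator C x * G x) \<in> borel_measurable lebesgue"
        using CB by (intro borel_measurable_times borel_measurable_indicator) auto
    qed (use nT C(3) in \<open>auto simp: indicator_def elim!: eventually_mono\<close>)
    with 0 show ?thesis by simp
  qed
  have "AE x in lebesgue. G x \<le> 0" by (rule AE_nonpos_of_set_integrals[OF G]) (simp add: leb)
  moreover have "AE x in lebesgue. - G x \<le> 0"
    by (rule AE_nonpos_of_set_integrals) (use G leb in auto)
  ultimately show ?thesis by eventually_elim simp
qed

text \<open>Bumps with values in \<open>[0, 1]\<close> converge to the indicator of a box, and
  dominated convergence turns the hypothesis into vanishing integrals over all boxes whose closure
  lies in \<Omega>. Countably many closed boxes exhaust \<Omega>.\<close>

lemma fundamental_lemma:
  fixes g :: "real^'d \<Rightarrow> real"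
  assumes \<Omega>: "open \<Omega>" and g: "locally_integrable \<Omega> g"
    and int: "\<And>\<phi>. test_fun \<Omega> \<phi> \<Longrightarrow> (LINT x|lebesgue_on \<Omega>. g x * \<phi> x) = 0"
  shows "AE x in lebesgue_on \<Omega>. g x = 0"
proof -
  have \<Omega>m[measurable]: "\<Omega> \<in> sets lebesgue" using \<Omega> by simp
  have iK: "integrable lebesgue (\<lambda>x. indicator K x * g x)" if "compact K" "K \<subseteq> \<Omega>" for K
  proof -
    have "integrable (lebesgue_on K) g" using g that by (simp add: locally_integrable_def)
    moreover have "K \<in> sets lebesgue" using that(1) by (simp add: compact_imp_closed)
    ultimately show ?thesis by (simp add: integrable_restrict_space)
  qed
  have box0: "(\<integral>x. indicator (box a b) x * g x \<partial>lebesgue) = 0" if ab: "cbox a b \<subseteq> \<Omega>" for a b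
  proof -
    let ?h = "\<lambda>x. indicator (cbox a b) x * g x"
    have ih: "integrable lebesgue ?h" by (rule iK[OF compact_cbox ab])
    note [measurable] = borel_measurable_integrable[OF ih]
    have bump_m[measurable]: "box_bump n a b \<in> borel_measurable lebesgue" for n
    proof -
      have "continuous_on UNIV (box_bump n a b)"
        using test_fun_box_bump[OF ab, of n] unfolding test_fun_def smooth_fun_def
        by (metis continuous_at_imp_continuous_on differentiable_imp_continuous_within foldr.simps(1) id_apply)
      then show ?thesis by (simp add: borel_measurable_continuous_onI measurable_completion)
    qed
    have "(\<integral>x. ?h x * box_bump n a b x \<partial>lebesgue) = 0" for n
    proof -
      have "(\<integral>x. ?h x * box_bump n a b x \<partial>lebesgue) = (\<integral>x. indicator \<Omega> x * (g x * box_bump n a b x) \<partial>lebesgue)"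
        using ab box_subset_cbox[of a b] box_bump_outside[of _ a b n]
        by (intro Bochner_Integration.integral_cong refl) (auto simp: indicator_def)
      also have "\<dots> = (LINT x|lebesgue_on \<Omega>. g x * box_bump n a b x)" by (simp add: integral_restrict_space)
      also have "\<dots> = 0" by (rule int[OF test_fun_box_bump[OF ab]])
      finally show ?thesis .
    qed
    then have "(\<lambda>n. \<integral>x. ?h x * box_bump n a b x \<partial>lebesgue) \<longlonglongrightarrow> 0" by simp
    moreover have "(\<lambda>n. \<integral>x. ?h x * box_bump n a b x \<partial>lebesgue) \<longlonglongrightarrow> (\<integral>x. ?h x * indicator (box a b) x \<partial>lebesgue)"
    proof (rule integral_dominated_convergence[OF _ _ integrable_abs[OF ih]])
      show "AE x in lebesgue. (\<lambda>n. ?h x * box_bump n a b x) \<longlonglongrightarrow> ?h x * indicator (box a b) x"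
        by (intro AE_I2 tendsto_intros box_bump_tendsto)
      show "AE x in lebesgue. norm (?h x * box_bump n a b x) \<le> \<bar>?h x\<bar>" for n
        using box_bump_bounds[of n a b]
        by (intro AE_I2) (simp add: abs_mult mult_left_le abs_of_nonneg)
    next
      show "(\<lambda>x. ?h x * indicator (box a b) x) \<in> borel_measurable lebesgue"
        by (intro borel_measurable_times[OF borel_measurable_integrable[OF ih]] borel_measurable_indicator) simp
      show "(\<lambda>x. ?h x * box_bump n a b x) \<in> borel_measurable lebesgue" for n
        by (rule borel_measurable_times[OF borel_measurable_integrable[OF ih] bump_m])
    qed
    ultimately have "(\<integral>x. ?h x * indicator (box a b) x \<partial>lebesgue) = 0" by (intro LIMSEQ_unique)
    moreover have "(\<lambda>x. ?h x * indicator (box a b) x) = (\<lambda>x. indicator (box a b) x * g x)"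
      using box_subset_cbox[of a b] by (auto simp: fun_eq_iff indicator_def)
    ultimately show ?thesis by simp
  qed
  have AE_box: "AE x in lebesgue. x \<in> cbox c d \<longrightarrow> g x = 0" if cd: "cbox c d \<subseteq> \<Omega>" for c d
  proof -
    have "AE x in lebesgue. indicator (box c d) x * g x = 0"
    proof (rule AE_zero_of_box_integrals)
      have "integrable lebesgue (\<lambda>x. indicator (box c d) x * (indicator (cbox c d) x * g x))"
        using integrable_mult_indicator[OF _ iK[OF compact_cbox cd], of "box c d"] by simp
      moreover have "(\<lambda>x. indicator (box c d) x * (indicator (cbox c d) x * g x)) =
          (\<lambda>x. indicator (box c d) x * g x)"
        using box_subset_cbox[of c d] by (auto simp: fun_eq_iff indicator_def)
      ultimately show "integrable lebesgue (\<lambda>x. indicator (box c d) x * g x)" by simp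
      fix a b
      \<comment> \<open>Truncation to \<open>box c d\<close> preserves the vanishing of box
        integrals: the intersection of two boxes is a box, and the closed box with its corners stays
        inside \<open>cbox c d\<close>.\<close>
      have e: "(\<lambda>x. indicator (box a b) x * (indicator (box c d) x * g x)) =
          (\<lambda>x. indicator (box a b \<inter> box c d) x * g x)" by (auto simp: indicator_def)
      show "(\<integral>x. indicator (box a b) x * (indicator (box c d) x * g x) \<partial>lebesgue) = 0"
      proof (cases "box a b \<inter> box c d = {}")
        case False
        define a' b' where "a' = (\<chi> i. max (a $ i) (c $ i))" and "b' = (\<chi> i. min (b $ i) (d $ i))"
        have eq: "box a b \<inter> box c d = box a' b'" unfolding a'_def b'_def by (rule box_Int_box_cart)
        have "cbox a' b' \<subseteq> cbox c d" by (auto simp: mem_box_cart a'_def b'_def)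
        then show ?thesis unfolding e eq using box0 cd by (metis order_trans)
      qed (simp add: e)
    qed (auto simp: indicator_def)
    \<comment> \<open>The argument covers the open box; the faces of the closed one form a null
      set.\<close>
    moreover have "AE x in lebesgue. x \<notin> cbox c d - box c d"
      using negligible_frontier_interval[of c d] unfolding negligible_iff_null_sets by (rule AE_not_in)
    ultimately show ?thesis by eventually_elim (auto simp: indicator_def split: if_splits)
  qed
  obtain \<D> where D: "countable \<D>" "\<D> \<subseteq> Pow \<Omega>" "\<And>X. X \<in> \<D> \<Longrightarrow> \<exists>a b. X = cbox a b" "\<Union>\<D> = \<Omega>"
    using open_countable_Union_open_cbox[OF \<Omega>] by metis
  have "AE x in lebesgue. \<forall>X\<in>\<D>. x \<in> X \<longrightarrow> g x = 0"
    unfolding AE_ball_countable[OF D(1)] using AE_box D(2,3) by blast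
  then have "AE x in lebesgue. x \<in> \<Omega> \<longrightarrow> g x = 0"
    by eventually_elim (use D(4) in blast)
  then show ?thesis by (simp add: AE_restrict_space_iff)
qed

section \<open>Linear structure of the Sobolev space\<close>

lemma locally_integrable_add:
  "locally_integrable \<Omega> f \<Longrightarrow> locally_integrable \<Omega> g \<Longrightarrow> locally_integrable \<Omega> (\<lambda>x. f x + g x)"
  by (simp add: locally_integrable_def)

lemma locally_integrable_bounded_linear:
  assumes "bounded_linear T" "locally_integrable \<Omega> f"
  shows "locally_integrable \<Omega> (\<lambda>x. T (f x))"
  using assms by (auto simp: locally_integrable_def intro: integrable_bounded_linear)

lemma test_fun_continuous:
  assumes "test_fun \<Omega> \<phi>"
  shows "continuous_on UNIV \<phi>" "continuous_on UNIV (partial_deriv j \<phi>)"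
proof -
  have d: "foldr partial_deriv js \<phi> differentiable (at x)" for js x
    using assms by (auto simp: test_fun_def smooth_fun_def)
  show "continuous_on UNIV \<phi>" "continuous_on UNIV (partial_deriv j \<phi>)"
    using d[of "[]"] d[of "[j]"]
    by (auto intro!: continuous_at_imp_continuous_on differentiable_imp_continuous_within)
qed

lemma partial_deriv_outside_support:
  assumes "x \<notin> closure {x. \<phi> x \<noteq> 0}" shows "partial_deriv j \<phi> x = 0"
proof -
  have "((\<lambda>_. 0) has_derivative (\<lambda>_. 0)) (at x)" by simp
  then have "(\<phi> has_derivative (\<lambda>_. 0)) (at x)"
  proof (rule has_derivative_transform_within_open[of _ _ _ _ "- closure {x. \<phi> x \<noteq> 0}"])
    show "0 = \<phi> y" if "y \<in> - closure {x. \<phi> x \<noteq> 0}" for y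
      using that closure_subset[of "{x. \<phi> x \<noteq> 0}"] by auto
  qed (use assms in auto)
  from frechet_derivative_at[OF this] show ?thesis by (metis partial_deriv_def)
qed

lemma locally_integrable_mult_compact_support:
  fixes h :: "real^'d \<Rightarrow> real"
  assumes \<Omega>: "open \<Omega>" and h: "locally_integrable \<Omega> h" and \<phi>: "continuous_on UNIV \<phi>"
    and K: "compact K" "K \<subseteq> \<Omega>" and out: "\<And>x. x \<notin> K \<Longrightarrow> \<phi> x = 0"
  shows "integrable (lebesgue_on \<Omega>) (\<lambda>x. h x * \<phi> x)"
proof -
  have Km: "K \<in> sets lebesgue" using K(1) by (simp add: compact_imp_closed)
  have "integrable (lebesgue_on K) h" using h K by (simp add: locally_integrable_def)
  then have i: "integrable lebesgue (\<lambda>x. indicator K x * h x)"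
    using Km by (simp add: integrable_restrict_space)
  obtain B where B: "\<forall>x\<in>K. \<bar>\<phi> x\<bar> \<le> B"
    using compact_continuous_image[OF continuous_on_subset[OF \<phi> subset_UNIV] K(1)]
    by (auto dest!: compact_imp_bounded simp: bounded_iff)
  have \<phi>m: "\<phi> \<in> borel_measurable lebesgue"
    using \<phi> by (simp add: borel_measurable_continuous_onI measurable_completion)
  have "integrable lebesgue (\<lambda>x. (indicator K x * h x) * \<phi> x)"
  proof (rule Bochner_Integration.integrable_bound[OF integrable_mult_left[OF i, of B]])
    show "(\<lambda>x. (indicator K x * h x) * \<phi> x) \<in> borel_measurable lebesgue"
      by (rule borel_measurable_times[OF borel_measurable_integrable[OF i] \<phi>m])
    show "AE x in lebesgue. norm (indicator K x * h x * \<phi> x) \<le> norm (indicator K x * h x * B)"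
      using B by (intro AE_I2) (force simp: indicator_def abs_mult intro!: mult_left_mono)
  qed
  moreover have "(\<lambda>x. (indicator K x * h x) * \<phi> x) = (\<lambda>x. indicator \<Omega> x * (h x * \<phi> x))"
    using out K(2) by (auto simp: fun_eq_iff indicator_def)
  ultimately show ?thesis using \<Omega> by (simp add: integrable_restrict_space)
qed

lemma weak_gradient_integrable:
  fixes \<Omega> :: "(real^'d) set" and g :: "real^'d \<Rightarrow> real^'d^'m" and u :: "real^'d \<Rightarrow> real^'m"
  assumes \<Omega>: "open \<Omega>" and \<phi>: "test_fun \<Omega> \<phi>"
  shows "locally_integrable \<Omega> g \<Longrightarrow> integrable (lebesgue_on \<Omega>) (\<lambda>x. g x $ i $ j * \<phi> x)"
    and "locally_integrable \<Omega> u \<Longrightarrow> integrable (lebesgue_on \<Omega>) (\<lambda>x. u x $ i * partial_deriv j \<phi> x)"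
proof -
  let ?K = "closure {x. \<phi> x \<noteq> 0}"
  have K: "compact ?K" "?K \<subseteq> \<Omega>" using \<phi> by (auto simp: test_fun_def)
  have o: "\<phi> x = 0" if "x \<notin> ?K" for x using that closure_subset[of "{x. \<phi> x \<noteq> 0}"] by auto
  have bl: "bounded_linear (\<lambda>A::real^'d^'m. A $ i $ j)"
    using bounded_linear_compose[OF bounded_linear_vec_nth[of j] bounded_linear_vec_nth[of i]] by (simp add: o_def)
  show "locally_integrable \<Omega> g \<Longrightarrow> integrable (lebesgue_on \<Omega>) (\<lambda>x. g x $ i $ j * \<phi> x)"
    by (rule locally_integrable_mult_compact_support[OF \<Omega> locally_integrable_bounded_linear[OF bl]
          test_fun_continuous(1)[OF \<phi>] K o])
  show "locally_integrable \<Omega> u \<Longrightarrow> integrable (lebesgue_on \<Omega>) (\<lambda>x. u x $ i * partial_deriv j \<phi> x)"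
    by (rule locally_integrable_mult_compact_support[OF \<Omega>
          locally_integrable_bounded_linear[OF bounded_linear_vec_nth]
          test_fun_continuous(2)[OF \<phi>] K partial_deriv_outside_support])
qed

text \<open>Every entry of the difference annihilates all test functions. This is what gives the
  arbitrary representative \<open>weak_grad\<close> its algebraic properties almost
  everywhere.\<close>

lemma weak_gradient_unique:
  assumes \<Omega>: "open \<Omega>" and g: "has_weak_gradient \<Omega> u g" "has_weak_gradient \<Omega> u g'"
  shows "AE x in lebesgue_on \<Omega>. g x = g' x"
proof -
  have l: "locally_integrable \<Omega> g" "locally_integrable \<Omega> g'" using g by (auto simp: has_weak_gradient_def)
  have "AE x in lebesgue_on \<Omega>. g x $ i $ j - g' x $ i $ j = 0" for i j
  proof (rule fundamental_lemma[OF \<Omega>])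
    have "bounded_linear (\<lambda>A::real^'a^'b. A $ i $ j)"
      using bounded_linear_compose[OF bounded_linear_vec_nth[of j] bounded_linear_vec_nth[of i]] by (simp add: o_def)
    from locally_integrable_bounded_linear[OF this l(1)] locally_integrable_bounded_linear[OF this l(2)]
    show "locally_integrable \<Omega> (\<lambda>x. g x $ i $ j - g' x $ i $ j)"
      by (simp add: locally_integrable_def)
    fix \<phi> assume \<phi>: "test_fun \<Omega> \<phi>"
    have "(LINT x|lebesgue_on \<Omega>. g x $ i $ j * \<phi> x) = (LINT x|lebesgue_on \<Omega>. g' x $ i $ j * \<phi> x)"
    proof -
      have "(LINT x|lebesgue_on \<Omega>. u x $ i * partial_deriv j \<phi> x) = - (LINT x|lebesgue_on \<Omega>. k x $ i $ j * \<phi> x)"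
        if "has_weak_gradient \<Omega> u k" for k using that \<phi> unfolding has_weak_gradient_def by blast
      from this[OF g(1)] this[OF g(2)] show ?thesis by simp
    qed
    then show "(LINT x|lebesgue_on \<Omega>. (g x $ i $ j - g' x $ i $ j) * \<phi> x) = 0"
      using weak_gradient_integrable(1)[OF \<Omega> \<phi> l(1)] weak_gradient_integrable(1)[OF \<Omega> \<phi> l(2)]
      by (simp add: left_diff_distrib)
  qed
  then have "AE x in lebesgue_on \<Omega>. \<forall>i j. g x $ i $ j - g' x $ i $ j = 0"
    by (simp add: AE_all_countable)
  then show ?thesis by eventually_elim (simp add: vec_eq_iff)
qed

lemma has_weak_gradient_add:
  assumes \<Omega>: "open \<Omega>" and u: "has_weak_gradient \<Omega> u g" and v: "has_weak_gradient \<Omega> v k"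
  shows "has_weak_gradient \<Omega> (\<lambda>x. u x + v x) (\<lambda>x. g x + k x)"
  using u v unfolding has_weak_gradient_def
  by (auto simp: locally_integrable_add distrib_right weak_gradient_integrable[OF \<Omega>])

lemma has_weak_gradient_scale:
  assumes "has_weak_gradient \<Omega> u g"
  shows "has_weak_gradient \<Omega> (\<lambda>x. c *\<^sub>R u x) (\<lambda>x. c *\<^sub>R g x)"
  using assms unfolding has_weak_gradient_def
  by (auto simp: locally_integrable_def mult.assoc)

lemma has_weak_gradient_weak_grad:
  "has_weak_gradient \<Omega> u g \<Longrightarrow> has_weak_gradient \<Omega> u (weak_grad \<Omega> u)"
  unfolding weak_grad_def by (rule someI[of "has_weak_gradient \<Omega> u"])

section \<open>Modular bounds for \<open>L\<^sup>p\<close> functions\<close>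

lemma measurable_lebesgue_on_AE_eq:
  fixes f :: "real^'d \<Rightarrow> 'b::euclidean_space"
  assumes "\<Omega> \<in> sets lebesgue" "f \<in> borel_measurable (lebesgue_on \<Omega>)"
    "AE x in lebesgue_on \<Omega>. f x = g x"
  shows "g \<in> borel_measurable (lebesgue_on \<Omega>)"
  by (rule complete_measure.measurable_AE_eq[OF complete_measure_lebesgue_on[OF assms(1)] assms(2,3)]) simp

text \<open>A bound on the modular \<open>\<integral> |V|\<^sup>p\<close>, with which no triangle inequality for the norm of
  \<open>L\<^sup>p\<close> is needed.\<close>

definition Lp_bounded :: "ennreal \<Rightarrow> (real^'d) set \<Rightarrow> real \<Rightarrow> (real^'d \<Rightarrow> 'b::euclidean_space) \<Rightarrow> bool" where
  "Lp_bounded p \<Omega> R V \<longleftrightarrow> V \<in> borel_measurable (lebesgue_on \<Omega>) \<and>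
     (if p = \<infinity> then AE x in lebesgue_on \<Omega>. norm (V x) \<le> R
      else integrable (lebesgue_on \<Omega>) (\<lambda>x. norm (V x) powr enn2real p) \<and>
        (LINT x|lebesgue_on \<Omega>. norm (V x) powr enn2real p) \<le> R)"

lemma Lp_boundedD:
  assumes "Lp_bounded p \<Omega> R V"
  shows Lp_bounded_measurable: "V \<in> borel_measurable (lebesgue_on \<Omega>)"
    and Lp_bounded_AE: "p = \<infinity> \<Longrightarrow> AE x in lebesgue_on \<Omega>. norm (V x) \<le> R"
    and Lp_bounded_integrable: "p \<noteq> \<infinity> \<Longrightarrow> integrable (lebesgue_on \<Omega>) (\<lambda>x. norm (V x) powr enn2real p)"
    and Lp_bounded_integral_le: "p \<noteq> \<infinity> \<Longrightarrow> (LINT x|lebesgue_on \<Omega>. norm (V x) powr enn2real p) \<le> R"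
  using assms by (auto simp: Lp_bounded_def)

lemma in_Lp_AE_bound:
  assumes "in_Lp \<infinity> \<Omega> u"
  shows "AE x in lebesgue_on \<Omega>. norm (u x) \<le> Lp_norm \<infinity> \<Omega> u"
  using esssup_AE[of "\<lambda>x. ennreal (norm (u x))" "lebesgue_on \<Omega>"]
proof eventually_elim
  case (elim x)
  \<comment> \<open>Finiteness matters here, since \<open>enn2real\<close> sends infinity to
    \<open>0\<close>.\<close>
  have "esssup (lebesgue_on \<Omega>) (\<lambda>x. ennreal (norm (u x))) < top"
    using assms by (simp add: in_Lp_def)
  from enn2real_mono[OF elim this] show ?case by (simp add: Lp_norm_def)
qed

lemma in_Lp_imp_Lp_bounded:
  assumes "in_Lp p \<Omega> u" shows "\<exists>R. Lp_bounded p \<Omega> R u"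
proof (cases "p = \<infinity>")
  case True
  then show ?thesis using assms in_Lp_AE_bound[of \<Omega> u] by (auto simp: in_Lp_def Lp_bounded_def)
next
  case False
  then show ?thesis using assms by (auto simp: in_Lp_def Lp_bounded_def)
qed

lemma Lp_bounded_imp_in_Lp:
  assumes "Lp_bounded p \<Omega> R u" shows "in_Lp p \<Omega> u"
proof (cases "p = \<infinity>")
  case True
  have [measurable]: "u \<in> borel_measurable (lebesgue_on \<Omega>)" by (rule Lp_bounded_measurable[OF assms])
  have "esssup (lebesgue_on \<Omega>) (\<lambda>x. ennreal (norm (u x))) \<le> ennreal R"
    using Lp_bounded_AE[OF assms True]
    by (intro esssup_I) (auto elim!: eventually_mono intro: ennreal_leI)
  then have "esssup (lebesgue_on \<Omega>) (\<lambda>x. ennreal (norm (u x))) < \<infinity>" using le_less_trans by fastforce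
  then show ?thesis using True by (simp add: in_Lp_def)
next
  case False
  then show ?thesis using assms by (auto simp: in_Lp_def Lp_bounded_def)
qed

text \<open>The factor in \<open>(a + b)^s \<le> 2^s * (a^s + b^s)\<close>; for
  \<open>p = \<infinity>\<close> essential bounds simply add.\<close>

definition modular_const :: "ennreal \<Rightarrow> real" where
  "modular_const p = (if p = \<infinity> then 1 else 2 powr enn2real p)"

lemma powr_add_le:
  fixes a b s :: real
  assumes "0 \<le> a" "0 \<le> b" "0 \<le> s"
  shows "(a + b) powr s \<le> 2 powr s * (a powr s + b powr s)"
proof -
  have "(a + b) powr s \<le> (2 * max a b) powr s" using assms by (intro powr_mono2) auto
  also have "\<dots> = 2 powr s * max a b powr s" using assms by (simp add: powr_mult)
  also have "max a b powr s \<le> a powr s + b powr s" by (simp add: max_def)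
  finally show ?thesis by simp
qed

text \<open>Domination takes the place of equality, and the three functions may have different
  types: sums, functions changed on a null set, jets and real radius functions are all
  covered.\<close>

lemma Lp_bounded_add:
  fixes X :: "real^'d \<Rightarrow> 'a::euclidean_space" and V :: "real^'d \<Rightarrow> 'b::euclidean_space"
    and W :: "real^'d \<Rightarrow> 'c::euclidean_space"
  assumes V: "Lp_bounded p \<Omega> R V" and W: "Lp_bounded p \<Omega> R' W"
    and X[measurable]: "X \<in> borel_measurable (lebesgue_on \<Omega>)"
    and le: "AE x in lebesgue_on \<Omega>. norm (X x) \<le> norm (V x) + norm (W x)"
  shows "Lp_bounded p \<Omega> (modular_const p * (R + R')) X"
proof (cases "p = \<infinity>")
  case True
  have "AE x in lebesgue_on \<Omega>. norm (X x) \<le> R + R'"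
    using le Lp_bounded_AE[OF V True] Lp_bounded_AE[OF W True] by eventually_elim simp
  then show ?thesis using X True by (simp add: Lp_bounded_def modular_const_def)
next
  case False
  let ?s = "enn2real p"
  let ?g = "\<lambda>x. 2 powr ?s * (norm (V x) powr ?s + norm (W x) powr ?s)"
  have ig: "integrable (lebesgue_on \<Omega>) ?g"
    using Lp_bounded_integrable[OF V False] Lp_bounded_integrable[OF W False] by simp
  have b: "AE x in lebesgue_on \<Omega>. norm (X x) powr ?s \<le> ?g x"
    using le
  proof eventually_elim
    case (elim x)
    then have "norm (X x) powr ?s \<le> (norm (V x) + norm (W x)) powr ?s" by (intro powr_mono2) auto
    also have "\<dots> \<le> ?g x" by (intro powr_add_le) auto
    finally show ?case .
  qed
  have iX: "integrable (lebesgue_on \<Omega>) (\<lambda>x. norm (X x) powr ?s)"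
    using b by (intro Bochner_Integration.integrable_bound[OF ig]) (auto elim!: eventually_mono)
  have "(LINT x|lebesgue_on \<Omega>. norm (X x) powr ?s) \<le> (LINT x|lebesgue_on \<Omega>. ?g x)"
    by (rule integral_mono_AE[OF iX ig b])
  also have "\<dots> = 2 powr ?s * ((LINT x|lebesgue_on \<Omega>. norm (V x) powr ?s) + (LINT x|lebesgue_on \<Omega>. norm (W x) powr ?s))"
    using Lp_bounded_integrable[OF V False] Lp_bounded_integrable[OF W False] by simp
  also have "\<dots> \<le> 2 powr ?s * (R + R')"
    using Lp_bounded_integral_le[OF V False] Lp_bounded_integral_le[OF W False] by (intro mult_left_mono) auto
  finally show ?thesis using X iX False by (simp add: Lp_bounded_def modular_const_def)
qed

lemma Lp_bounded_scale:
  assumes V: "Lp_bounded p \<Omega> R V"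
  shows "in_Lp p \<Omega> (\<lambda>x. c *\<^sub>R V x)"
proof -
  have [measurable]: "V \<in> borel_measurable (lebesgue_on \<Omega>)" by (rule Lp_bounded_measurable[OF V])
  show ?thesis
  proof (cases "p = \<infinity>")
    case True
    have "Lp_bounded p \<Omega> (\<bar>c\<bar> * R) (\<lambda>x. c *\<^sub>R V x)"
      unfolding Lp_bounded_def using True Lp_bounded_AE[OF V True]
      by (auto elim!: eventually_mono intro: mult_left_mono)
    then show ?thesis by (rule Lp_bounded_imp_in_Lp)
  next
    case False
    then show ?thesis
      using Lp_bounded_integrable[OF V False] by (simp add: in_Lp_def powr_mult)
  qed
qed

lemma in_Lp_scale: "in_Lp p \<Omega> V \<Longrightarrow> in_Lp p \<Omega> (\<lambda>x. c *\<^sub>R V x)"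
  using in_Lp_imp_Lp_bounded Lp_bounded_scale by blast

lemma in_Lp_add:
  assumes "in_Lp p \<Omega> V" "in_Lp p \<Omega> W" shows "in_Lp p \<Omega> (\<lambda>x. V x + W x)"
proof -
  obtain R R' where "Lp_bounded p \<Omega> R V" "Lp_bounded p \<Omega> R' W"
    using assms in_Lp_imp_Lp_bounded by blast
  then have "Lp_bounded p \<Omega> (modular_const p * (R + R')) (\<lambda>x. V x + W x)"
    by (rule Lp_bounded_add) (use assms in \<open>auto simp: in_Lp_def intro: norm_triangle_ineq\<close>)
  then show ?thesis by (rule Lp_bounded_imp_in_Lp)
qed

lemma in_Lp_AE_eq:
  assumes "\<Omega> \<in> sets lebesgue" "in_Lp p \<Omega> V" "AE x in lebesgue_on \<Omega>. V x = W x"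
  shows "in_Lp p \<Omega> W"
proof -
  obtain R where R: "Lp_bounded p \<Omega> R V" using assms(2) in_Lp_imp_Lp_bounded by blast
  have "W \<in> borel_measurable (lebesgue_on \<Omega>)"
    by (rule measurable_lebesgue_on_AE_eq[OF assms(1) Lp_bounded_measurable[OF R] assms(3)])
  then have "Lp_bounded p \<Omega> (modular_const p * (R + R)) W"
    by (rule Lp_bounded_add[OF R R]) (use assms(3) in \<open>auto elim!: eventually_mono\<close>)
  then show ?thesis by (rule Lp_bounded_imp_in_Lp)
qed

section \<open>Jets of Sobolev functions\<close>

definition jet :: "(real^'d) set \<Rightarrow> (real^'d \<Rightarrow> real^'m) \<Rightarrow> real^'d \<Rightarrow> (real^'m) \<times> (real^'d^'m)" where
  "jet \<Omega> u x = (u x, weak_grad \<Omega> u x)"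

lemma W1p_add:
  assumes \<Omega>: "open \<Omega>" and u: "u \<in> W1p p \<Omega>" and v: "v \<in> W1p p \<Omega>"
  shows "(\<lambda>x. u x + v x) \<in> W1p p \<Omega>"
    and "AE x in lebesgue_on \<Omega>. jet \<Omega> (\<lambda>x. u x + v x) x = jet \<Omega> u x + jet \<Omega> v x"
proof -
  have g: "has_weak_gradient \<Omega> u (weak_grad \<Omega> u)" "has_weak_gradient \<Omega> v (weak_grad \<Omega> v)"
    using u v has_weak_gradient_weak_grad unfolding W1p_def by blast+
  note s = has_weak_gradient_add[OF \<Omega> g]
  have ae: "AE x in lebesgue_on \<Omega>. weak_grad \<Omega> u x + weak_grad \<Omega> v x = weak_grad \<Omega> (\<lambda>x. u x + v x) x"
    by (rule weak_gradient_unique[OF \<Omega> s has_weak_gradient_weak_grad[OF s]])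
  show "(\<lambda>x. u x + v x) \<in> W1p p \<Omega>"
    using u v s in_Lp_AE_eq[OF _ in_Lp_add ae, of p] \<Omega> unfolding W1p_def
    by (auto intro: in_Lp_add)
  show "AE x in lebesgue_on \<Omega>. jet \<Omega> (\<lambda>x. u x + v x) x = jet \<Omega> u x + jet \<Omega> v x"
    using ae by eventually_elim (simp add: jet_def)
qed

lemma W1p_scale:
  assumes \<Omega>: "open \<Omega>" and u: "u \<in> W1p p \<Omega>"
  shows "(\<lambda>x. c *\<^sub>R u x) \<in> W1p p \<Omega>"
    and "AE x in lebesgue_on \<Omega>. jet \<Omega> (\<lambda>x. c *\<^sub>R u x) x = c *\<^sub>R jet \<Omega> u x"
proof -
  have g: "has_weak_gradient \<Omega> u (weak_grad \<Omega> u)"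
    using u has_weak_gradient_weak_grad unfolding W1p_def by blast
  note s = has_weak_gradient_scale[OF g, of c]
  have ae: "AE x in lebesgue_on \<Omega>. c *\<^sub>R weak_grad \<Omega> u x = weak_grad \<Omega> (\<lambda>x. c *\<^sub>R u x) x"
    by (rule weak_gradient_unique[OF \<Omega> s has_weak_gradient_weak_grad[OF s]])
  show "(\<lambda>x. c *\<^sub>R u x) \<in> W1p p \<Omega>"
    using u s in_Lp_AE_eq[OF _ in_Lp_scale ae, of p] \<Omega> unfolding W1p_def
    by (auto intro: in_Lp_scale)
  show "AE x in lebesgue_on \<Omega>. jet \<Omega> (\<lambda>x. c *\<^sub>R u x) x = c *\<^sub>R jet \<Omega> u x"
    using ae by eventually_elim (simp add: jet_def)
qed

lemma fun_subspace_W1p: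
  assumes "open \<Omega>" shows "fun_subspace (W1p p \<Omega>)"
proof -
  have "locally_integrable \<Omega> (\<lambda>_. 0)" by (simp add: locally_integrable_def)
  then have g: "has_weak_gradient \<Omega> (\<lambda>_. 0) (\<lambda>_. 0)" by (simp add: has_weak_gradient_def locally_integrable_def)
  have ae: "AE x in lebesgue_on \<Omega>. 0 = weak_grad \<Omega> (\<lambda>_. 0) x"
    by (rule weak_gradient_unique[OF assms g has_weak_gradient_weak_grad[OF g]])
  have 0: "Lp_bounded p \<Omega> 0 (\<lambda>_. 0)" by (simp add: Lp_bounded_def)
  have "(\<lambda>_. 0) \<in> W1p p \<Omega>"
    using g assms Lp_bounded_imp_in_Lp[OF 0] in_Lp_AE_eq[OF _ Lp_bounded_imp_in_Lp[OF 0] ae]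
    unfolding W1p_def by auto
  then show ?thesis
    using W1p_add(1)[OF assms] W1p_scale(1)[OF assms] unfolding fun_subspace_def by blast
qed

lemma jet_measurable:
  assumes "u \<in> W1p p \<Omega>" shows "jet \<Omega> u \<in> borel_measurable (lebesgue_on \<Omega>)"
proof -
  have [measurable]: "u \<in> borel_measurable (lebesgue_on \<Omega>)" "weak_grad \<Omega> u \<in> borel_measurable (lebesgue_on \<Omega>)"
    using assms by (auto simp: W1p_def in_Lp_def)
  show ?thesis unfolding jet_def by (intro borel_measurable_Pair) measurable
qed

lemma W1p_norm_nonneg: "0 \<le> W1p_norm p \<Omega> u"
  by (auto simp: W1p_norm_def Lp_norm_def le_max_iff_disj)

lemma norm_jet_le: "norm (jet \<Omega> u x) \<le> norm (u x) + norm (weak_grad \<Omega> u x)"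
  unfolding jet_def by (rule norm_Pair_le)

text \<open>For \<open>p = \<infinity>\<close> the Sobolev norm is a maximum and bounds each of two
  terms; for finite \<open>p\<close> its \<open>p\<close>-th power is the sum of the two modulars,
  and \<open>2 powr p\<close> is the constant for their combination.\<close>

lemma Lp_bounded_jet:
  assumes p: "1 \<le> p" and u: "u \<in> W1p p \<Omega>"
  shows "Lp_bounded p \<Omega> (if p = \<infinity> then 2 * W1p_norm p \<Omega> u
      else 2 powr enn2real p * W1p_norm p \<Omega> u powr enn2real p) (jet \<Omega> u)"
proof (cases "p = \<infinity>")
  case True
  have "Lp_bounded p \<Omega> (Lp_norm p \<Omega> u) u" "Lp_bounded p \<Omega> (Lp_norm p \<Omega> (weak_grad \<Omega> u)) (weak_grad \<Omega> u)"
    using u True in_Lp_AE_bound by (auto simp: W1p_def Lp_bounded_def in_Lp_def)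
  from Lp_bounded_add[OF this jet_measurable[OF u]] norm_jet_le
  have "Lp_bounded p \<Omega> (modular_const p * (Lp_norm p \<Omega> u + Lp_norm p \<Omega> (weak_grad \<Omega> u))) (jet \<Omega> u)" by blast
  then have "AE x in lebesgue_on \<Omega>. norm (jet \<Omega> u x) \<le> Lp_norm p \<Omega> u + Lp_norm p \<Omega> (weak_grad \<Omega> u)"
    using True by (simp add: Lp_bounded_def modular_const_def)
  then have "AE x in lebesgue_on \<Omega>. norm (jet \<Omega> u x) \<le> 2 * W1p_norm p \<Omega> u"
    by eventually_elim (auto simp: W1p_norm_def True)
  then show ?thesis using True jet_measurable[OF u] by (simp add: Lp_bounded_def)
next
  case False
  let ?s = "enn2real p"
  let ?I = "\<lambda>f. LINT x|lebesgue_on \<Omega>. norm (f x) powr ?s"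
  have s: "1 \<le> ?s" using p False by (cases p) (auto simp: top_unique)
  have "Lp_bounded p \<Omega> (?I u) u" "Lp_bounded p \<Omega> (?I (weak_grad \<Omega> u)) (weak_grad \<Omega> u)"
    using u False by (auto simp: W1p_def Lp_bounded_def in_Lp_def)
  from Lp_bounded_add[OF this jet_measurable[OF u]] norm_jet_le
  have "Lp_bounded p \<Omega> (modular_const p * (?I u + ?I (weak_grad \<Omega> u))) (jet \<Omega> u)" by blast
  moreover have "W1p_norm p \<Omega> u powr ?s = ?I u + ?I (weak_grad \<Omega> u)"
    using s False by (simp add: W1p_norm_def Lp_norm_def powr_powr)
  ultimately show ?thesis using False by (simp add: modular_const_def)
qed

section \<open>Integrable weights and measurability\<close>

text \<open>\<open>L\<close> bounds the pairing with \<open>M\<close> and is a separate argument so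
  that it can stay fixed while \<open>M\<close> varies. The \<open>itself\<close> argument
  determines \<open>'m\<close>, which the remaining arguments leave open.\<close>

definition jet_weight ::
    "ennreal \<Rightarrow> (real^'d) set \<Rightarrow> 'm::finite itself \<Rightarrow> real \<Rightarrow> (real^'d \<Rightarrow> real) \<Rightarrow> bool" where
  "jet_weight p \<Omega> (_ :: 'm::finite itself) L M \<longleftrightarrow> M \<in> borel_measurable (lebesgue_on \<Omega>) \<and> (\<forall>x. 0 \<le> M x) \<and>
     (\<forall>h :: real^'d \<Rightarrow> real^'m. h \<in> W1p p \<Omega> \<longrightarrow>
        integrable (lebesgue_on \<Omega>) (\<lambda>x. M x * norm (jet \<Omega> h x)) \<and>
        (LINT x|lebesgue_on \<Omega>. M x * norm (jet \<Omega> h x)) \<le> L * W1p_norm p \<Omega> h)"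

lemma jet_weight_top:
  fixes \<beta> :: "real^'d \<Rightarrow> real"
  assumes \<beta>: "integrable (lebesgue_on \<Omega>) \<beta>" "\<And>x. 0 \<le> \<beta> x"
  shows "jet_weight \<infinity> \<Omega> TYPE('m::finite) (2 * (LINT x|lebesgue_on \<Omega>. \<beta> x)) \<beta>"
  unfolding jet_weight_def
proof (intro conjI allI impI)
  fix h :: "real^'d \<Rightarrow> real^'m" assume h: "h \<in> W1p \<infinity> \<Omega>"
  note [measurable] = borel_measurable_integrable[OF \<beta>(1)] jet_measurable[OF h]
  let ?N = "W1p_norm \<infinity> \<Omega> h"
  have b: "AE x in lebesgue_on \<Omega>. \<beta> x * norm (jet \<Omega> h x) \<le> \<beta> x * (2 * ?N)"
    using Lp_bounded_AE[OF Lp_bounded_jet[OF _ h]] \<beta>(2) by (auto elim!: eventually_mono intro: mult_left_mono)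
  have i: "integrable (lebesgue_on \<Omega>) (\<lambda>x. \<beta> x * (2 * ?N))" using \<beta> by simp
  show iJ: "integrable (lebesgue_on \<Omega>) (\<lambda>x. \<beta> x * norm (jet \<Omega> h x))"
    using b by (intro Bochner_Integration.integrable_bound[OF i]) (auto elim!: eventually_mono simp: \<beta>(2) W1p_norm_nonneg)
  show "(LINT x|lebesgue_on \<Omega>. \<beta> x * norm (jet \<Omega> h x)) \<le> 2 * (LINT x|lebesgue_on \<Omega>. \<beta> x) * ?N"
    using integral_mono_AE[OF iJ i b] by (simp add: mult_ac)
qed (use \<beta> in auto)

lemma jet_weight_1:
  fixes M :: "real^'d \<Rightarrow> real"
  assumes M: "M \<in> borel_measurable (lebesgue_on \<Omega>)" "\<And>x. 0 \<le> M x"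
    and c: "AE x in lebesgue_on \<Omega>. M x \<le> c" "0 \<le> c"
  shows "jet_weight 1 \<Omega> TYPE('m::finite) (2 * c) M"
  unfolding jet_weight_def
proof (intro conjI allI impI)
  fix h :: "real^'d \<Rightarrow> real^'m" assume h: "h \<in> W1p 1 \<Omega>"
  note [measurable] = M(1) jet_measurable[OF h]
  let ?N = "W1p_norm 1 \<Omega> h"
  have B: "Lp_bounded 1 \<Omega> (2 * ?N) (jet \<Omega> h)" using Lp_bounded_jet[OF _ h] by (simp add: W1p_norm_nonneg)
  have iN: "integrable (lebesgue_on \<Omega>) (\<lambda>x. norm (jet \<Omega> h x))"
    and N: "(LINT x|lebesgue_on \<Omega>. norm (jet \<Omega> h x)) \<le> 2 * ?N"
    using Lp_bounded_integrable[OF B] Lp_bounded_integral_le[OF B] by auto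
  have b: "AE x in lebesgue_on \<Omega>. M x * norm (jet \<Omega> h x) \<le> c * norm (jet \<Omega> h x)"
    using c(1) by (auto elim!: eventually_mono intro: mult_right_mono)
  have i: "integrable (lebesgue_on \<Omega>) (\<lambda>x. c * norm (jet \<Omega> h x))" using iN by simp
  show iJ: "integrable (lebesgue_on \<Omega>) (\<lambda>x. M x * norm (jet \<Omega> h x))"
    using b by (intro Bochner_Integration.integrable_bound[OF i]) (auto elim!: eventually_mono simp: M(2) c(2))
  have "(LINT x|lebesgue_on \<Omega>. M x * norm (jet \<Omega> h x)) \<le> c * (LINT x|lebesgue_on \<Omega>. norm (jet \<Omega> h x))"
    using integral_mono_AE[OF iJ i b] by simp
  also have "\<dots> \<le> c * (2 * ?N)" using N c(2) by (rule mult_left_mono)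
  finally show "(LINT x|lebesgue_on \<Omega>. M x * norm (jet \<Omega> h x)) \<le> 2 * c * ?N" by (simp add: mult_ac)
qed (use M in auto)

text \<open>A form of Hoelder's inequality, by Young's inequality for \<open>M x\<close> and the jet
  divided by its norm. After integration the first term contributes at most \<open>S\<close>; the
  second contributes at most \<open>2 powr s\<close>, the bound for the modular of the normalized
  jet.\<close>

lemma jet_weight_finite:
  fixes M :: "real^'d \<Rightarrow> real"
  assumes s: "1 < s" and s': "1 / s + 1 / s' = 1" "1 < s'"
    and M: "M \<in> borel_measurable (lebesgue_on \<Omega>)" "\<And>x. 0 \<le> M x"
    and iM: "integrable (lebesgue_on \<Omega>) (\<lambda>x. M x powr s')"
    and S: "(LINT x|lebesgue_on \<Omega>. M x powr s') \<le> S"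
  shows "jet_weight (ennreal s) \<Omega> TYPE('m::finite) (S + 2 powr s) M"
  unfolding jet_weight_def
proof (intro conjI allI impI)
  fix h :: "real^'d \<Rightarrow> real^'m" assume h: "h \<in> W1p (ennreal s) \<Omega>"
  note [measurable] = M(1) jet_measurable[OF h]
  let ?N = "W1p_norm (ennreal s) \<Omega> h" and ?b = "\<lambda>x. norm (jet \<Omega> h x)"
  have p: "1 \<le> ennreal s" "ennreal s \<noteq> \<infinity>" "enn2real (ennreal s) = s" using s by auto
  have B: "Lp_bounded (ennreal s) \<Omega> (2 powr s * ?N powr s) (jet \<Omega> h)"
    using Lp_bounded_jet[OF p(1) h] p by simp
  have ib: "integrable (lebesgue_on \<Omega>) (\<lambda>x. ?b x powr s)"
    and Ib: "(LINT x|lebesgue_on \<Omega>. ?b x powr s) \<le> 2 powr s * ?N powr s"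
    using Lp_bounded_integrable[OF B p(2)] Lp_bounded_integral_le[OF B p(2)] p(3) by auto
  have "integrable (lebesgue_on \<Omega>) (\<lambda>x. M x * ?b x) \<and>
      (LINT x|lebesgue_on \<Omega>. M x * ?b x) \<le> (S + 2 powr s) * ?N"
  proof (cases "?N = 0")
    \<comment> \<open>Normalization is impossible here, but then the modular of the jet is
      \<open>0\<close> and the jet vanishes almost everywhere.\<close>
    case True
    have "(LINT x|lebesgue_on \<Omega>. ?b x powr s) = 0"
      using Ib s True by (intro antisym integral_nonneg_AE) auto
    then have "AE x in lebesgue_on \<Omega>. ?b x powr s = 0"
      using integral_nonneg_eq_0_iff_AE[OF ib] by simp
    then have 0: "AE x in lebesgue_on \<Omega>. M x * ?b x = 0"
      by eventually_elim simp
    then have "integrable (lebesgue_on \<Omega>) (\<lambda>x. M x * ?b x)"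
      by (subst integrable_cong_AE[of _ _ "\<lambda>_. 0"]) auto
    moreover have "(LINT x|lebesgue_on \<Omega>. M x * ?b x) = (LINT x|lebesgue_on \<Omega>. 0)"
      using 0 by (intro integral_cong_AE) auto
    ultimately show ?thesis using True by simp
  next
    case False
    then have T: "0 < ?N" using W1p_norm_nonneg[of "ennreal s" \<Omega> h] by linarith
    let ?g = "\<lambda>x. ?N * (M x powr s' + ?b x powr s / ?N powr s)"
    have le: "M x * ?b x \<le> ?g x" for x
    proof -
      have "M x * (?b x / ?N) \<le> M x powr s' / s' + (?b x / ?N) powr s / s"
        using s s' M(2) T by (intro Youngs_inequality) auto
      also have "\<dots> \<le> M x powr s' + (?b x / ?N) powr s"
        using s s' by (intro add_mono) (auto simp: divide_le_eq mult_le_cancel_left1)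
      also have "(?b x / ?N) powr s = ?b x powr s / ?N powr s" using T by (simp add: powr_divide)
      finally show ?thesis using T by (simp add: field_simps)
    qed
    have ig: "integrable (lebesgue_on \<Omega>) ?g" using iM ib by simp
    have iJ: "integrable (lebesgue_on \<Omega>) (\<lambda>x. M x * ?b x)"
      using le M(2) by (intro Bochner_Integration.integrable_bound[OF ig]) (auto intro!: AE_I2 abs_ge_self[THEN order_trans[OF le]])
    have "(LINT x|lebesgue_on \<Omega>. M x * ?b x) \<le> (LINT x|lebesgue_on \<Omega>. ?g x)"
      using le by (intro integral_mono iJ ig)
    also have "\<dots> = ?N * ((LINT x|lebesgue_on \<Omega>. M x powr s') + (LINT x|lebesgue_on \<Omega>. ?b x powr s) / ?N powr s)"
      using iM ib by simp
    also have "\<dots> \<le> ?N * (S + 2 powr s)"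
      using S Ib T by (intro mult_left_mono add_mono) (auto simp: divide_le_eq)
    finally show ?thesis using iJ by (simp add: mult.commute)
  qed
  then show "integrable (lebesgue_on \<Omega>) (\<lambda>x. M x * ?b x)"
    "(LINT x|lebesgue_on \<Omega>. M x * ?b x) \<le> (S + 2 powr s) * ?N" by auto
qed (use M in auto)

lemma conj_exponent_ennreal:
  assumes "1 < s" shows "conj_exponent (ennreal s) = ennreal (s / (s - 1))"
proof -
  have "inverse (ennreal s) = ennreal (inverse s)" using assms by (simp add: inverse_ennreal)
  then have "1 - inverse (ennreal s) = ennreal (1 - inverse s)"
    using assms by (simp add: ennreal_minus flip: ennreal_1)
  moreover have "0 < 1 - inverse s" using assms by (simp add: field_simps)
  ultimately have "conj_exponent (ennreal s) = ennreal (inverse (1 - inverse s))"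
    by (simp add: conj_exponent_def inverse_ennreal)
  also have "inverse (1 - inverse s) = s / (s - 1)" using assms by (simp add: field_simps)
  finally show ?thesis .
qed

lemma rpow_mono: "0 \<le> a \<Longrightarrow> a \<le> b \<Longrightarrow> 0 \<le> s \<Longrightarrow> rpow a s \<le> rpow b s"
  by (auto simp: rpow_def intro: powr_mono2)

text \<open>\<open>r\<close> is a pointwise radius, and \<open>M x\<close> bounds all slopes over
  the ball of radius \<open>r x\<close>. The order of quantifiers matters: \<open>L\<close> depends
  on \<open>r\<close> only through the bound \<open>R\<close>, which later yields one Lipschitz
  constant for a whole neighbourhood.\<close>

lemma codiff_growth_weight:
  fixes G :: "real^'d \<Rightarrow> (real^'m) \<times> (real^'d^'m) \<Rightarrow> (real \<times> (real^'m) \<times> (real^'d^'m)) set"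
  assumes p: "1 \<le> p" and G: "codiff_growth_condition p \<Omega> G"
  shows "\<exists>L. \<forall>r :: real^'d \<Rightarrow> real. Lp_bounded p \<Omega> R r \<longrightarrow> (\<exists>M. jet_weight p \<Omega> TYPE('m::finite) L M \<and>
     (AE x in lebesgue_on \<Omega>. \<forall>y a v. norm y \<le> r x \<longrightarrow> (a, v) \<in> G x y \<longrightarrow> norm v \<le> M x))"
proof (cases "p = \<infinity>")
  case True
  \<comment> \<open>The condition is stated for positive \<open>N\<close>, while \<open>R\<close> is
    arbitrary.\<close>
  define N where "N = max R 1"
  have "0 < N" by (simp add: N_def)
  then obtain \<beta> where \<beta>: "integrable (lebesgue_on \<Omega>) \<beta>"
    "AE x in lebesgue_on \<Omega>. \<forall>u \<xi>. max (norm u) (norm \<xi>) \<le> N \<longrightarrow>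
              (\<forall>(a, v1, v2) \<in> G x (u, \<xi>). max \<bar>a\<bar> (max (norm v1) (norm v2)) \<le> \<beta> x)"
    using G True unfolding codiff_growth_condition_def by auto
  have w: "jet_weight p \<Omega> TYPE('m::finite) (2 * (LINT x|lebesgue_on \<Omega>. 2 * \<bar>\<beta> x\<bar>)) (\<lambda>x. 2 * \<bar>\<beta> x\<bar>)"
    unfolding True using \<beta>(1) by (intro jet_weight_top) auto
  show ?thesis
  proof (intro exI[of _ "2 * (LINT x|lebesgue_on \<Omega>. 2 * \<bar>\<beta> x\<bar>)"] allI impI, rule exI, rule conjI[OF w])
    fix r :: "real^'d \<Rightarrow> real" assume r: "Lp_bounded p \<Omega> R r"
    show "AE x in lebesgue_on \<Omega>. \<forall>y a v. norm y \<le> r x \<longrightarrow> (a, v) \<in> G x y \<longrightarrow> norm v \<le> 2 * \<bar>\<beta> x\<bar>"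
      using \<beta>(2) Lp_bounded_AE[OF r True]
    proof eventually_elim
      case (elim x)
      show ?case
      proof (intro allI impI)
        fix y a v assume y: "norm y \<le> r x" and av: "(a, v) \<in> G x y"
        obtain u \<xi> v1 v2 where e: "y = (u, \<xi>)" "v = (v1, v2)" by (cases y; cases v)
        have "norm u \<le> N" "norm \<xi> \<le> N"
          using norm_fst_le[of u \<xi>] norm_snd_le[of \<xi> u] y elim(2) by (auto simp: e N_def)
        then have "max (norm v1) (norm v2) \<le> \<beta> x" using elim(1) av e by fastforce
        then show "norm v \<le> 2 * \<bar>\<beta> x\<bar>"
          using norm_Pair_le[of v1 v2] abs_ge_self[of "\<beta> x"] unfolding e by linarith
      qed
    qed
  qed
next
  case False
  define s where "s = enn2real p"
  have ps: "p = ennreal s" using False by (simp add: s_def less_top)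
  then have s: "1 \<le> s" using p by simp
  obtain \<beta> \<gamma> C where \<gamma>: "in_Lp (conj_exponent p) \<Omega> \<gamma>" and C: "0 < C"
    and b: "AE x in lebesgue_on \<Omega>. \<forall>u \<xi>. \<forall>(a, v1, v2) \<in> G x (u, \<xi>).
              \<bar>a\<bar> \<le> \<beta> x + C * (norm u powr s + norm \<xi> powr s) \<and>
              max (norm v1) (norm v2) \<le> \<gamma> x + C * (rpow (norm u) (s - 1) + rpow (norm \<xi>) (s - 1))"
    using G False unfolding codiff_growth_condition_def s_def by (auto simp: less_top)
  have \<gamma>m[measurable]: "\<gamma> \<in> borel_measurable (lebesgue_on \<Omega>)" using \<gamma> by (simp add: in_Lp_def)
  \<comment> \<open>Each of \<open>v1\<close> and \<open>v2\<close> is at most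
    \<open>\<bar>\<gamma>\<bar> + 2 * C * r^(s - 1)\<close>, and the norm of the pair is at most
    their sum.\<close>
  define M where "M r x = 2 * \<bar>\<gamma> x\<bar> + 4 * C * rpow \<bar>r x\<bar> (s - 1)" for r :: "real^'d \<Rightarrow> real" and x
  have M0: "0 \<le> M r x" for r x using C by (simp add: M_def rpow_def)
  have Mm: "M r \<in> borel_measurable (lebesgue_on \<Omega>)" if [measurable]: "r \<in> borel_measurable (lebesgue_on \<Omega>)" for r
    unfolding M_def rpow_def by measurable
  have Mb: "AE x in lebesgue_on \<Omega>. \<forall>y a v. norm y \<le> r x \<longrightarrow> (a, v) \<in> G x y \<longrightarrow> norm v \<le> M r x" for r
    using b
  proof eventually_elim
    case (elim x)
    show ?case
    proof (intro allI impI)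
      fix y a v assume y: "norm y \<le> r x" and av: "(a, v) \<in> G x y"
      obtain u \<xi> v1 v2 where e: "y = (u, \<xi>)" "v = (v1, v2)" by (cases y; cases v)
      have "norm u \<le> \<bar>r x\<bar>" "norm \<xi> \<le> \<bar>r x\<bar>"
        using norm_fst_le[of u \<xi>] norm_snd_le[of \<xi> u] y by (auto simp: e)
      then have "rpow (norm u) (s - 1) \<le> rpow \<bar>r x\<bar> (s - 1)" "rpow (norm \<xi>) (s - 1) \<le> rpow \<bar>r x\<bar> (s - 1)"
        using s by (auto intro!: rpow_mono)
      then have "C * (rpow (norm u) (s - 1) + rpow (norm \<xi>) (s - 1)) \<le> C * (2 * rpow \<bar>r x\<bar> (s - 1))"
        using C by (intro mult_left_mono) auto
      moreover have "max (norm v1) (norm v2) \<le> \<gamma> x + C * (rpow (norm u) (s - 1) + rpow (norm \<xi>) (s - 1))"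
        using elim av e by fastforce
      ultimately have "norm v1 \<le> \<bar>\<gamma> x\<bar> + C * (2 * rpow \<bar>r x\<bar> (s - 1))" "norm v2 \<le> \<bar>\<gamma> x\<bar> + C * (2 * rpow \<bar>r x\<bar> (s - 1))"
        by auto
      then show "norm v \<le> M r x" using norm_Pair_le[of v1 v2] by (simp add: e M_def)
    qed
  qed
  have "\<exists>L. \<forall>r. Lp_bounded p \<Omega> R r \<longrightarrow> jet_weight p \<Omega> TYPE('m::finite) L (M r)"
  proof (cases "s = 1")
    case True
    then have p1: "p = 1" using ps by simp
    \<comment> \<open>For \<open>p = 1\<close> the function \<gamma> is essentially bounded and
      \<open>rpow\<close> is the constant \<open>1\<close>, so \<open>M r\<close> is essentially
      bounded, uniformly in \<open>r\<close>.\<close>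
    have "conj_exponent p = \<infinity>" by (simp add: p1 conj_exponent_def)
    with in_Lp_AE_bound[of \<Omega> \<gamma>] \<gamma> obtain c where c: "AE x in lebesgue_on \<Omega>. \<bar>\<gamma> x\<bar> \<le> c" by auto
    have "AE x in lebesgue_on \<Omega>. M r x \<le> 2 * \<bar>c\<bar> + 4 * C" for r
      using c by eventually_elim (auto simp: M_def True rpow_def)
    then have "jet_weight p \<Omega> TYPE('m::finite) (2 * (2 * \<bar>c\<bar> + 4 * C)) (M r)" if "Lp_bounded p \<Omega> R r" for r
      unfolding p1 using C by (intro jet_weight_1 Mm Lp_bounded_measurable[OF that] M0) auto
    then show ?thesis by blast
  next
    case False
    with s have s1: "1 < s" by simp
    define s' where "s' = s / (s - 1)"
    \<comment> \<open>By \<open>(s - 1) * s' = s\<close>, the growth \<open>r^(s - 1)\<close> raised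
      to the power \<open>s'\<close> is the modular integrand of \<open>r\<close>.\<close>
    have s': "1 / s + 1 / s' = 1" "1 < s'" "(s - 1) * s' = s"
      using s1 by (auto simp: s'_def field_simps)
    have conj: "conj_exponent p = ennreal s'" unfolding ps s'_def by (rule conj_exponent_ennreal[OF s1])
    have i\<gamma>: "integrable (lebesgue_on \<Omega>) (\<lambda>x. \<bar>\<gamma> x\<bar> powr s')"
      using \<gamma> s'(2) unfolding conj by (simp add: in_Lp_def)
    define A where "A = (LINT x|lebesgue_on \<Omega>. \<bar>\<gamma> x\<bar> powr s')"
    have "jet_weight p \<Omega> TYPE('m::finite) (2 powr s' * (2 powr s' * A + (4 * C) powr s' * R) + 2 powr s) (M r)"
      if r: "Lp_bounded p \<Omega> R r" for r
      unfolding ps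
    proof (rule jet_weight_finite[OF s1 s'(1,2) Mm[OF Lp_bounded_measurable[OF r]] M0])
      have pn: "p \<noteq> \<infinity>" "enn2real p = s" using ps s by auto
      note [measurable] = Mm[OF Lp_bounded_measurable[OF r]]
      have ir: "integrable (lebesgue_on \<Omega>) (\<lambda>x. \<bar>r x\<bar> powr s)" and Ir: "(LINT x|lebesgue_on \<Omega>. \<bar>r x\<bar> powr s) \<le> R"
        using Lp_bounded_integrable[OF r pn(1)] Lp_bounded_integral_le[OF r pn(1)] pn(2) by auto
      let ?g = "\<lambda>x. 2 powr s' * (2 powr s' * \<bar>\<gamma> x\<bar> powr s' + (4 * C) powr s' * \<bar>r x\<bar> powr s)"
      have ig: "integrable (lebesgue_on \<Omega>) ?g" using i\<gamma> ir by simp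
      have le: "M r x powr s' \<le> ?g x" for x
      proof -
        have "M r x powr s' \<le> 2 powr s' * ((2 * \<bar>\<gamma> x\<bar>) powr s' + (4 * C * rpow \<bar>r x\<bar> (s - 1)) powr s')"
          unfolding M_def using C s' by (intro powr_add_le) (auto simp: rpow_def)
        also have "(4 * C * rpow \<bar>r x\<bar> (s - 1)) powr s' = (4 * C) powr s' * \<bar>r x\<bar> powr s"
          using C s1 s'(3) by (simp add: rpow_def powr_mult powr_powr)
        finally show ?thesis by (simp add: powr_mult)
      qed
      show iM: "integrable (lebesgue_on \<Omega>) (\<lambda>x. M r x powr s')"
        by (rule Bochner_Integration.integrable_bound[OF ig]) (auto intro!: AE_I2 order_trans[OF le])
      have "(LINT x|lebesgue_on \<Omega>. M r x powr s') \<le> (LINT x|lebesgue_on \<Omega>. ?g x)"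
        by (intro integral_mono iM ig le)
      also have "\<dots> = 2 powr s' * (2 powr s' * A + (4 * C) powr s' * (LINT x|lebesgue_on \<Omega>. \<bar>r x\<bar> powr s))"
        using i\<gamma> ir by (simp add: A_def)
      also have "\<dots> \<le> 2 powr s' * (2 powr s' * A + (4 * C) powr s' * R)"
        using Ir by (intro mult_left_mono add_mono) auto
      finally show "(LINT x|lebesgue_on \<Omega>. M r x powr s') \<le> 2 powr s' * (2 powr s' * A + (4 * C) powr s' * R)" .
    qed
    then show ?thesis by blast
  qed
  then show ?thesis using Mb by blast
qed

section \<open>Measurability of integrands and support functions\<close>

lemma caratheodory_fun_compose:
  fixes g :: "real^'d \<Rightarrow> 'y::{metric_space, second_countable_topology} \<Rightarrow> real"
  assumes \<Omega>: "open \<Omega>" and g: "caratheodory_fun \<Omega> g" and u: "u \<in> borel_measurable (lebesgue_on \<Omega>)"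
  shows "(\<lambda>x. g x (u x)) \<in> borel_measurable (lebesgue_on \<Omega>)"
proof -
  interpret complete_measure "lebesgue_on \<Omega>" using \<Omega> by (intro complete_measure_lebesgue_on) auto
  \<comment> \<open>Replacing \<open>g\<close> by \<open>0\<close> off \<open>Z\<close> gives
    continuity at every point; completeness makes \<open>Z\<close> measurable and absorbs the
    change.\<close>
  define Z where "Z = {x \<in> space (lebesgue_on \<Omega>). continuous_on UNIV (g x)}"
  have c: "AE x in lebesgue_on \<Omega>. continuous_on UNIV (g x)" using g by (simp add: caratheodory_fun_def)
  have [measurable]: "Z \<in> sets (lebesgue_on \<Omega>)" unfolding Z_def by (rule sets_Collect_AE[OF c])
  have [measurable]: "(\<lambda>x. g x y) \<in> borel_measurable (lebesgue_on \<Omega>)" for y using g by (simp add: caratheodory_fun_def)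
  have "(\<lambda>x. if x \<in> Z then g x (u x) else 0) \<in> borel_measurable (lebesgue_on \<Omega>)"
  proof (rule caratheodory_measurable[where g = "\<lambda>x y. if x \<in> Z then g x y else 0", OF _ _ u])
    show "continuous_on UNIV (\<lambda>y. if x \<in> Z then g x y else 0)" for x
    proof (cases "x \<in> Z")
      case True
      then have "continuous_on UNIV (g x)" by (simp add: Z_def)
      with True show ?thesis by simp
    qed simp
  qed measurable
  moreover have "AE x in lebesgue_on \<Omega>. (if x \<in> Z then g x (u x) else 0) = g x (u x)"
    using c AE_space by eventually_elim (simp add: Z_def)
  ultimately show ?thesis by (rule measurable_AE_eq) auto
qed

lemma caratheodory_fun_tilted_sup:
  fixes G :: "real^'d \<Rightarrow> 'y::metric_space \<Rightarrow> (real \<times> 'a::euclidean_space) set"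
  assumes \<Omega>: "open \<Omega>" and G: "caratheodory_multifun \<Omega> G"
    and ne: "AE x in lebesgue_on \<Omega>. \<forall>y. compact (G x y) \<and> G x y \<noteq> {}"
  shows "caratheodory_fun \<Omega> (\<lambda>x y. tilted_sup (G x y) c \<xi>)"
  unfolding caratheodory_fun_def
proof (intro conjI allI)
  interpret complete_measure "lebesgue_on \<Omega>" using \<Omega> by (intro complete_measure_lebesgue_on) auto
  show "(\<lambda>x. tilted_sup (G x y) c \<xi>) \<in> borel_measurable (lebesgue_on \<Omega>)" for y
  proof (subst borel_measurable_iff_greater, intro allI)
    fix b
    \<comment> \<open>Up to a null set, the supremum exceeds \<open>b\<close> exactly where
      \<open>G\<close> meets this open half-space, which is the form in which measurability of
      \<open>G\<close> is given.\<close>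
    define V where "V = {p. b < c * fst p + snd p \<bullet> \<xi>}"
    have "open V" unfolding V_def by (intro open_Collect_less continuous_intros)
    then have V: "{x \<in> \<Omega>. G x y \<inter> V \<noteq> {}} \<in> sets (lebesgue_on \<Omega>)"
      using G by (simp add: caratheodory_multifun_def measurable_multifun_def)
    show "{x \<in> space (lebesgue_on \<Omega>). b < tilted_sup (G x y) c \<xi>} \<in> sets (lebesgue_on \<Omega>)"
    proof (rule in_sets_AE[OF _ V])
      show "AE x in lebesgue_on \<Omega>. x \<in> {x \<in> \<Omega>. G x y \<inter> V \<noteq> {}} \<longleftrightarrow>
          x \<in> {x \<in> space (lebesgue_on \<Omega>). b < tilted_sup (G x y) c \<xi>}"
        using ne
      proof eventually_elim
        case (elim x)
        then have "b < tilted_sup (G x y) c \<xi> \<longleftrightarrow> (\<exists>(a, v)\<in>G x y. b < c * a + v \<bullet> \<xi>)"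
          by (intro less_tilted_sup_iff) auto
        then show ?case by (auto simp: V_def)
      qed
    qed auto
  qed
  have "AE x in lebesgue_on \<Omega>. \<forall>y. ((\<lambda>z. hausdorff_dist (G x z) (G x y)) \<longlongrightarrow> 0) (at y)"
    using G by (simp add: caratheodory_multifun_def)
  then show "AE x in lebesgue_on \<Omega>. continuous_on UNIV (\<lambda>y. tilted_sup (G x y) c \<xi>)"
    using ne
  proof eventually_elim
    case (elim x)
    have "((\<lambda>z. tilted_sup (G x z) c \<xi>) \<longlongrightarrow> tilted_sup (G x y) c \<xi>) (at y)" for y
    proof (rule LIM_zero_cancel, rule Lim_null_comparison)
      show "\<forall>\<^sub>F z in at y. norm (tilted_sup (G x z) c \<xi> - tilted_sup (G x y) c \<xi>)
          \<le> (\<bar>c\<bar> + norm \<xi>) * hausdorff_dist (G x z) (G x y)"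
        using elim(2) by (intro always_eventually allI) (simp add: tilted_sup_hausdorff)
      show "((\<lambda>z. (\<bar>c\<bar> + norm \<xi>) * hausdorff_dist (G x z) (G x y)) \<longlongrightarrow> 0) (at y)"
        using elim(1) by (intro tendsto_mult_right_zero) auto
    qed
    then show ?case by (auto simp: continuous_on_def intro: tendsto_within_subset)
  qed
qed

text \<open>Measurability of \<open>G\<close> is tested with open sets, and \<open>a = 0\<close> is
  not an open condition, so the slices are reached as a limit: their support function is the limit
  of the measurable tilted suprema with tilt \<open>n * c\<close>.\<close>

lemma measurable_support_fun_zero_slice:
  fixes G :: "real^'d \<Rightarrow> 'y::{metric_space, second_countable_topology} \<Rightarrow> (real \<times> 'a::euclidean_space) set"
  assumes \<Omega>: "open \<Omega>" and G: "caratheodory_multifun \<Omega> G"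
    and ne: "AE x in lebesgue_on \<Omega>. \<forall>y. compact (G x y) \<and> zero_slice (G x y) \<noteq> {} \<and> (\<forall>(a, v)\<in>G x y. c * a \<le> 0)"
    and c: "c \<noteq> 0" and U: "U \<in> borel_measurable (lebesgue_on \<Omega>)"
  shows "(\<lambda>x. support_fun (zero_slice (G x (U x))) \<xi>) \<in> borel_measurable (lebesgue_on \<Omega>)"
proof -
  interpret complete_measure "lebesgue_on \<Omega>" using \<Omega> by (intro complete_measure_lebesgue_on) auto
  define Z where "Z = {x \<in> space (lebesgue_on \<Omega>). \<forall>y. compact (G x y) \<and> zero_slice (G x y) \<noteq> {} \<and> (\<forall>(a, v)\<in>G x y. c * a \<le> 0)}"
  have [measurable]: "Z \<in> sets (lebesgue_on \<Omega>)" unfolding Z_def by (rule sets_Collect_AE[OF ne])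
  have "AE x in lebesgue_on \<Omega>. \<forall>y. compact (G x y) \<and> G x y \<noteq> {}"
    using ne by eventually_elim (auto simp: zero_slice_def)
  note cf = caratheodory_fun_tilted_sup[OF \<Omega> G this]
  have [measurable]: "(\<lambda>x. tilted_sup (G x (U x)) (real n * c) \<xi>) \<in> borel_measurable (lebesgue_on \<Omega>)" for n
    by (rule caratheodory_fun_compose[OF \<Omega> cf U])
  have "(\<lambda>x. if x \<in> Z then support_fun (zero_slice (G x (U x))) \<xi> else 0) \<in> borel_measurable (lebesgue_on \<Omega>)"
  proof (rule borel_measurable_LIMSEQ_real)
    show "(\<lambda>x. if x \<in> Z then tilted_sup (G x (U x)) (real n * c) \<xi> else 0) \<in> borel_measurable (lebesgue_on \<Omega>)" for n
      by measurable
    show "(\<lambda>n. if x \<in> Z then tilted_sup (G x (U x)) (real n * c) \<xi> else 0) \<longlonglongrightarrow>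
        (if x \<in> Z then support_fun (zero_slice (G x (U x))) \<xi> else 0)" for x
    proof (cases "x \<in> Z")
      case True
      have "((\<lambda>t. tilted_sup (G x (U x)) (t * c) \<xi>) \<longlongrightarrow> support_fun (zero_slice (G x (U x))) \<xi>) at_top"
        using True c by (intro tilted_sup_tendsto) (auto simp: Z_def)
      from filterlim_compose[OF this filterlim_real_sequentially] True show ?thesis by simp
    qed simp
  qed
  moreover have "AE x in lebesgue_on \<Omega>. (if x \<in> Z then support_fun (zero_slice (G x (U x))) \<xi> else 0) =
      support_fun (zero_slice (G x (U x))) \<xi>"
    using ne AE_space by eventually_elim (auto simp: Z_def)
  ultimately show ?thesis by (rule measurable_AE_eq) auto
qed

lemma integrable_growth:
  fixes f :: "real^'d \<Rightarrow> (real^'m) \<times> (real^'d^'m) \<Rightarrow> real"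
  assumes \<Omega>: "open \<Omega>" and p: "1 \<le> p" and f: "caratheodory_fun \<Omega> f" "growth_condition p \<Omega> f" and u: "u \<in> W1p p \<Omega>"
  shows "integrable (lebesgue_on \<Omega>) (\<lambda>x. f x (jet \<Omega> u x))"
proof -
  have m: "(\<lambda>x. f x (jet \<Omega> u x)) \<in> borel_measurable (lebesgue_on \<Omega>)"
    by (rule caratheodory_fun_compose[OF \<Omega> f(1) jet_measurable[OF u]])
  obtain R where R: "Lp_bounded p \<Omega> R (jet \<Omega> u)" using Lp_bounded_jet[OF p u] by blast
  have nj: "norm (u x) \<le> norm (jet \<Omega> u x)" "norm (weak_grad \<Omega> u x) \<le> norm (jet \<Omega> u x)" for x
    by (simp_all add: jet_def norm_fst_le norm_snd_le)
  show ?thesis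
  proof (cases "p = \<infinity>")
    case True
    have "0 < max R 1" by simp
    then obtain \<beta> where \<beta>: "integrable (lebesgue_on \<Omega>) \<beta>"
      "AE x in lebesgue_on \<Omega>. \<forall>u \<xi>. max (norm u) (norm \<xi>) \<le> max R 1 \<longrightarrow> \<bar>f x (u, \<xi>)\<bar> \<le> \<beta> x"
      using f(2) True unfolding growth_condition_def by (auto split: if_splits)
    have "AE x in lebesgue_on \<Omega>. norm (f x (jet \<Omega> u x)) \<le> norm (\<beta> x)"
      using \<beta>(2) Lp_bounded_AE[OF R True]
    proof eventually_elim
      case (elim x)
      have "max (norm (u x)) (norm (weak_grad \<Omega> u x)) \<le> max R 1" using nj[of x] elim(2) by auto
      with elim(1) show ?case by (fastforce simp: jet_def)
    qed
    then show ?thesis by (rule Bochner_Integration.integrable_bound[OF \<beta>(1) m])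
  next
    case False
    let ?s = "enn2real p"
    obtain \<beta> C where \<beta>: "integrable (lebesgue_on \<Omega>) \<beta>" "0 < C"
      "AE x in lebesgue_on \<Omega>. \<forall>u \<xi>. \<bar>f x (u, \<xi>)\<bar> \<le> \<beta> x + C * (norm u powr ?s + norm \<xi> powr ?s)"
      using f(2) False unfolding growth_condition_def by (auto simp: less_top)
    have i: "integrable (lebesgue_on \<Omega>) (\<lambda>x. \<beta> x + C * (2 * norm (jet \<Omega> u x) powr ?s))"
      using \<beta>(1) Lp_bounded_integrable[OF R False] by simp
    have "AE x in lebesgue_on \<Omega>. norm (f x (jet \<Omega> u x)) \<le> norm (\<beta> x + C * (2 * norm (jet \<Omega> u x) powr ?s))"
      using \<beta>(3)
    proof eventually_elim
      case (elim x)
      have "norm (u x) powr ?s \<le> norm (jet \<Omega> u x) powr ?s" "norm (weak_grad \<Omega> u x) powr ?s \<le> norm (jet \<Omega> u x) powr ?s"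
        using nj[of x] by (auto intro!: powr_mono2)
      then have "C * (norm (u x) powr ?s + norm (weak_grad \<Omega> u x) powr ?s) \<le> C * (2 * norm (jet \<Omega> u x) powr ?s)"
        using \<beta>(2) by (intro mult_left_mono) auto
      moreover have "\<bar>f x (jet \<Omega> u x)\<bar> \<le> \<beta> x + C * (norm (u x) powr ?s + norm (weak_grad \<Omega> u x) powr ?s)"
        using elim by (simp add: jet_def)
      ultimately show ?case by simp
    qed
    then show ?thesis by (rule Bochner_Integration.integrable_bound[OF i m])
  qed
qed

section \<open>The two halves of the quasidifferential\<close>

lemma sigma_finite_lebesgue_on:
  assumes "\<Omega> \<in> sets lebesgue" shows "sigma_finite_measure (lebesgue_on (\<Omega> :: 'a::euclidean_space set))"
proof (rule sigma_finite_measure_restrict_space[OF _ assms])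
  show "sigma_finite_measure (lebesgue :: 'a measure)"
  proof
    show "\<exists>A. countable A \<and> A \<subseteq> sets lebesgue \<and> \<Union> A = space (lebesgue :: 'a measure) \<and>
        (\<forall>a\<in>A. emeasure lebesgue a \<noteq> \<infinity>)"
    proof (intro exI[of _ "range (\<lambda>n. ball (0::'a) (real n))"] conjI ballI)
      show "\<Union> (range (\<lambda>n. ball (0::'a) (real n))) = space lebesgue"
        using reals_Archimedean2 by (auto simp: dist_norm)
      fix a assume "a \<in> range (\<lambda>n. ball (0::'a) (real n))"
      then obtain n where "a = ball (0::'a) (real n)" by blast
      then show "emeasure lebesgue a \<noteq> \<infinity>"
        using emeasure_lborel_ball_finite[of "0::'a" "real n"] by simp
    qed auto
  qed
qed

lemma W1p_jet_in_weighted_L1: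
  fixes h :: "real^'d \<Rightarrow> real^'m"
  assumes "jet_weight p \<Omega> TYPE('m) L M" "h \<in> W1p p \<Omega>"
  shows "jet \<Omega> h \<in> weighted_L1 (lebesgue_on \<Omega>) M"
  using assms jet_measurable[OF assms(2)] by (auto simp: jet_weight_def weighted_L1_def)

text \<open>Each half of the quasidifferential consists of the functionals
  \<open>h \<mapsto> \<integral> \<langle>v, (h, \<nabla>h)\<rangle>\<close> with \<open>v\<close> a selection of the zero slice of \<open>G\<close>, and these are
  the restrictions of the linear functionals below \<open>q \<mapsto> \<integral> \<sigma>(x, q(x))\<close> on a weighted \<open>L\<^sup>1\<close> space.\<close>

lemma functional_quasidiff_half:
  fixes \<Omega> :: "(real^'d) set" and u :: "real^'d \<Rightarrow> real^'m"
    and G :: "real^'d \<Rightarrow> (real^'m) \<times> (real^'d^'m) \<Rightarrow> (real \<times> (real^'m) \<times> (real^'d^'m)) set"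
  assumes \<Omega>: "open \<Omega>" and G: "caratheodory_multifun \<Omega> G" and c: "c \<noteq> 0"
    and ne: "AE x in lebesgue_on \<Omega>. \<forall>y. compact (G x y) \<and> zero_slice (G x y) \<noteq> {} \<and> (\<forall>(a, v)\<in>G x y. c * a \<le> 0)"
    and cv: "AE x in lebesgue_on \<Omega>. \<forall>y. convex (G x y)"
    and u: "u \<in> W1p p \<Omega>"
    and M: "jet_weight p \<Omega> TYPE('m) L M"
    and GM: "AE x in lebesgue_on \<Omega>. \<forall>a v. (a, v) \<in> G x (jet \<Omega> u x) \<longrightarrow> norm v \<le> M x"
  defines "P \<equiv> functional_quasidiff p \<Omega> G u"
    and "S \<equiv> \<lambda>h. LINT x|lebesgue_on \<Omega>. support_fun (zero_slice (G x (jet \<Omega> u x))) (jet \<Omega> h x)"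
  shows "convex_functionals (W1p p \<Omega>) P"
    and "compactin (weak_star_topology (W1p p \<Omega>) (W1p_norm p \<Omega>)) P"
    and "\<And>\<phi> h. \<phi> \<in> P \<Longrightarrow> h \<in> W1p p \<Omega> \<Longrightarrow> \<phi> h \<le> S h"
    and "\<And>h. h \<in> W1p p \<Omega> \<Longrightarrow> \<exists>\<phi>\<in>P. \<phi> h = S h"
    and "\<And>h. h \<in> W1p p \<Omega> \<Longrightarrow> integrable (lebesgue_on \<Omega>) (\<lambda>x. support_fun (zero_slice (G x (jet \<Omega> u x))) (jet \<Omega> h x))"
proof -
  let ?N = "lebesgue_on \<Omega>" and ?X = "W1p p \<Omega> :: (real^'d \<Rightarrow> real^'m) set"
  have \<Omega>m: "\<Omega> \<in> sets lebesgue" using \<Omega> by simp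
  interpret complete_measure ?N by (rule complete_measure_lebesgue_on[OF \<Omega>m])
  interpret sigma_finite_measure ?N by (rule sigma_finite_lebesgue_on[OF \<Omega>m])
  have Mm[measurable]: "M \<in> borel_measurable ?N" and M0: "\<And>x. 0 \<le> M x" using M by (auto simp: jet_weight_def)
  define K where "K x = zero_slice (G x (jet \<Omega> u x))" for x
  \<comment> \<open>Off \<open>Z\<close> the integrand \<sigma> will be \<open>0\<close>, so that
    homogeneity, subadditivity, continuity and the bound by \<open>M\<close> hold at every
    point.\<close>
  define Z where "Z = {x \<in> space ?N. compact (K x) \<and> convex (K x) \<and> K x \<noteq> {} \<and> (\<forall>v\<in>K x. norm v \<le> M x)}"
  have good: "AE x in ?N. compact (K x) \<and> convex (K x) \<and> K x \<noteq> {} \<and> (\<forall>v\<in>K x. norm v \<le> M x)"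
    using ne cv GM
  proof eventually_elim
    case (elim x)
    have "norm v \<le> M x" if "v \<in> zero_slice (G x (jet \<Omega> u x))" for v
      using elim(3) that unfolding zero_slice_def by blast
    then show ?case unfolding K_def
      using elim(1)[rule_format, of "jet \<Omega> u x"] elim(2)[rule_format, of "jet \<Omega> u x"]
      by (intro conjI ballI compact_zero_slice convex_zero_slice) simp_all
  qed
  have Zm[measurable]: "Z \<in> sets ?N" unfolding Z_def by (rule sets_Collect_AE[OF good])
  have AEZ: "AE x in ?N. x \<in> Z" using good AE_space by eventually_elim (simp add: Z_def)
  have Z: "compact (K x)" "convex (K x)" "K x \<noteq> {}" "\<And>v. v \<in> K x \<Longrightarrow> norm v \<le> M x" if "x \<in> Z" for x
    using that by (auto simp: Z_def)
  define \<sigma> where "\<sigma> x \<xi> = (if x \<in> Z then support_fun (K x) \<xi> else 0)" for x \<xi>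
  have [measurable]: "(\<lambda>x. support_fun (K x) \<xi>) \<in> borel_measurable ?N" for \<xi>
    unfolding K_def by (rule measurable_support_fun_zero_slice[OF \<Omega> G ne c jet_measurable[OF u]])
  have \<sigma>m: "(\<lambda>x. \<sigma> x \<xi>) \<in> borel_measurable ?N" for \<xi> unfolding \<sigma>_def by measurable
  have \<sigma>c: "continuous_on UNIV (\<sigma> x)" for x
  proof (cases "x \<in> Z")
    case True
    then have "\<sigma> x = support_fun (K x)" by (simp add: \<sigma>_def fun_eq_iff)
    then show ?thesis using continuous_on_support_fun[OF Z(1,3)[OF True]] by simp
  next
    case False
    then have "\<sigma> x = (\<lambda>_. 0)" by (simp add: \<sigma>_def fun_eq_iff)
    then show ?thesis by simp
  qed
  have \<sigma>h: "\<sigma> x (t *\<^sub>R \<xi>) = t * \<sigma> x \<xi>" if "0 \<le> t" for x t \<xi>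
    by (cases "x \<in> Z") (simp_all add: \<sigma>_def support_fun_scale[OF Z(1,3) that])
  have \<sigma>M: "\<bar>\<sigma> x \<xi>\<bar> \<le> M x * norm \<xi>" for x \<xi>
    by (cases "x \<in> Z") (simp_all add: \<sigma>_def M0 abs_support_fun_le[OF Z(1,3,4)])
  have \<sigma>add: "\<sigma> x (\<xi> + \<eta>) \<le> \<sigma> x \<xi> + \<sigma> x \<eta>" for x \<xi> \<eta>
    by (cases "x \<in> Z") (simp_all add: \<sigma>_def support_fun_add_le[OF Z(1,3)])
  have in_K: "v \<in> K x" if "x \<in> Z" "\<And>\<xi>. v \<bullet> \<xi> \<le> \<sigma> x \<xi>" for x v
    using that Z in_of_le_support_fun[of "K x" v] by (simp add: \<sigma>_def)
  let ?E = "weighted_L1 ?N M :: (real^'d \<Rightarrow> (real^'m) \<times> (real^'d^'m)) set"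
  have E: "fun_subspace ?E" by (rule fun_subspace_weighted_L1[OF Mm M0])
  have jE: "jet \<Omega> h \<in> ?E" if "h \<in> ?X" for h :: "real^'d \<Rightarrow> real^'m" by (rule W1p_jet_in_weighted_L1[OF M that])
  have i\<sigma>: "integrable ?N (\<lambda>x. \<sigma> x (q x))" if q: "q \<in> ?E" for q
  proof (rule Bochner_Integration.integrable_bound[OF weighted_L1_integrable[OF q]])
    show "(\<lambda>x. \<sigma> x (q x)) \<in> borel_measurable ?N"
      by (rule caratheodory_measurable[OF \<sigma>m \<sigma>c weighted_L1_measurable[OF q]])
    show "AE x in ?N. norm (\<sigma> x (q x)) \<le> norm (M x * norm (q x))"
      using \<sigma>M M0 by (intro AE_I2) (simp add: abs_mult)
  qed
  define \<Sigma> where "\<Sigma> q = (LINT x|?N. \<sigma> x (q x))" for q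
  have S\<Sigma>: "S h = \<Sigma> (jet \<Omega> h)" "integrable ?N (\<lambda>x. support_fun (K x) (jet \<Omega> h x))" if h: "h \<in> ?X" for h
  proof -
    have m: "(\<lambda>x. support_fun (K x) (jet \<Omega> h x)) \<in> borel_measurable ?N"
      and ae: "AE x in ?N. \<sigma> x (jet \<Omega> h x) = support_fun (K x) (jet \<Omega> h x)"
    proof -
      show ae: "AE x in ?N. \<sigma> x (jet \<Omega> h x) = support_fun (K x) (jet \<Omega> h x)"
        using AEZ by eventually_elim (simp add: \<sigma>_def)
      show "(\<lambda>x. support_fun (K x) (jet \<Omega> h x)) \<in> borel_measurable ?N"
        by (rule measurable_AE_eq[OF borel_measurable_integrable[OF i\<sigma>[OF jE[OF h]]] ae]) simp
    qed
    show "S h = \<Sigma> (jet \<Omega> h)"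
      unfolding S_def \<Sigma>_def K_def[symmetric]
      using ae m borel_measurable_integrable[OF i\<sigma>[OF jE[OF h]]]
      by (intro integral_cong_AE) (auto elim!: eventually_mono)
    show "integrable ?N (\<lambda>x. support_fun (K x) (jet \<Omega> h x))"
      using integrable_cong_AE[OF borel_measurable_integrable[OF i\<sigma>[OF jE[OF h]]] m ae] i\<sigma>[OF jE[OF h]] by simp
  qed
  have \<Sigma>: "sublinear_on ?E \<Sigma>"
    unfolding sublinear_on_def
  proof (intro conjI ballI allI impI)
    fix q r assume q: "q \<in> ?E" and r: "r \<in> ?E"
    have "\<Sigma> (\<lambda>x. q x + r x) \<le> (LINT x|?N. \<sigma> x (q x) + \<sigma> x (r x))"
      unfolding \<Sigma>_def using i\<sigma> q r \<sigma>add fun_subspace_add[OF E q r]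
      by (intro integral_mono) auto
    then show "\<Sigma> (\<lambda>x. q x + r x) \<le> \<Sigma> q + \<Sigma> r" using i\<sigma> q r by (simp add: \<Sigma>_def)
  qed (simp add: \<Sigma>_def \<sigma>h)
  define Q where "Q = {\<psi> \<in> extensional ?E. linear_on_funs ?E \<psi> \<and> (\<forall>q\<in>?E. \<psi> q \<le> \<Sigma> q)}"
  \<comment> \<open>Restriction to jets. \<open>Q\<close> consists of functionals on arbitrary
    fields, where compactness and densities are available; the claims follow once \<open>P\<close>
    is identified with the image of \<open>Q\<close> under this continuous map.\<close>
  define T where "T \<psi> = restrict (\<lambda>h. \<psi> (jet \<Omega> h)) ?X" for \<psi> :: "(real^'d \<Rightarrow> (real^'m) \<times> (real^'d^'m)) \<Rightarrow> real"
  have bvq: "AE x in ?N. \<bar>v x \<bullet> q x\<bar> \<le> M x * norm (q x)" if "AE x in ?N. v x \<in> K x" for v q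
    using that AEZ
  proof eventually_elim
    case (elim x)
    have "\<bar>v x \<bullet> q x\<bar> \<le> norm (v x) * norm (q x)" by (rule Cauchy_Schwarz_ineq2)
    also have "\<dots> \<le> M x * norm (q x)" using Z(4)[OF elim(2,1)] by (rule mult_right_mono) simp
    finally show ?case .
  qed
  have ivq: "integrable ?N (\<lambda>x. v x \<bullet> q x)"
    if q: "q \<in> ?E" and v: "v \<in> borel_measurable ?N" "AE x in ?N. v x \<in> K x" for v q
  proof (rule Bochner_Integration.integrable_bound[OF weighted_L1_integrable[OF q]])
    note [measurable] = v(1) weighted_L1_measurable[OF q]
    show "(\<lambda>x. v x \<bullet> q x) \<in> borel_measurable ?N" by measurable
    show "AE x in ?N. norm (v x \<bullet> q x) \<le> norm (M x * norm (q x))"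
      using bvq[OF v(2), of q] by eventually_elim (simp add: M0)
  qed
  have rep_P: "\<phi> \<in> P"
    if \<phi>: "\<phi> \<in> extensional ?X" and v: "v \<in> borel_measurable ?N" "AE x in ?N. v x \<in> K x"
      and int: "\<And>h. h \<in> ?X \<Longrightarrow> \<phi> h = (LINT x|?N. v x \<bullet> jet \<Omega> h x)" for \<phi> v
  proof -
    have vm[measurable]: "v \<in> borel_measurable ?N" by (rule v)
    note iv = ivq[OF jE v]
    have dual: "\<phi> \<in> dual_space ?X (W1p_norm p \<Omega>)"
      unfolding dual_space_def
    proof (intro CollectI conjI ballI allI \<phi>)
      fix h k t assume h: "h \<in> ?X"
      have "\<phi> (\<lambda>x. t *\<^sub>R h x) = (LINT x|?N. t * (v x \<bullet> jet \<Omega> h x))"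
        unfolding int[OF W1p_scale(1)[OF \<Omega> h]]
      proof (rule integral_cong_AE)
        show "AE x in ?N. v x \<bullet> jet \<Omega> (\<lambda>x. t *\<^sub>R h x) x = t * (v x \<bullet> jet \<Omega> h x)"
          using W1p_scale(2)[OF \<Omega> h, of t] by eventually_elim simp
      qed (use iv[OF h] iv[OF W1p_scale(1)[OF \<Omega> h]] in auto)
      then show "\<phi> (\<lambda>x. t *\<^sub>R h x) = t * \<phi> h" by (simp add: int[OF h])
      assume k: "k \<in> ?X"
      have "\<phi> (\<lambda>x. h x + k x) = (LINT x|?N. v x \<bullet> jet \<Omega> h x + v x \<bullet> jet \<Omega> k x)"
        unfolding int[OF W1p_add(1)[OF \<Omega> h k]]
      proof (rule integral_cong_AE)
        show "AE x in ?N. v x \<bullet> jet \<Omega> (\<lambda>x. h x + k x) x = v x \<bullet> jet \<Omega> h x + v x \<bullet> jet \<Omega> k x"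
          using W1p_add(2)[OF \<Omega> h k] by eventually_elim (simp add: inner_add_right)
      qed (use iv[OF h] iv[OF k] iv[OF W1p_add(1)[OF \<Omega> h k]] in auto)
      then show "\<phi> (\<lambda>x. h x + k x) = \<phi> h + \<phi> k" using iv[OF h] iv[OF k] by (simp add: int h k)
    next
      have "\<bar>\<phi> h\<bar> \<le> L * W1p_norm p \<Omega> h" if h: "h \<in> ?X" for h
      proof -
        have "\<bar>\<phi> h\<bar> \<le> (LINT x|?N. \<bar>v x \<bullet> jet \<Omega> h x\<bar>)" unfolding int[OF h] by (rule integral_abs_bound)
        also have "\<dots> \<le> (LINT x|?N. M x * norm (jet \<Omega> h x))"
          by (intro integral_mono_AE bvq v(2) weighted_L1_integrable[OF jE[OF h]] integrable_abs iv[OF h])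
        also have "\<dots> \<le> L * W1p_norm p \<Omega> h" using M h by (simp add: jet_weight_def)
        finally show ?thesis .
      qed
      then show "\<exists>C. \<forall>h\<in>?X. \<bar>\<phi> h\<bar> \<le> C * W1p_norm p \<Omega> h" by blast
    qed
    moreover have "(0, \<phi>) \<in> functional_codiff p \<Omega> G u"
      unfolding functional_codiff_def
    proof (intro CollectI exI conjI ballI)
      show "(0, \<phi>) = (0, \<phi>)" by simp
      show "\<phi> \<in> dual_space ?X (W1p_norm p \<Omega>)" by (rule dual)
      \<comment> \<open>A selection of the slices is completed by the constant
        \<open>a = 0\<close>.\<close>
      show "measurable_selection \<Omega> (\<lambda>x. G x (u x, weak_grad \<Omega> u x)) (\<lambda>x. (0, fst (v x), snd (v x)))"
        unfolding measurable_selection_def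
      proof
        show "(\<lambda>x. (0::real, fst (v x), snd (v x))) \<in> borel_measurable ?N"
          by (simp add: borel_measurable_Pair vm)
        show "AE x in ?N. (0, fst (v x), snd (v x)) \<in> G x (u x, weak_grad \<Omega> u x)"
          using v(2) by eventually_elim (simp add: K_def zero_slice_def jet_def)
      qed
      show "has_bochner_integral ?N (\<lambda>x. 0) (0::real)" by (rule has_bochner_integral_zero)
      fix h assume h: "h \<in> ?X"
      have "(\<lambda>x. fst (v x) \<bullet> h x + snd (v x) \<bullet> weak_grad \<Omega> h x) = (\<lambda>x. v x \<bullet> jet \<Omega> h x)"
        by (simp add: jet_def inner_prod_def)
      then show "has_bochner_integral ?N (\<lambda>x. fst (v x) \<bullet> h x + snd (v x) \<bullet> weak_grad \<Omega> h x) (\<phi> h)"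
        using iv[OF h] int[OF h] by (simp add: has_bochner_integral_iff)
    qed
    ultimately show ?thesis by (simp add: P_def functional_quasidiff_def)
  qed
  have P_rep: "\<exists>v. v \<in> borel_measurable ?N \<and> (AE x in ?N. v x \<in> K x) \<and>
      (\<forall>h\<in>?X. \<phi> h = (LINT x|?N. v x \<bullet> jet \<Omega> h x))" if \<phi>: "\<phi> \<in> P" for \<phi>
  proof -
    obtain a v1 v2 where sel: "measurable_selection \<Omega> (\<lambda>x. G x (u x, weak_grad \<Omega> u x)) (\<lambda>x. (a x, v1 x, v2 x))"
      and a: "has_bochner_integral ?N a 0"
      and int: "\<And>h. h \<in> ?X \<Longrightarrow> has_bochner_integral ?N (\<lambda>x. v1 x \<bullet> h x + v2 x \<bullet> weak_grad \<Omega> h x) (\<phi> h)"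
      using \<phi> unfolding P_def functional_quasidiff_def functional_codiff_def by auto
    have selm: "(\<lambda>x. (a x, v1 x, v2 x)) \<in> borel_measurable ?N"
      and selG: "AE x in ?N. (a x, v1 x, v2 x) \<in> G x (jet \<Omega> u x)"
      using sel by (auto simp: measurable_selection_def jet_def)
    have "(\<lambda>x. snd (a x, v1 x, v2 x)) \<in> borel_measurable ?N"
      by (rule borel_measurable_continuous_on[OF _ selm]) (intro continuous_intros)
    then have vm: "(\<lambda>x. (v1 x, v2 x)) \<in> borel_measurable ?N" by simp
    \<comment> \<open>Only the integral of \<open>a\<close> is known to vanish; the constant sign of
      \<open>c * a\<close> upgrades this to \<open>a = 0\<close> almost everywhere.\<close>
    have sgn: "AE x in ?N. 0 \<le> - c * a x"
      using selG ne
    proof eventually_elim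
      case (elim x)
      from elim(2) have "\<forall>(a, v)\<in>G x (jet \<Omega> u x). c * a \<le> 0" by blast
      with elim(1) show ?case by fastforce
    qed
    have ia: "integrable ?N (\<lambda>x. - c * a x)" "(LINT x|?N. - c * a x) = 0"
      using a by (auto simp: has_bochner_integral_iff)
    have "AE x in ?N. - c * a x = 0"
      using integral_nonneg_eq_0_iff_AE[OF ia(1) sgn] ia(2) by simp
    then have a0: "AE x in ?N. a x = 0" using c by simp
    have "AE x in ?N. (v1 x, v2 x) \<in> K x"
      using a0 selG by eventually_elim (simp add: K_def zero_slice_def)
    moreover have "\<forall>h\<in>?X. \<phi> h = (LINT x|?N. (v1 x, v2 x) \<bullet> jet \<Omega> h x)"
      using int by (auto simp: has_bochner_integral_iff jet_def)
    ultimately show ?thesis using vm by blast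
  qed
  have TQ_P: "T \<psi> \<in> P" if "\<psi> \<in> Q" for \<psi>
  proof -
    have lin: "linear_on_funs ?E \<psi>" and le: "\<And>q. q \<in> ?E \<Longrightarrow> \<psi> q \<le> (LINT x|?N. \<sigma> x (q x))"
      using that by (auto simp: Q_def \<Sigma>_def)
    obtain v where v: "v \<in> borel_measurable ?N"
      "\<And>q. q \<in> ?E \<Longrightarrow> has_bochner_integral ?N (\<lambda>x. v x \<bullet> q x) (\<psi> q)"
      "AE x in ?N. \<forall>\<xi>. v x \<bullet> \<xi> \<le> \<sigma> x \<xi>"
    proof (rule dominated_functional_representation[OF Mm M0 lin le \<sigma>m])
      show "AE x in ?N. \<forall>\<xi>. \<bar>\<sigma> x \<xi>\<bar> \<le> M x * norm \<xi>" using \<sigma>M by simp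
      show "AE x in ?N. continuous_on UNIV (\<sigma> x)" using \<sigma>c by simp
    qed (use \<sigma>h in auto)
    have "AE x in ?N. v x \<in> K x" using v(3) AEZ by eventually_elim (auto intro: in_K)
    then show ?thesis
      using v(2)[OF jE] by (intro rep_P[OF _ v(1)]) (auto simp: T_def has_bochner_integral_iff)
  qed
  have P_TQ: "\<exists>\<psi>\<in>Q. \<phi> = T \<psi>" if \<phi>: "\<phi> \<in> P" for \<phi>
  proof -
    obtain v where v: "v \<in> borel_measurable ?N" "AE x in ?N. v x \<in> K x"
      and int: "\<And>h. h \<in> ?X \<Longrightarrow> \<phi> h = (LINT x|?N. v x \<bullet> jet \<Omega> h x)" using P_rep[OF \<phi>] by blast
    \<comment> \<open>The selection itself extends \<phi> from jets to all fields.\<close>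
    define \<psi> where "\<psi> = restrict (\<lambda>q. LINT x|?N. v x \<bullet> q x) ?E"
    have "linear_on_funs ?E \<psi>"
      unfolding linear_on_funs_def
    proof (intro conjI ballI allI)
      fix q r t assume q: "q \<in> ?E"
      show "\<psi> (\<lambda>a. t *\<^sub>R q a) = t * \<psi> q" using fun_subspace_scale[OF E q] q by (simp add: \<psi>_def)
      assume r: "r \<in> ?E"
      show "\<psi> (\<lambda>a. q a + r a) = \<psi> q + \<psi> r"
        using fun_subspace_add[OF E q r] q r ivq[OF q v] ivq[OF r v] by (simp add: \<psi>_def inner_add_right)
    qed
    moreover have "\<psi> q \<le> \<Sigma> q" if q: "q \<in> ?E" for q
    proof -
      have "AE x in ?N. v x \<bullet> q x \<le> \<sigma> x (q x)"
        using v(2) AEZ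
      proof eventually_elim
        case (elim x)
        then show ?case using support_fun_upper[OF Z(1) elim(1)] by (simp add: \<sigma>_def)
      qed
      then show ?thesis using q ivq[OF q v] i\<sigma>[OF q] by (simp add: \<psi>_def \<Sigma>_def integral_mono_AE)
    qed
    ultimately have "\<psi> \<in> Q" by (simp add: Q_def \<psi>_def)
    moreover have "\<phi> = T \<psi>"
    proof (rule extensionalityI[of _ ?X])
      show "\<phi> \<in> extensional ?X" using \<phi> by (simp add: P_def functional_quasidiff_def dual_space_def)
    qed (use int jE in \<open>auto simp: T_def \<psi>_def\<close>)
    ultimately show ?thesis by blast
  qed
  have PT: "P = T ` Q" using TQ_P P_TQ by blast
  show "convex_functionals ?X P"
    unfolding convex_functionals_def
  proof (intro ballI)
    fix \<phi> \<phi>' and t :: real assume \<phi>: "\<phi> \<in> P" "\<phi>' \<in> P" and t: "t \<in> {0..1}"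
    obtain \<psi> \<psi>' where \<psi>: "\<psi> \<in> Q" "\<phi> = T \<psi>" "\<psi>' \<in> Q" "\<phi>' = T \<psi>'" using P_TQ \<phi> by blast
    \<comment> \<open>Convexity is read off from \<open>Q\<close>: domination by \<Sigma> survives
      convex combinations, so the selections do not have to be combined.\<close>
    define \<theta> where "\<theta> = restrict (\<lambda>q. (1 - t) * \<psi> q + t * \<psi>' q) ?E"
    have lin: "linear_on_funs ?E \<psi>" "linear_on_funs ?E \<psi>'" using \<psi> by (auto simp: Q_def)
    have "linear_on_funs ?E \<theta>"
      using lin fun_subspace_add[OF E] fun_subspace_scale[OF E]
      by (simp add: linear_on_funs_def \<theta>_def algebra_simps)
    moreover have "\<theta> q \<le> \<Sigma> q" if q: "q \<in> ?E" for q
    proof -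
      have "(1 - t) * \<psi> q + t * \<psi>' q \<le> (1 - t) * \<Sigma> q + t * \<Sigma> q"
        using \<psi> q t by (intro add_mono mult_left_mono) (auto simp: Q_def)
      then show ?thesis using q by (simp add: \<theta>_def algebra_simps)
    qed
    ultimately have "\<theta> \<in> Q" by (simp add: Q_def \<theta>_def)
    moreover have "restrict (\<lambda>h. (1 - t) * \<phi> h + t * \<phi>' h) ?X = T \<theta>"
      using jE by (auto simp: \<psi> T_def \<theta>_def fun_eq_iff restrict_def)
    ultimately show "restrict (\<lambda>h. (1 - t) * \<phi> h + t * \<phi>' h) ?X \<in> P" using TQ_P by simp
  qed
  show "compactin (weak_star_topology ?X (W1p_norm p \<Omega>)) P"
    unfolding weak_star_topology_def compactin_subtopology
  proof
    have "compactin (product_topology (\<lambda>_. euclideanreal) ?E) Q"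
      unfolding Q_def by (rule compactin_linear_minorants[OF E])
    moreover have "continuous_map (product_topology (\<lambda>_. euclideanreal) ?E) (product_topology (\<lambda>_. euclideanreal) ?X) T"
      unfolding continuous_map_componentwise
    proof (intro conjI ballI)
      show "T ` topspace (product_topology (\<lambda>_. euclideanreal) ?E) \<subseteq> extensional ?X" by (auto simp: T_def)
      fix h assume h: "h \<in> ?X"
      have "continuous_map (product_topology (\<lambda>_. euclideanreal) ?E) euclideanreal (\<lambda>\<psi>. \<psi> (jet \<Omega> h))"
        by (rule continuous_map_product_projection[OF jE[OF h]])
      then show "continuous_map (product_topology (\<lambda>_. euclideanreal) ?E) euclideanreal (\<lambda>\<psi>. T \<psi> h)"
        using h by (simp add: T_def)
    qed
    ultimately show "compactin (product_topology (\<lambda>_. euclideanreal) ?X) P"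
      unfolding PT by (rule image_compactin)
    show "P \<subseteq> dual_space ?X (W1p_norm p \<Omega>)" by (auto simp: P_def functional_quasidiff_def)
  qed
  show "\<phi> h \<le> S h" if "\<phi> \<in> P" "h \<in> ?X" for \<phi> h
  proof -
    obtain \<psi> where "\<psi> \<in> Q" "\<phi> = T \<psi>" using P_TQ \<open>\<phi> \<in> P\<close> by blast
    then show ?thesis using that jE S\<Sigma>(1) by (simp add: T_def Q_def)
  qed
  \<comment> \<open>Hahn-Banach on fields supplies a functional touching \<Sigma> at the jet of
    \<open>h\<close>, and \<open>TQ_P\<close> turns it into an element of \<open>P\<close>; no
    pointwise maximizer is chosen.\<close>
  show "\<exists>\<phi>\<in>P. \<phi> h = S h" if h: "h \<in> ?X" for h
  proof -
    obtain \<psi> where \<psi>: "linear_on_funs ?E \<psi>" "\<And>q. q \<in> ?E \<Longrightarrow> \<psi> q \<le> \<Sigma> q" "\<psi> (jet \<Omega> h) = \<Sigma> (jet \<Omega> h)"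
      using exists_linear_minorant[OF E \<Sigma> jE[OF h]] by blast
    have "linear_on_funs ?E (restrict \<psi> ?E)"
      using \<psi>(1) fun_subspace_add[OF E] fun_subspace_scale[OF E] by (simp add: linear_on_funs_def)
    then have "restrict \<psi> ?E \<in> Q" using \<psi>(2) by (simp add: Q_def)
    from TQ_P[OF this] show ?thesis
      using \<psi>(3) h jE[OF h] S\<Sigma>(1)[OF h] by (intro bexI[of _ "T (restrict \<psi> ?E)"]) (auto simp: T_def)
  qed
  show "integrable ?N (\<lambda>x. support_fun (zero_slice (G x (jet \<Omega> u x))) (jet \<Omega> h x))" if "h \<in> ?X" for h
    using S\<Sigma>(2)[OF that] by (simp add: K_def)
qed

section \<open>The integral functional\<close>

lemma int_functional_jet: "int_functional \<Omega> f u = (LINT x|lebesgue_on \<Omega>. f x (jet \<Omega> u x))"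
  by (simp add: int_functional_def jet_def)

lemma codifferential_zero_slices:
  assumes "is_codifferential F y D E"
  shows "compact D \<and> zero_slice D \<noteq> {} \<and> (\<forall>(a, v)\<in>D. 1 * a \<le> 0)"
    and "compact E \<and> zero_slice E \<noteq> {} \<and> (\<forall>(b, w)\<in>E. - 1 * b \<le> 0)"
proof -
  have D: "D \<noteq> {}" "compact D" "codiff_Phi D 0 = 0" and E: "E \<noteq> {}" "compact E" "codiff_Psi E 0 = 0"
    using assms by (auto simp: is_codifferential_def)
  show "compact D \<and> zero_slice D \<noteq> {} \<and> (\<forall>(a, v)\<in>D. 1 * a \<le> 0)"
    using D(2) codiff_Phi_0[OF D(2,1,3)] by blast
  show "compact E \<and> zero_slice E \<noteq> {} \<and> (\<forall>(b, w)\<in>E. - 1 * b \<le> 0)"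
    using E(2) codiff_Psi_0[OF E(2,1,3)] by blast
qed

text \<open>A ball contains the segments between its points, so the slope bound over the ball of
  radius \<open>r x\<close> gives a Lipschitz bound for \<open>f x\<close> there. One
  \<open>M\<close> thus controls both sets of the codifferential and the increments.\<close>

lemma codifferentiability_weight:
  fixes f :: "real^'d \<Rightarrow> (real^'m) \<times> (real^'d^'m) \<Rightarrow> real"
  assumes p: "1 \<le> p" and cond: "codifferentiability_conditions p \<Omega> f dlo dup"
  shows "\<exists>L. \<forall>r :: real^'d \<Rightarrow> real. Lp_bounded p \<Omega> R r \<longrightarrow> (\<exists>M. jet_weight p \<Omega> TYPE('m) L M \<and>
     (AE x in lebesgue_on \<Omega>. \<forall>y a v. norm y \<le> r x \<longrightarrow> (a, v) \<in> dlo x y \<union> dup x y \<longrightarrow> norm v \<le> M x) \<and>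
     (AE x in lebesgue_on \<Omega>. \<forall>y z. norm y \<le> r x \<longrightarrow> norm z \<le> r x \<longrightarrow>
        \<bar>f x z - f x y\<bar> \<le> 2 * M x * norm (z - y)))"
proof -
  have cont: "AE x in lebesgue_on \<Omega>. continuous_on UNIV (f x)"
    and cod: "AE x in lebesgue_on \<Omega>. \<forall>y. is_codifferential (f x) y (dlo x y) (dup x y)"
    and growth: "codiff_growth_condition p \<Omega> (\<lambda>x y. dlo x y \<union> dup x y)"
    using cond by (auto simp: codifferentiability_conditions_def caratheodory_fun_def)
  obtain L where L: "\<And>r :: real^'d \<Rightarrow> real. Lp_bounded p \<Omega> R r \<Longrightarrow> \<exists>M. jet_weight p \<Omega> TYPE('m) L M \<and>
     (AE x in lebesgue_on \<Omega>. \<forall>y a v. norm y \<le> r x \<longrightarrow> (a, v) \<in> dlo x y \<union> dup x y \<longrightarrow> norm v \<le> M x)"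
    using codiff_growth_weight[OF p growth, of R] by blast
  show ?thesis
  proof (intro exI[of _ L] allI impI)
    fix r :: "real^'d \<Rightarrow> real" assume "Lp_bounded p \<Omega> R r"
    from L[OF this] obtain M where M: "jet_weight p \<Omega> TYPE('m) L M"
      "AE x in lebesgue_on \<Omega>. \<forall>y a v. norm y \<le> r x \<longrightarrow> (a, v) \<in> dlo x y \<union> dup x y \<longrightarrow> norm v \<le> M x" by blast
    have "AE x in lebesgue_on \<Omega>. \<forall>y z. norm y \<le> r x \<longrightarrow> norm z \<le> r x \<longrightarrow> \<bar>f x z - f x y\<bar> \<le> 2 * M x * norm (z - y)"
      using cont cod M(2)
    proof eventually_elim
      case (elim x)
      show ?case
      proof (intro allI impI)
        fix y z :: "(real^'m) \<times> (real^'d^'m)" assume yz: "norm y \<le> r x" "norm z \<le> r x"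
        have seg: "norm t \<le> r x" if "t \<in> closed_segment y z" for t
        proof -
          have "closed_segment y z \<subseteq> cball 0 (r x)"
            using yz by (intro closed_segment_subset) auto
          then show ?thesis using that by auto
        qed
        show "\<bar>f x z - f x y\<bar> \<le> 2 * M x * norm (z - y)"
        proof (rule codifferentiable_lipschitz_on_segment[OF elim(1)])
          show "is_codifferential (f x) t (dlo x t) (dup x t)" for t using elim(2) by blast
          show "norm v \<le> M x" if "t \<in> closed_segment y z" "(a, v) \<in> dlo x t \<union> dup x t" for t a v
            using elim(3) seg[OF that(1)] that(2) by blast
        qed
      qed
    qed
    with M show "\<exists>M. jet_weight p \<Omega> TYPE('m) L M \<and>
     (AE x in lebesgue_on \<Omega>. \<forall>y a v. norm y \<le> r x \<longrightarrow> (a, v) \<in> dlo x y \<union> dup x y \<longrightarrow> norm v \<le> M x) \<and>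
     (AE x in lebesgue_on \<Omega>. \<forall>y z. norm y \<le> r x \<longrightarrow> norm z \<le> r x \<longrightarrow>
        \<bar>f x z - f x y\<bar> \<le> 2 * M x * norm (z - y))" by blast
  qed
qed

lemma Lp_bounded_norm_add:
  fixes V :: "real^'d \<Rightarrow> 'b::euclidean_space" and W :: "real^'d \<Rightarrow> 'c::euclidean_space"
  assumes "Lp_bounded p \<Omega> R V" "Lp_bounded p \<Omega> R' W"
  shows "Lp_bounded p \<Omega> (modular_const p * (R + R')) (\<lambda>x. norm (V x) + norm (W x))"
proof (rule Lp_bounded_add[OF assms])
  note [measurable] = Lp_bounded_measurable[OF assms(1)] Lp_bounded_measurable[OF assms(2)]
  show "(\<lambda>x. norm (V x) + norm (W x)) \<in> borel_measurable (lebesgue_on \<Omega>)" by measurable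
qed simp

text \<open>The increment is measured by \<open>\<alpha>\<close> and \<open>k\<close> because homogeneity of the Sobolev norm
  is then not needed.\<close>

lemma int_functional_lipschitz:
  fixes f :: "real^'d \<Rightarrow> (real^'m) \<times> (real^'d^'m) \<Rightarrow> real"
  assumes \<Omega>: "open \<Omega>" and p: "1 \<le> p" and cond: "codifferentiability_conditions p \<Omega> f dlo dup"
  obtains L where "0 \<le> L" "\<And>v w k \<alpha>. v \<in> W1p p \<Omega> \<Longrightarrow> w \<in> W1p p \<Omega> \<Longrightarrow> k \<in> W1p p \<Omega> \<Longrightarrow> 0 \<le> \<alpha> \<Longrightarrow>
    Lp_bounded p \<Omega> R (jet \<Omega> v) \<Longrightarrow> Lp_bounded p \<Omega> R (jet \<Omega> w) \<Longrightarrow>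
    AE x in lebesgue_on \<Omega>. jet \<Omega> v x - jet \<Omega> w x = \<alpha> *\<^sub>R jet \<Omega> k x \<Longrightarrow>
    \<bar>int_functional \<Omega> f v - int_functional \<Omega> f w\<bar> \<le> L * (\<alpha> * W1p_norm p \<Omega> k)"
proof -
  let ?N = "lebesgue_on \<Omega>"
  have f: "caratheodory_fun \<Omega> f" "growth_condition p \<Omega> f"
    using cond by (auto simp: codifferentiability_conditions_def)
  note int = integrable_growth[OF \<Omega> p f]
  \<comment> \<open>A bound for the radius \<open>norm (jet v) + norm (jet w)\<close> that is known
    before \<open>v\<close> and \<open>w\<close>, so \<open>L\<close> does not depend on
    them.\<close>
  define R' where "R' = modular_const p * (R + R)"
  from codifferentiability_weight[OF p cond, of R'] obtain L where
    L: "\<And>r :: real^'d \<Rightarrow> real. Lp_bounded p \<Omega> R' r \<Longrightarrow> \<exists>M. jet_weight p \<Omega> TYPE('m) L M \<and>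
     (AE x in ?N. \<forall>y z. norm y \<le> r x \<longrightarrow> norm z \<le> r x \<longrightarrow> \<bar>f x z - f x y\<bar> \<le> 2 * M x * norm (z - y))"
    by blast
  show thesis
  proof (rule that[of "2 * \<bar>L\<bar>"])
    fix v w k :: "real^'d \<Rightarrow> real^'m" and \<alpha> :: real
    assume v: "v \<in> W1p p \<Omega>" and w: "w \<in> W1p p \<Omega>" and k: "k \<in> W1p p \<Omega>" and \<alpha>: "0 \<le> \<alpha>"
      and R: "Lp_bounded p \<Omega> R (jet \<Omega> v)" "Lp_bounded p \<Omega> R (jet \<Omega> w)"
      and d: "AE x in ?N. jet \<Omega> v x - jet \<Omega> w x = \<alpha> *\<^sub>R jet \<Omega> k x"
    define r where "r x = norm (jet \<Omega> v x) + norm (jet \<Omega> w x)" for x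
    have "Lp_bounded p \<Omega> R' r" unfolding R'_def r_def by (rule Lp_bounded_norm_add[OF R])
    from L[OF this] obtain M where M: "jet_weight p \<Omega> TYPE('m) L M" and
      lip: "AE x in ?N. \<forall>y z. norm y \<le> r x \<longrightarrow> norm z \<le> r x \<longrightarrow> \<bar>f x z - f x y\<bar> \<le> 2 * M x * norm (z - y)" by blast
    have iM: "integrable ?N (\<lambda>x. M x * norm (jet \<Omega> k x))"
      and IM: "(LINT x|?N. M x * norm (jet \<Omega> k x)) \<le> L * W1p_norm p \<Omega> k" using M k by (auto simp: jet_weight_def)
    have "int_functional \<Omega> f v - int_functional \<Omega> f w = (LINT x|?N. f x (jet \<Omega> v x) - f x (jet \<Omega> w x))"
      unfolding int_functional_jet using int[OF v] int[OF w] by simp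
    also have "\<bar>\<dots>\<bar> \<le> (LINT x|?N. \<bar>f x (jet \<Omega> v x) - f x (jet \<Omega> w x)\<bar>)" by (rule integral_abs_bound)
    also have "\<dots> \<le> (LINT x|?N. 2 * \<alpha> * (M x * norm (jet \<Omega> k x)))"
    proof (rule integral_mono_AE)
      show "AE x in ?N. \<bar>f x (jet \<Omega> v x) - f x (jet \<Omega> w x)\<bar> \<le> 2 * \<alpha> * (M x * norm (jet \<Omega> k x))"
        using lip d
      proof eventually_elim
        case (elim x)
        have "\<bar>f x (jet \<Omega> v x) - f x (jet \<Omega> w x)\<bar> \<le> 2 * M x * norm (jet \<Omega> v x - jet \<Omega> w x)"
        proof -
          have "norm (jet \<Omega> v x) \<le> r x" "norm (jet \<Omega> w x) \<le> r x" by (simp_all add: r_def)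
          then show ?thesis using elim(1) by blast
        qed
        then show ?case using \<alpha> by (simp add: elim(2) mult_ac)
      qed
    qed (use int[OF v] int[OF w] iM in auto)
    also have "\<dots> = 2 * \<alpha> * (LINT x|?N. M x * norm (jet \<Omega> k x))" by simp
    also have "\<dots> \<le> 2 * \<alpha> * (\<bar>L\<bar> * W1p_norm p \<Omega> k)"
    proof (rule mult_left_mono)
      show "(LINT x|?N. M x * norm (jet \<Omega> k x)) \<le> \<bar>L\<bar> * W1p_norm p \<Omega> k"
        using IM mult_right_mono[OF abs_ge_self W1p_norm_nonneg] by (rule order_trans)
    qed (use \<alpha> in simp)
    finally show "\<bar>int_functional \<Omega> f v - int_functional \<Omega> f w\<bar> \<le> 2 * \<bar>L\<bar> * (\<alpha> * W1p_norm p \<Omega> k)"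
      by (simp add: mult_ac)
  qed simp
qed

lemma W1p_diff:
  assumes \<Omega>: "open \<Omega>" and u: "u \<in> W1p p \<Omega>" and v: "v \<in> W1p p \<Omega>"
  shows "(\<lambda>x. u x - v x) \<in> W1p p \<Omega>"
    and "AE x in lebesgue_on \<Omega>. jet \<Omega> (\<lambda>x. u x - v x) x = jet \<Omega> u x - jet \<Omega> v x"
proof -
  note s = W1p_scale[OF \<Omega> v, of "-1"]
  show "(\<lambda>x. u x - v x) \<in> W1p p \<Omega>" using W1p_add(1)[OF \<Omega> u s(1)] by simp
  show "AE x in lebesgue_on \<Omega>. jet \<Omega> (\<lambda>x. u x - v x) x = jet \<Omega> u x - jet \<Omega> v x"
    using W1p_add(2)[OF \<Omega> u s(1)] s(2) by eventually_elim simp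
qed

lemma W1p_add_scale:
  assumes \<Omega>: "open \<Omega>" and u: "u \<in> W1p p \<Omega>" and v: "v \<in> W1p p \<Omega>"
  shows "(\<lambda>x. u x + \<alpha> *\<^sub>R v x) \<in> W1p p \<Omega>"
    and "AE x in lebesgue_on \<Omega>. jet \<Omega> (\<lambda>x. u x + \<alpha> *\<^sub>R v x) x = jet \<Omega> u x + \<alpha> *\<^sub>R jet \<Omega> v x"
proof -
  note s = W1p_scale[OF \<Omega> v, of \<alpha>]
  show "(\<lambda>x. u x + \<alpha> *\<^sub>R v x) \<in> W1p p \<Omega>" using W1p_add(1)[OF \<Omega> u s(1)] .
  show "AE x in lebesgue_on \<Omega>. jet \<Omega> (\<lambda>x. u x + \<alpha> *\<^sub>R v x) x = jet \<Omega> u x + \<alpha> *\<^sub>R jet \<Omega> v x"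
    using W1p_add(2)[OF \<Omega> u s(1)] s(2) by eventually_elim simp
qed

lemma Lp_bounded_mono: "Lp_bounded p \<Omega> R V \<Longrightarrow> R \<le> R' \<Longrightarrow> Lp_bounded p \<Omega> R' V"
  by (auto simp: Lp_bounded_def elim: eventually_mono)

lemma Lp_bounded_jet_near:
  assumes "1 \<le> p" "0 \<le> \<rho>"
  obtains R where "\<And>h :: real^'d \<Rightarrow> real^'m. h \<in> W1p p \<Omega> \<Longrightarrow> W1p_norm p \<Omega> h \<le> \<rho> \<Longrightarrow> Lp_bounded p \<Omega> R (jet \<Omega> h)"
proof (cases "p = \<infinity>")
  case True
  show thesis
  proof (rule that[of "2 * \<rho>"])
    fix h :: "real^'d \<Rightarrow> real^'m" assume h: "h \<in> W1p p \<Omega>" "W1p_norm p \<Omega> h \<le> \<rho>"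
    show "Lp_bounded p \<Omega> (2 * \<rho>) (jet \<Omega> h)"
      using Lp_bounded_jet[OF assms(1) h(1)] h(2) True by (auto simp: Lp_bounded_def elim!: eventually_mono)
  qed
next
  case False
  show thesis
  proof (rule that[of "2 powr enn2real p * \<rho> powr enn2real p"])
    fix h :: "real^'d \<Rightarrow> real^'m" assume h: "h \<in> W1p p \<Omega>" "W1p_norm p \<Omega> h \<le> \<rho>"
    have "2 powr enn2real p * W1p_norm p \<Omega> h powr enn2real p \<le> 2 powr enn2real p * \<rho> powr enn2real p"
      using h(2) W1p_norm_nonneg[of p \<Omega> h] by (intro mult_left_mono powr_mono2) auto
    with Lp_bounded_jet[OF assms(1) h(1)] False
    show "Lp_bounded p \<Omega> (2 powr enn2real p * \<rho> powr enn2real p) (jet \<Omega> h)"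
      by (simp only: if_False) (rule Lp_bounded_mono)
  qed
qed

lemma int_functional_locally_lipschitz:
  fixes f :: "real^'d \<Rightarrow> (real^'m) \<times> (real^'d^'m) \<Rightarrow> real"
  assumes \<Omega>: "open \<Omega>" and p: "1 \<le> p" and cond: "codifferentiability_conditions p \<Omega> f dlo dup"
  shows "locally_lipschitz (W1p p \<Omega>) (W1p_norm p \<Omega>) (int_functional \<Omega> f)"
  unfolding locally_lipschitz_def
proof
  fix u :: "real^'d \<Rightarrow> real^'m" assume u: "u \<in> W1p p \<Omega>"
  obtain R1 where R1: "Lp_bounded p \<Omega> R1 (jet \<Omega> u)" using Lp_bounded_jet[OF p u] by blast
  obtain R2 where R2: "\<And>h :: real^'d \<Rightarrow> real^'m. h \<in> W1p p \<Omega> \<Longrightarrow> W1p_norm p \<Omega> h \<le> 1 \<Longrightarrow> Lp_bounded p \<Omega> R2 (jet \<Omega> h)"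
    by (rule Lp_bounded_jet_near[OF p zero_le_one]) blast
  \<comment> \<open>\<open>R1\<close> is for \<open>u\<close> and \<open>R2\<close> for differences
    of norm at most \<open>1\<close>, so \<open>R\<close> serves the whole open unit ball around
    \<open>u\<close>.\<close>
  define R where "R = modular_const p * (R1 + R2)"
  have R: "Lp_bounded p \<Omega> R (jet \<Omega> v)" if v: "v \<in> W1p p \<Omega>" "W1p_norm p \<Omega> (\<lambda>x. v x - u x) < 1" for v
    unfolding R_def
  proof (rule Lp_bounded_add[OF R1 R2[OF W1p_diff(1)[OF \<Omega> v(1) u]] jet_measurable[OF v(1)]])
    show "AE x in lebesgue_on \<Omega>. norm (jet \<Omega> v x) \<le> norm (jet \<Omega> u x) + norm (jet \<Omega> (\<lambda>x. v x - u x) x)"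
      using W1p_diff(2)[OF \<Omega> v(1) u]
    proof eventually_elim
      case (elim x)
      show ?case using norm_triangle_sub[of "jet \<Omega> v x" "jet \<Omega> u x"] by (simp add: elim)
    qed
  qed (use v(2) in simp)
  obtain L where L: "\<And>v w k \<alpha>. v \<in> W1p p \<Omega> \<Longrightarrow> w \<in> W1p p \<Omega> \<Longrightarrow> k \<in> W1p p \<Omega> \<Longrightarrow> 0 \<le> \<alpha> \<Longrightarrow>
    Lp_bounded p \<Omega> R (jet \<Omega> v) \<Longrightarrow> Lp_bounded p \<Omega> R (jet \<Omega> w) \<Longrightarrow>
    AE x in lebesgue_on \<Omega>. jet \<Omega> v x - jet \<Omega> w x = \<alpha> *\<^sub>R jet \<Omega> k x \<Longrightarrow>
    \<bar>int_functional \<Omega> f v - int_functional \<Omega> f w\<bar> \<le> L * (\<alpha> * W1p_norm p \<Omega> k)"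
    by (rule int_functional_lipschitz[OF \<Omega> p cond, where R = R]) blast
  show "\<exists>\<epsilon>>0. \<exists>L. \<forall>v\<in>W1p p \<Omega>. \<forall>w\<in>W1p p \<Omega>.
     W1p_norm p \<Omega> (\<lambda>x. v x - u x) < \<epsilon> \<and> W1p_norm p \<Omega> (\<lambda>x. w x - u x) < \<epsilon> \<longrightarrow>
     \<bar>int_functional \<Omega> f v - int_functional \<Omega> f w\<bar> \<le> L * W1p_norm p \<Omega> (\<lambda>x. v x - w x)"
  proof (rule exI[of _ 1], intro conjI, simp, rule exI[of _ L], intro ballI impI)
    fix v w :: "real^'d \<Rightarrow> real^'m" assume v: "v \<in> W1p p \<Omega>" and w: "w \<in> W1p p \<Omega>"
      and n: "W1p_norm p \<Omega> (\<lambda>x. v x - u x) < 1 \<and> W1p_norm p \<Omega> (\<lambda>x. w x - u x) < 1"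
    have "AE x in lebesgue_on \<Omega>. jet \<Omega> v x - jet \<Omega> w x = 1 *\<^sub>R jet \<Omega> (\<lambda>x. v x - w x) x"
      using W1p_diff(2)[OF \<Omega> v w] by eventually_elim simp
    from L[OF v w W1p_diff(1)[OF \<Omega> v w] _ R[OF v] R[OF w] this] n
    show "\<bar>int_functional \<Omega> f v - int_functional \<Omega> f w\<bar> \<le> L * W1p_norm p \<Omega> (\<lambda>x. v x - w x)" by simp
  qed
qed

section \<open>Directional derivatives and their Hadamard property\<close>

lemma norm_add_scale_le:
  fixes a b :: "'a::real_normed_vector"
  assumes "0 < t" "t < 1" shows "norm (a + t *\<^sub>R b) \<le> norm a + norm b"
  using assms mult_right_mono[of t 1 "norm b"] norm_triangle_ineq[of a "t *\<^sub>R b"] by simp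

text \<open>The limit is tested on sequences in \<open>(0, 1)\<close> so that dominated convergence
  applies. Steps below \<open>1\<close> keep all points within the radius
  \<open>norm (jet u) + norm (jet h)\<close>, where the Lipschitz weight gives the integrable
  majorant \<open>2 * M * norm (jet h)\<close>.\<close>

lemma int_functional_has_dir_deriv:
  fixes f :: "real^'d \<Rightarrow> (real^'m) \<times> (real^'d^'m) \<Rightarrow> real"
  assumes \<Omega>: "open \<Omega>" and p: "1 \<le> p" and cond: "codifferentiability_conditions p \<Omega> f dlo dup"
    and u: "u \<in> W1p p \<Omega>" and h: "h \<in> W1p p \<Omega>"
    and m: "(\<lambda>x. support_fun (zero_slice (dlo x (jet \<Omega> u x))) (jet \<Omega> h x) -
      support_fun (zero_slice (dup x (jet \<Omega> u x))) (- jet \<Omega> h x)) \<in> borel_measurable (lebesgue_on \<Omega>)"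
  shows "has_dir_deriv (int_functional \<Omega> f) u h
    (LINT x|lebesgue_on \<Omega>. support_fun (zero_slice (dlo x (jet \<Omega> u x))) (jet \<Omega> h x) -
      support_fun (zero_slice (dup x (jet \<Omega> u x))) (- jet \<Omega> h x))"
  unfolding has_dir_deriv_def
proof (rule tendsto_at_right_sequentially[of 0 1])
  let ?N = "lebesgue_on \<Omega>"
  have f: "caratheodory_fun \<Omega> f" "growth_condition p \<Omega> f"
    and cod: "AE x in ?N. \<forall>y. is_codifferential (f x) y (dlo x y) (dup x y)"
    using cond by (auto simp: codifferentiability_conditions_def)
  note int = integrable_growth[OF \<Omega> p f]
  obtain R1 R2 where "Lp_bounded p \<Omega> R1 (jet \<Omega> u)" "Lp_bounded p \<Omega> R2 (jet \<Omega> h)"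
    using Lp_bounded_jet[OF p u] Lp_bounded_jet[OF p h] by blast
  note r = Lp_bounded_norm_add[OF this]
  obtain L M where M: "jet_weight p \<Omega> TYPE('m) L M" and
    lip: "AE x in ?N. \<forall>y z. norm y \<le> norm (jet \<Omega> u x) + norm (jet \<Omega> h x) \<longrightarrow>
      norm z \<le> norm (jet \<Omega> u x) + norm (jet \<Omega> h x) \<longrightarrow> \<bar>f x z - f x y\<bar> \<le> 2 * M x * norm (z - y)"
    using codifferentiability_weight[OF p cond] r by blast
  have iM: "integrable ?N (\<lambda>x. 2 * (M x * norm (jet \<Omega> h x)))" using M h by (simp add: jet_weight_def)
  fix s :: "nat \<Rightarrow> real" assume s: "\<And>n. 0 < s n" "\<And>n. s n < 1" "s \<longlonglongrightarrow> 0"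
  note uh = W1p_add_scale[OF \<Omega> u h]
  define q where "q n x = (f x (jet \<Omega> (\<lambda>x. u x + s n *\<^sub>R h x) x) - f x (jet \<Omega> u x)) / s n" for n x
  have eq: "(int_functional \<Omega> f (\<lambda>x. u x + s n *\<^sub>R h x) - int_functional \<Omega> f u) / s n = (LINT x|?N. q n x)" for n
    unfolding q_def int_functional_jet using int[OF uh(1)] int[OF u] by simp
  show "(\<lambda>n. (int_functional \<Omega> f (\<lambda>x. u x + s n *\<^sub>R h x) - int_functional \<Omega> f u) / s n) \<longlonglongrightarrow>
    (LINT x|lebesgue_on \<Omega>. support_fun (zero_slice (dlo x (jet \<Omega> u x))) (jet \<Omega> h x) -
      support_fun (zero_slice (dup x (jet \<Omega> u x))) (- jet \<Omega> h x))"
    unfolding eq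
  proof (rule integral_dominated_convergence[OF m _ iM])
    show "q n \<in> borel_measurable ?N" for n
      unfolding q_def using int[OF uh(1)] int[OF u]
      by (intro borel_measurable_divide borel_measurable_diff borel_measurable_const) auto
    have e: "AE x in ?N. \<forall>n. jet \<Omega> (\<lambda>x. u x + s n *\<^sub>R h x) x = jet \<Omega> u x + s n *\<^sub>R jet \<Omega> h x"
      using uh(2) by (simp add: AE_all_countable)
    have sr: "filterlim s (at_right 0) sequentially"
      using s(3) less_imp_neq[OF s(1), THEN not_sym] s(1) by (simp add: filterlim_at)
    show "AE x in ?N. (\<lambda>n. q n x) \<longlonglongrightarrow> support_fun (zero_slice (dlo x (jet \<Omega> u x))) (jet \<Omega> h x) -
      support_fun (zero_slice (dup x (jet \<Omega> u x))) (- jet \<Omega> h x)"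
      using e cod
    proof eventually_elim
      case (elim x)
      from elim(2) have "is_codifferential (f x) (jet \<Omega> u x) (dlo x (jet \<Omega> u x)) (dup x (jet \<Omega> u x))" by blast
      from filterlim_compose[OF is_codifferential_dir_deriv[OF this] sr, of "jet \<Omega> h x"]
      show ?case by (simp add: q_def elim(1))
    qed
    show "AE x in ?N. norm (q n x) \<le> 2 * (M x * norm (jet \<Omega> h x))" for n
      using e lip
    proof eventually_elim
      case (elim x)
      have "norm (jet \<Omega> u x + s n *\<^sub>R jet \<Omega> h x) \<le> norm (jet \<Omega> u x) + norm (jet \<Omega> h x)"
        using s(1,2)[of n] by (intro norm_add_scale_le) auto
      moreover have "norm (jet \<Omega> u x) \<le> norm (jet \<Omega> u x) + norm (jet \<Omega> h x)" by simp
      ultimately have "\<bar>f x (jet \<Omega> u x + s n *\<^sub>R jet \<Omega> h x) - f x (jet \<Omega> u x)\<bar> \<le>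
          2 * M x * norm (jet \<Omega> u x + s n *\<^sub>R jet \<Omega> h x - jet \<Omega> u x)"
        using elim(2) by blast
      then show ?case using s(1)[of n] by (simp add: q_def elim(1) abs_divide pos_divide_le_eq mult_ac)
    qed
  qed
qed simp

text \<open>For the same step \<alpha>, replacing the direction \<open>v\<close> by \<open>w\<close>
  changes the difference quotient by at most \<open>L\<close> times the norm of
  \<open>w - v\<close>, because \<alpha> cancels. The ordinary directional derivative and a locally
  uniform Lipschitz constant therefore suffice.\<close>

lemma int_functional_hadamard:
  fixes f :: "real^'d \<Rightarrow> (real^'m) \<times> (real^'d^'m) \<Rightarrow> real"
  assumes \<Omega>: "open \<Omega>" and p: "1 \<le> p" and cond: "codifferentiability_conditions p \<Omega> f dlo dup"
    and u: "u \<in> W1p p \<Omega>" and v: "v \<in> W1p p \<Omega>" and D: "has_dir_deriv (int_functional \<Omega> f) u v D"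
    and \<epsilon>: "0 < \<epsilon>"
  shows "\<exists>\<delta>>0. \<forall>\<alpha>. \<forall>w\<in>W1p p \<Omega>. 0 < \<alpha> \<and> \<alpha> < \<delta> \<and> W1p_norm p \<Omega> (\<lambda>x. w x - v x) \<le> \<delta> \<longrightarrow>
     \<bar>(int_functional \<Omega> f (\<lambda>x. u x + \<alpha> *\<^sub>R w x) - int_functional \<Omega> f u) / \<alpha> - D\<bar> < \<epsilon>"
proof -
  let ?F = "int_functional \<Omega> f"
  obtain R1 where R1: "Lp_bounded p \<Omega> R1 (jet \<Omega> u)" using Lp_bounded_jet[OF p u] by blast
  obtain R2 where R2: "Lp_bounded p \<Omega> R2 (jet \<Omega> v)" using Lp_bounded_jet[OF p v] by blast
  obtain R3 where R3: "\<And>h :: real^'d \<Rightarrow> real^'m. h \<in> W1p p \<Omega> \<Longrightarrow> W1p_norm p \<Omega> h \<le> 1 \<Longrightarrow> Lp_bounded p \<Omega> R3 (jet \<Omega> h)"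
    by (rule Lp_bounded_jet_near[OF p zero_le_one]) blast
  define R4 where "R4 = modular_const p * (R1 + R2)"
  define R where "R = max R4 (modular_const p * (R4 + R3))"
  have b4: "Lp_bounded p \<Omega> R4 (\<lambda>x. norm (jet \<Omega> u x) + norm (jet \<Omega> v x))"
    unfolding R4_def by (rule Lp_bounded_norm_add[OF R1 R2])
  have R: "Lp_bounded p \<Omega> R (jet \<Omega> (\<lambda>x. u x + \<alpha> *\<^sub>R w x))"
    if w: "w \<in> W1p p \<Omega>" "W1p_norm p \<Omega> (\<lambda>x. w x - v x) \<le> 1" and \<alpha>: "0 < \<alpha>" "\<alpha> < 1" for w \<alpha>
  proof (rule Lp_bounded_mono, rule Lp_bounded_add[OF b4 R3[OF W1p_diff(1)[OF \<Omega> w(1) v] w(2)] jet_measurable[OF W1p_add_scale(1)[OF \<Omega> u w(1)]]])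
    show "AE x in lebesgue_on \<Omega>. norm (jet \<Omega> (\<lambda>x. u x + \<alpha> *\<^sub>R w x) x) \<le>
        norm (norm (jet \<Omega> u x) + norm (jet \<Omega> v x)) + norm (jet \<Omega> (\<lambda>x. w x - v x) x)"
      using W1p_add_scale(2)[OF \<Omega> u w(1), of \<alpha>] W1p_diff(2)[OF \<Omega> w(1) v]
    proof eventually_elim
      case (elim x)
      have "norm (jet \<Omega> u x + \<alpha> *\<^sub>R jet \<Omega> w x) \<le> norm (jet \<Omega> u x) + norm (jet \<Omega> w x)"
        using \<alpha> by (intro norm_add_scale_le) auto
      also have "norm (jet \<Omega> w x) \<le> norm (jet \<Omega> v x) + norm (jet \<Omega> w x - jet \<Omega> v x)"
        by (rule norm_triangle_sub)
      finally show ?case by (simp add: elim)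
    qed
  qed (simp add: R_def)
  obtain L where L0: "0 \<le> L" and L: "\<And>v w k \<alpha>. v \<in> W1p p \<Omega> \<Longrightarrow> w \<in> W1p p \<Omega> \<Longrightarrow> k \<in> W1p p \<Omega> \<Longrightarrow> 0 \<le> \<alpha> \<Longrightarrow>
    Lp_bounded p \<Omega> R (jet \<Omega> v) \<Longrightarrow> Lp_bounded p \<Omega> R (jet \<Omega> w) \<Longrightarrow>
    AE x in lebesgue_on \<Omega>. jet \<Omega> v x - jet \<Omega> w x = \<alpha> *\<^sub>R jet \<Omega> k x \<Longrightarrow>
    \<bar>?F v - ?F w\<bar> \<le> L * (\<alpha> * W1p_norm p \<Omega> k)"
    by (rule int_functional_lipschitz[OF \<Omega> p cond, where R = R]) blast
  have "\<forall>\<^sub>F \<alpha> in at_right 0. \<bar>(?F (\<lambda>x. u x + \<alpha> *\<^sub>R v x) - ?F u) / \<alpha> - D\<bar> < \<epsilon> / 2"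
    using tendstoD[OF D[unfolded has_dir_deriv_def], of "\<epsilon> / 2"] \<epsilon> by (simp add: dist_real_def)
  then obtain \<delta>1 where \<delta>1: "0 < \<delta>1"
    "\<And>\<alpha>. 0 < \<alpha> \<Longrightarrow> \<alpha> < \<delta>1 \<Longrightarrow> \<bar>(?F (\<lambda>x. u x + \<alpha> *\<^sub>R v x) - ?F u) / \<alpha> - D\<bar> < \<epsilon> / 2"
    unfolding eventually_at_right_field by blast
  \<comment> \<open>\<open>L + 1\<close> avoids a zero denominator and gives
    \<open>L * \<delta> \<le> \<epsilon> / 2\<close>; the bound \<open>1\<close> keeps all arguments
    where \<open>L\<close> is valid.\<close>
  define \<delta> where "\<delta> = min (min \<delta>1 1) (\<epsilon> / (2 * (L + 1)))"
  have \<delta>: "0 < \<delta>" "\<delta> \<le> \<delta>1" "\<delta> \<le> 1" "\<delta> \<le> \<epsilon> / (2 * (L + 1))" using \<delta>1(1) \<epsilon> L0 by (auto simp: \<delta>_def)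
  have L\<delta>: "L * \<delta> \<le> \<epsilon> / 2"
  proof -
    have "L * \<delta> \<le> (L + 1) * (\<epsilon> / (2 * (L + 1)))" using \<delta> L0 by (intro mult_mono) auto
    also have "\<dots> = \<epsilon> / 2" using L0 by (simp add: field_simps)
    finally show ?thesis .
  qed
  show ?thesis
  proof (intro exI[of _ \<delta>] conjI allI ballI impI \<delta>(1))
    fix \<alpha> w assume w: "w \<in> W1p p \<Omega>" and *: "0 < \<alpha> \<and> \<alpha> < \<delta> \<and> W1p_norm p \<Omega> (\<lambda>x. w x - v x) \<le> \<delta>"
    then have \<alpha>: "0 < \<alpha>" "\<alpha> < 1" "\<alpha> < \<delta>1" and n: "W1p_norm p \<Omega> (\<lambda>x. w x - v x) \<le> \<delta>" using \<delta> by auto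
    have Rv: "Lp_bounded p \<Omega> R (jet \<Omega> (\<lambda>x. u x + \<alpha> *\<^sub>R v x))"
    proof (rule Lp_bounded_mono)
      show "Lp_bounded p \<Omega> R4 (jet \<Omega> (\<lambda>x. u x + \<alpha> *\<^sub>R v x))"
        unfolding R4_def
      proof (rule Lp_bounded_add[OF R1 R2 jet_measurable[OF W1p_add_scale(1)[OF \<Omega> u v]]])
        show "AE x in lebesgue_on \<Omega>. norm (jet \<Omega> (\<lambda>x. u x + \<alpha> *\<^sub>R v x) x) \<le> norm (jet \<Omega> u x) + norm (jet \<Omega> v x)"
          using W1p_add_scale(2)[OF \<Omega> u v, of \<alpha>] by eventually_elim (simp add: norm_add_scale_le \<alpha>)
      qed
    qed (simp add: R_def)
    have Rw: "Lp_bounded p \<Omega> R (jet \<Omega> (\<lambda>x. u x + \<alpha> *\<^sub>R w x))" using R[OF w _ \<alpha>(1,2)] n \<delta> by simp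
    have "AE x in lebesgue_on \<Omega>. jet \<Omega> (\<lambda>x. u x + \<alpha> *\<^sub>R w x) x - jet \<Omega> (\<lambda>x. u x + \<alpha> *\<^sub>R v x) x =
        \<alpha> *\<^sub>R jet \<Omega> (\<lambda>x. w x - v x) x"
      using W1p_add_scale(2)[OF \<Omega> u w, of \<alpha>] W1p_add_scale(2)[OF \<Omega> u v, of \<alpha>] W1p_diff(2)[OF \<Omega> w v]
      by eventually_elim (simp add: scaleR_diff_right)
    from L[OF W1p_add_scale(1)[OF \<Omega> u w] W1p_add_scale(1)[OF \<Omega> u v] W1p_diff(1)[OF \<Omega> w v] _ Rw Rv this]
    have "\<bar>?F (\<lambda>x. u x + \<alpha> *\<^sub>R w x) - ?F (\<lambda>x. u x + \<alpha> *\<^sub>R v x)\<bar> \<le> L * (\<alpha> * W1p_norm p \<Omega> (\<lambda>x. w x - v x))"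
      using \<alpha> by simp
    also have "\<dots> \<le> L * (\<alpha> * \<delta>)" using n \<alpha> L0 by (intro mult_left_mono) auto
    also have "\<dots> \<le> \<alpha> * (\<epsilon> / 2)" using mult_left_mono[OF L\<delta>, of \<alpha>] \<alpha> by (simp add: mult_ac)
    finally have 1: "\<bar>(?F (\<lambda>x. u x + \<alpha> *\<^sub>R w x) - ?F (\<lambda>x. u x + \<alpha> *\<^sub>R v x)) / \<alpha>\<bar> \<le> \<epsilon> / 2"
      using \<alpha> by (simp add: abs_divide pos_divide_le_eq mult.commute)
    have 2: "(?F (\<lambda>x. u x + \<alpha> *\<^sub>R w x) - ?F u) / \<alpha> - D =
        (?F (\<lambda>x. u x + \<alpha> *\<^sub>R w x) - ?F (\<lambda>x. u x + \<alpha> *\<^sub>R v x)) / \<alpha> + ((?F (\<lambda>x. u x + \<alpha> *\<^sub>R v x) - ?F u) / \<alpha> - D)"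
      by (simp add: diff_divide_distrib)
    show "\<bar>(?F (\<lambda>x. u x + \<alpha> *\<^sub>R w x) - ?F u) / \<alpha> - D\<bar> < \<epsilon>"
      unfolding 2 using 1 \<delta>1(2)[OF \<alpha>(1,3)] by linarith
  qed
qed

theorem corollary2p9:
  fixes \<Omega> :: "(real^'d) set"
    and p :: ennreal
    and f :: "real^'d \<Rightarrow> (real^'m) \<times> (real^'d^'m) \<Rightarrow> real"
    and dlo dup :: "real^'d \<Rightarrow> (real^'m) \<times> (real^'d^'m) \<Rightarrow> (real \<times> (real^'m) \<times> (real^'d^'m)) set"
  assumes "open \<Omega>"
    and "1 \<le> p"
    and "codifferentiability_conditions p \<Omega> f dlo dup"
    and "1 < p \<or>
         (p = 1 \<and> bounded \<Omega> \<and> segment_property \<Omega> \<and>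
          constant_slope_hull \<Omega> dlo \<and> constant_slope_hull \<Omega> dup)"
  shows "(\<forall>u \<in> W1p p \<Omega>. integrable (lebesgue_on \<Omega>) (\<lambda>x. f x (u x, weak_grad \<Omega> u x))) \<and>
    locally_lipschitz (W1p p \<Omega>) (W1p_norm p \<Omega>) (int_functional \<Omega> f) \<and>
    (\<forall>u \<in> W1p p \<Omega>.
       hadamard_quasidifferentiable (W1p p \<Omega>) (W1p_norm p \<Omega>) (int_functional \<Omega> f) u \<and>
       is_quasidifferential (W1p p \<Omega>) (W1p_norm p \<Omega>) (int_functional \<Omega> f) u
         (functional_quasidiff p \<Omega> dlo u) (functional_quasidiff p \<Omega> dup u))"
proof -
  note \<Omega> = assms(1) and p = assms(2) and cond = assms(3)
  let ?N = "lebesgue_on \<Omega>" and ?X = "W1p p \<Omega> :: (real^'d \<Rightarrow> real^'m) set"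
  have f: "caratheodory_fun \<Omega> f" "growth_condition p \<Omega> f"
    and cod: "AE x in ?N. \<forall>y. is_codifferential (f x) y (dlo x y) (dup x y)"
    and G: "caratheodory_multifun \<Omega> dlo" "caratheodory_multifun \<Omega> dup"
    using cond by (auto simp: codifferentiability_conditions_def)
  have lo: "AE x in ?N. \<forall>y. compact (dlo x y) \<and> zero_slice (dlo x y) \<noteq> {} \<and> (\<forall>(a, v)\<in>dlo x y. 1 * a \<le> 0)"
    using cod by eventually_elim (use codifferential_zero_slices(1) in blast)
  have up: "AE x in ?N. \<forall>y. compact (dup x y) \<and> zero_slice (dup x y) \<noteq> {} \<and> (\<forall>(a, v)\<in>dup x y. - 1 * a \<le> 0)"
    using cod by eventually_elim (use codifferential_zero_slices(2) in blast)
  have cv: "AE x in ?N. \<forall>y. convex (dlo x y)" "AE x in ?N. \<forall>y. convex (dup x y)"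
    using cod by (auto elim!: eventually_mono simp: is_codifferential_def)
  have qd: "is_quasidifferential ?X (W1p_norm p \<Omega>) (int_functional \<Omega> f) u
         (functional_quasidiff p \<Omega> dlo u) (functional_quasidiff p \<Omega> dup u)" if u: "u \<in> ?X" for u
  proof -
    obtain R where "Lp_bounded p \<Omega> R (jet \<Omega> u)" using Lp_bounded_jet[OF p u] by blast
    \<comment> \<open>The weight is needed at the single point \<open>jet u\<close> only; the sum of
      its norm with itself is a real radius function that covers it.\<close>
    from Lp_bounded_norm_add[OF this this]
    obtain L M where M: "jet_weight p \<Omega> TYPE('m) L M" and GM: "AE x in ?N. \<forall>y a v.
        norm y \<le> norm (jet \<Omega> u x) + norm (jet \<Omega> u x) \<longrightarrow> (a, v) \<in> dlo x y \<union> dup x y \<longrightarrow> norm v \<le> M x"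
      using codifferentiability_weight[OF p cond] by blast
    have GM': "AE x in ?N. \<forall>a v. (a, v) \<in> dlo x (jet \<Omega> u x) \<longrightarrow> norm v \<le> M x"
      "AE x in ?N. \<forall>a v. (a, v) \<in> dup x (jet \<Omega> u x) \<longrightarrow> norm v \<le> M x"
    proof -
      have n: "norm (jet \<Omega> u x) \<le> norm (jet \<Omega> u x) + norm (jet \<Omega> u x)" for x by simp
      show "AE x in ?N. \<forall>a v. (a, v) \<in> dlo x (jet \<Omega> u x) \<longrightarrow> norm v \<le> M x"
        using GM by eventually_elim (use n in blast)
      show "AE x in ?N. \<forall>a v. (a, v) \<in> dup x (jet \<Omega> u x) \<longrightarrow> norm v \<le> M x"
        using GM by eventually_elim (use n in blast)
    qed
    define S where "S G h = (LINT x|?N. support_fun (zero_slice (G x (jet \<Omega> u x))) (jet \<Omega> h x))"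
      for G :: "real^'d \<Rightarrow> (real^'m) \<times> (real^'d^'m) \<Rightarrow> (real \<times> (real^'m) \<times> (real^'d^'m)) set" and h
    note P = functional_quasidiff_half[OF \<Omega> G(1) _ lo cv(1) u M GM'(1), folded S_def, simplified]
    note Q = functional_quasidiff_half[OF \<Omega> G(2) _ up cv(2) u M GM'(2), folded S_def, simplified]
    \<comment> \<open>Attainment at the zero function shows that both sets are nonempty.\<close>
    have 0: "(\<lambda>_. 0) \<in> ?X" by (rule fun_subspace_0[OF fun_subspace_W1p[OF \<Omega>]])
    have "has_dir_deriv (int_functional \<Omega> f) u h
        ((SUP \<phi>\<in>functional_quasidiff p \<Omega> dlo u. \<phi> h) + (INF \<psi>\<in>functional_quasidiff p \<Omega> dup u. \<psi> h))"
      if h: "h \<in> ?X" for h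
    proof -
      have sup: "(SUP \<phi>\<in>functional_quasidiff p \<Omega> dlo u. \<phi> h) = S dlo h"
      proof (rule cSup_eq_maximum)
        show "S dlo h \<in> (\<lambda>\<phi>. \<phi> h) ` functional_quasidiff p \<Omega> dlo u"
          using P(4)[OF h] by (metis image_eqI)
        show "t \<le> S dlo h" if "t \<in> (\<lambda>\<phi>. \<phi> h) ` functional_quasidiff p \<Omega> dlo u" for t
          using that P(3)[OF _ h] by blast
      qed
      \<comment> \<open>The minimum at \<open>h\<close> is minus the maximum at \<open>- h\<close>.
        The scalar multiple is kept visible so that homogeneity of dual elements applies.\<close>
      let ?k = "\<lambda>x. - 1 *\<^sub>R h x"
      have k: "?k \<in> ?X" by (rule W1p_scale(1)[OF \<Omega> h])
      have neg: "\<psi> ?k = - \<psi> h" if "\<psi> \<in> functional_quasidiff p \<Omega> dup u" for \<psi>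
      proof -
        have "\<forall>c. \<forall>u\<in>?X. \<psi> (\<lambda>x. c *\<^sub>R u x) = c * \<psi> u"
          using that by (simp add: functional_quasidiff_def dual_space_def)
        from bspec[OF spec[OF this, of "-1"] h] show ?thesis by simp
      qed
      have inf: "(INF \<psi>\<in>functional_quasidiff p \<Omega> dup u. \<psi> h) = - S dup ?k"
      proof (rule cInf_eq_minimum)
        obtain \<psi> where \<psi>: "\<psi> \<in> functional_quasidiff p \<Omega> dup u" "\<psi> ?k = S dup ?k" using Q(4)[OF k] by blast
        have "S dup ?k = - \<psi> h" using neg[OF \<psi>(1)] unfolding \<psi>(2) .
        then have "- S dup ?k = \<psi> h" by simp
        then show "- S dup ?k \<in> (\<lambda>\<psi>. \<psi> h) ` functional_quasidiff p \<Omega> dup u" using \<psi>(1) by (rule image_eqI)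
        show "- S dup ?k \<le> t" if "t \<in> (\<lambda>\<psi>. \<psi> h) ` functional_quasidiff p \<Omega> dup u" for t
          using that Q(3)[OF _ k] neg by force
      qed
      \<comment> \<open>The weak gradient chosen for \<open>- h\<close> agrees with the negative of
        the one chosen for \<open>h\<close> only almost everywhere.\<close>
      have ae: "AE x in ?N. support_fun (zero_slice (dup x (jet \<Omega> u x))) (jet \<Omega> ?k x) =
          support_fun (zero_slice (dup x (jet \<Omega> u x))) (- jet \<Omega> h x)"
        using W1p_scale(2)[OF \<Omega> h, of "-1"] by eventually_elim simp
      have m: "(\<lambda>x. support_fun (zero_slice (dup x (jet \<Omega> u x))) (- jet \<Omega> h x)) \<in> borel_measurable ?N"
        using measurable_lebesgue_on_AE_eq[OF _ borel_measurable_integrable[OF Q(5)[OF k]] ae] \<Omega> by simp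
      have i: "integrable ?N (\<lambda>x. support_fun (zero_slice (dup x (jet \<Omega> u x))) (- jet \<Omega> h x))"
        using integrable_cong_AE[OF borel_measurable_integrable[OF Q(5)[OF k]] m ae] Q(5)[OF k] by simp
      have "S dup ?k = (LINT x|?N. support_fun (zero_slice (dup x (jet \<Omega> u x))) (- jet \<Omega> h x))"
        unfolding S_def using ae m borel_measurable_integrable[OF Q(5)[OF k]] by (intro integral_cong_AE)
      then have "(SUP \<phi>\<in>functional_quasidiff p \<Omega> dlo u. \<phi> h) + (INF \<psi>\<in>functional_quasidiff p \<Omega> dup u. \<psi> h) =
          (LINT x|?N. support_fun (zero_slice (dlo x (jet \<Omega> u x))) (jet \<Omega> h x) -
            support_fun (zero_slice (dup x (jet \<Omega> u x))) (- jet \<Omega> h x))"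
        unfolding sup inf using P(5)[OF h] i by (simp add: S_def)
      then show ?thesis
        using int_functional_has_dir_deriv[OF \<Omega> p cond u h]
          borel_measurable_diff[OF borel_measurable_integrable[OF P(5)[OF h]] m] by simp
    qed
    then show ?thesis
      unfolding is_quasidifferential_def using P(1,2) Q(1,2) P(4)[OF 0] Q(4)[OF 0] by blast
  qed
  have "hadamard_quasidifferentiable ?X (W1p_norm p \<Omega>) (int_functional \<Omega> f) u" if u: "u \<in> ?X" for u
    unfolding hadamard_quasidifferentiable_def
  proof (intro conjI ballI)
    show "\<exists>P Q. is_quasidifferential ?X (W1p_norm p \<Omega>) (int_functional \<Omega> f) u P Q" using qd[OF u] by blast
    fix v assume v: "v \<in> ?X"
    with qd[OF u] obtain D where D: "has_dir_deriv (int_functional \<Omega> f) u v D"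
      unfolding is_quasidifferential_def by blast
    show "\<exists>D. has_dir_deriv (int_functional \<Omega> f) u v D \<and>
        (\<forall>\<epsilon>>0. \<exists>\<delta>>0. \<forall>\<alpha>. \<forall>w\<in>?X. 0 < \<alpha> \<and> \<alpha> < \<delta> \<and> W1p_norm p \<Omega> (\<lambda>x. w x - v x) \<le> \<delta> \<longrightarrow>
           \<bar>(int_functional \<Omega> f (\<lambda>x. u x + \<alpha> *\<^sub>R w x) - int_functional \<Omega> f u) / \<alpha> - D\<bar> < \<epsilon>)"
      using D int_functional_hadamard[OF \<Omega> p cond u v D] by blast
  qed
  then show ?thesis
    using integrable_growth[OF \<Omega> p f] int_functional_locally_lipschitz[OF \<Omega> p cond] qd
    by (simp add: jet_def)
qed

end
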